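(* Let $\theta$ be an inner function in the unit disk. 1) If $A$ is a bounded truncated Toeplitz operator on $K_\theta$ which is nonnegative (i.e. $(Af,f)\ge 0$ for all $f\in K_\theta$), then $A$ admits a quasisymbol which is a nonnegative measure $\mu\in\mathcal C_2^+(\theta)$. 2) Every bounded truncated Toeplitz operator $A$ on $K_\theta$ admits a quasisymbol $\mu\in\mathcal C_2(\theta)$.
   Context: $\mathbb D$ is the open unit disk, $\mathbb T$ the unit circle, $m$ normalized Lebesgue measure on $\mathbb T$, $L^p=L^p(\mathbb T,m)$, $H^p$ the Hardy space in $\mathbb D$ (functions identified with their nontangential boundary values on $\mathbb T$), $H^p_-=\overline{zH^p}$. For an inner function $\theta$, $K^p_\theta=H^p\cap\theta H^p_-$ and $K_\theta=K^2_\theta=H^2\ominus\theta H^2$; $P_\theta$ is the orthogonal projection of $L^2$ onto $K_\theta$, and $(\cdot,\cdot)$ is the $L^2(m)$ inner product. Truncated Toeplitz operators: for $\varphi\in L^2$, $A_\varphi f=P_\theta(\varphi f)$ for $f\in K_\theta\cap L^\infty$. If $A_\varphi$ extends to a bounded operator on $K_\theta$, the extension is called a bounded truncated Toeplitz operator on $K_\theta$ with symbol $\varphi$. Measures: $\mathcal C_p(\theta)$ ($1\le p<\infty$) is the set of finite complex Borel measures $\mu$ on $\mathbb T$ for which the embedding $K^p_\theta\subset L^p(|\mu|)$ holds, i.e. there is $C$ with $\|f\|_{L^p(|\mu|)}\le C\|f\|_p$ for all $f\in K^p_\theta$ that are continuous on $\overline{\mathbb D}$ (such $f$ are dense in $K^p_\theta$);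 here $|\mu|$ is the total variation. $\mathcal C_p^+(\theta)$ is the set of nonnegative measures in $\mathcal C_p(\theta)$. Quasisymbol: a complex measure $\mu$ on $\mathbb T$ of finite total variation is a quasisymbol of a truncated Toeplitz operator $A$ on $K_\theta$ if $(Af,g)=\int f\bar g\,d\mu$ for all $f,g\in K_\theta$ that are continuous on $\overline{\mathbb D}$. *)

theory Defs
  imports "HOL-Complex_Analysis.Complex_Analysis" "HOL-Probability.Probability"
begin

text \<open>
  Elements of function spaces are represented by functions \<open>complex \<Rightarrow> complex\<close>, and equality in
  the space is equality almost everywhere on the unit circle. A function in a Hardy space is given
  on the closed disc: on the open disc it is the analytic function itself, on the circle
  (a Borel representative of) its nontangential boundary values. Values outside the closed disc
  play no role.
\<close>

abbreviation disc :: "complex set" where "disc \<equiv> ball 0 1"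
abbreviation circle :: "complex set" where "circle \<equiv> sphere 0 1"

abbreviation circle_borel :: "complex measure" where
  "circle_borel \<equiv> restrict_space borel circle"

text \<open>Normalized Lebesgue measure on the circle.\<close>

definition circle_measure :: "complex measure" where
  "circle_measure = distr (uniform_measure lborel {0..<2 * pi}) circle_borel cis"

definition Lp_space :: "real \<Rightarrow> (complex \<Rightarrow> complex) set" where
  "Lp_space p = {f \<in> borel_measurable circle_measure.
     integrable circle_measure (\<lambda>z. norm (f z) powr p)}"

definition Linf_space :: "(complex \<Rightarrow> complex) set" where
  "Linf_space = {f \<in> borel_measurable circle_measure.
     \<exists>C. AE z in circle_measure. norm (f z) \<le> C}"

definition Lp_norm :: "complex measure \<Rightarrow> real \<Rightarrow> (complex \<Rightarrow> complex) \<Rightarrow> real" where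
  "Lp_norm M p f = (\<integral>z. norm (f z) powr p \<partial>M) powr (1 / p)"

definition L2_inner :: "(complex \<Rightarrow> complex) \<Rightarrow> (complex \<Rightarrow> complex) \<Rightarrow> complex" where
  "L2_inner f g = (\<integral>z. f z * cnj (g z) \<partial>circle_measure)"


section \<open>Hardy spaces, inner functions and model spaces\<close>

definition stolz_region :: "real \<Rightarrow> complex \<Rightarrow> complex set" where
  "stolz_region \<alpha> \<zeta> = {z \<in> disc. dist z \<zeta> < \<alpha> * (1 - norm z)}"

definition has_nontangential_limit :: "(complex \<Rightarrow> complex) \<Rightarrow> complex \<Rightarrow> complex \<Rightarrow> bool" where
  "has_nontangential_limit f l \<zeta> \<longleftrightarrow> (\<forall>\<alpha>>1. (f \<longlongrightarrow> l) (at \<zeta> within stolz_region \<alpha> \<zeta>))"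

text \<open>The values of \<open>f\<close> on the circle are the boundary values of its restriction to the disc.\<close>

definition has_own_boundary_values :: "(complex \<Rightarrow> complex) \<Rightarrow> bool" where
  "has_own_boundary_values f \<longleftrightarrow> f \<in> borel_measurable circle_measure \<and>
     (AE \<zeta> in circle_measure. has_nontangential_limit f (f \<zeta>) \<zeta>)"

definition Hardy :: "real \<Rightarrow> (complex \<Rightarrow> complex) set" where
  "Hardy p = {f. f holomorphic_on disc \<and>
     (\<exists>C. \<forall>r. 0 \<le> r \<and> r < 1 \<longrightarrow>
        (\<integral>z. norm (f (of_real r * z)) powr p \<partial>circle_measure) \<le> C) \<and>
     has_own_boundary_values f}"

text \<open>\<open>H\<^sup>p\<^sub>-\<close>, the complex conjugates of functions in \<open>z H\<^sup>p\<close>.\<close>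

definition Hardy_minus :: "real \<Rightarrow> (complex \<Rightarrow> complex) set" where
  "Hardy_minus p = {g \<in> borel_measurable circle_measure.
     \<exists>h \<in> Hardy p. AE z in circle_measure. g z = cnj (z * h z)}"

definition inner_function :: "(complex \<Rightarrow> complex) \<Rightarrow> bool" where
  "inner_function \<theta> \<longleftrightarrow> \<theta> holomorphic_on disc \<and> bounded (\<theta> ` disc) \<and>
     has_own_boundary_values \<theta> \<and> (AE z in circle_measure. norm (\<theta> z) = 1)"

definition model_space :: "real \<Rightarrow> (complex \<Rightarrow> complex) \<Rightarrow> (complex \<Rightarrow> complex) set" where
  "model_space p \<theta> = {f \<in> Hardy p. \<exists>g \<in> Hardy_minus p.
     AE z in circle_measure. f z = \<theta> z * g z}"

text \<open>The orthogonal projection of \<open>L\<^sup>2\<close> onto \<open>K\<^sub>\<theta>\<close>; the choice is only between representatives.\<close>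

definition model_proj :: "(complex \<Rightarrow> complex) \<Rightarrow> (complex \<Rightarrow> complex) \<Rightarrow> complex \<Rightarrow> complex" where
  "model_proj \<theta> h = (SOME k. k \<in> model_space 2 \<theta> \<and>
     (\<forall>g \<in> model_space 2 \<theta>. L2_inner (\<lambda>z. h z - k z) g = 0))"


section \<open>Truncated Toeplitz operators\<close>

text \<open>
  Linearity and boundedness imply that the operator respects equality almost everywhere on
  the circle.
\<close>

definition bounded_operator_on_model_space ::
    "(complex \<Rightarrow> complex) \<Rightarrow> ((complex \<Rightarrow> complex) \<Rightarrow> complex \<Rightarrow> complex) \<Rightarrow> bool" where
  "bounded_operator_on_model_space \<theta> A \<longleftrightarrow>
     (\<forall>f \<in> model_space 2 \<theta>. A f \<in> model_space 2 \<theta>) \<and>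
     (\<forall>f \<in> model_space 2 \<theta>. \<forall>g \<in> model_space 2 \<theta>.
        AE z in circle_measure. A (\<lambda>w. f w + g w) z = A f z + A g z) \<and>
     (\<forall>c. \<forall>f \<in> model_space 2 \<theta>. AE z in circle_measure. A (\<lambda>w. c * f w) z = c * A f z) \<and>
     (\<exists>C. \<forall>f \<in> model_space 2 \<theta>.
        Lp_norm circle_measure 2 (A f) \<le> C * Lp_norm circle_measure 2 f)"

definition bounded_TTO ::
    "(complex \<Rightarrow> complex) \<Rightarrow> ((complex \<Rightarrow> complex) \<Rightarrow> complex \<Rightarrow> complex) \<Rightarrow> bool" where
  "bounded_TTO \<theta> A \<longleftrightarrow> bounded_operator_on_model_space \<theta> A \<and>
     (\<exists>\<phi> \<in> Lp_space 2. \<forall>f \<in> model_space 2 \<theta> \<inter> Linf_space.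
        AE z in circle_measure. A f z = model_proj \<theta> (\<lambda>w. \<phi> w * f w) z)"

definition nonneg_operator ::
    "(complex \<Rightarrow> complex) \<Rightarrow> ((complex \<Rightarrow> complex) \<Rightarrow> complex \<Rightarrow> complex) \<Rightarrow> bool" where
  "nonneg_operator \<theta> A \<longleftrightarrow> (\<forall>f \<in> model_space 2 \<theta>. L2_inner (A f) f \<in> \<real>\<^sub>\<ge>\<^sub>0)"


section \<open>Complex measures on the circle\<close>

text \<open>
  A complex measure is a countably additive complex set function on the Borel sets of the circle
  (its values on other sets play no role). Finiteness of the total variation is automatic.
\<close>

definition complex_measure_on_circle :: "(complex set \<Rightarrow> complex) \<Rightarrow> bool" where
  "complex_measure_on_circle \<mu> \<longleftrightarrow>
     (\<forall>E :: nat \<Rightarrow> complex set. range E \<subseteq> sets circle_borel \<and> disjoint_family E \<longrightarrow>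
        (\<lambda>i. \<mu> (E i)) sums \<mu> (\<Union>i. E i))"

definition total_variation :: "(complex set \<Rightarrow> complex) \<Rightarrow> complex measure" where
  "total_variation \<mu> = measure_of circle (sets circle_borel)
     (\<lambda>S. SUP E \<in> {E :: nat \<Rightarrow> complex set. range E \<subseteq> sets circle_borel \<and>
                   disjoint_family E \<and> (\<Union>i. E i) = S}.
            (\<Sum>i. ennreal (norm (\<mu> (E i)))))"

text \<open>
  The positive part in the Jordan decomposition of a real measure \<open>\<nu>\<close>; the negative part is
  the positive part of \<open>-\<nu>\<close>. Note that \<open>ennreal\<close> sends negative numbers to \<open>0\<close>.
\<close>

definition jordan_pos :: "(complex set \<Rightarrow> real) \<Rightarrow> complex measure" where
  "jordan_pos \<nu> = measure_of circle (sets circle_borel)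
     (\<lambda>S. SUP E \<in> {E \<in> sets circle_borel. E \<subseteq> S}. ennreal (\<nu> E))"

definition cm_integral :: "(complex set \<Rightarrow> complex) \<Rightarrow> (complex \<Rightarrow> complex) \<Rightarrow> complex" where
  "cm_integral \<mu> f =
     ((\<integral>z. f z \<partial>jordan_pos (\<lambda>E. Re (\<mu> E))) - (\<integral>z. f z \<partial>jordan_pos (\<lambda>E. - Re (\<mu> E)))) +
     \<i> * ((\<integral>z. f z \<partial>jordan_pos (\<lambda>E. Im (\<mu> E))) - (\<integral>z. f z \<partial>jordan_pos (\<lambda>E. - Im (\<mu> E))))"

definition nonneg_measure :: "(complex set \<Rightarrow> complex) \<Rightarrow> bool" where
  "nonneg_measure \<mu> \<longleftrightarrow> (\<forall>E \<in> sets circle_borel. \<mu> E \<in> \<real>\<^sub>\<ge>\<^sub>0)"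

definition Carleson :: "real \<Rightarrow> (complex \<Rightarrow> complex) \<Rightarrow> (complex set \<Rightarrow> complex) set" where
  "Carleson p \<theta> = {\<mu>. complex_measure_on_circle \<mu> \<and>
     (\<exists>C. \<forall>f \<in> model_space p \<theta>. continuous_on (cball 0 1) f \<longrightarrow>
        Lp_norm (total_variation \<mu>) p f \<le> C * Lp_norm circle_measure p f)}"

definition Carleson_nonneg :: "real \<Rightarrow> (complex \<Rightarrow> complex) \<Rightarrow> (complex set \<Rightarrow> complex) set" where
  "Carleson_nonneg p \<theta> = {\<mu> \<in> Carleson p \<theta>. nonneg_measure \<mu>}"

definition quasisymbol :: "(complex \<Rightarrow> complex) \<Rightarrow>
    ((complex \<Rightarrow> complex) \<Rightarrow> complex \<Rightarrow> complex) \<Rightarrow> (complex set \<Rightarrow> complex) \<Rightarrow> bool" where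
  "quasisymbol \<theta> A \<mu> \<longleftrightarrow> complex_measure_on_circle \<mu> \<and>
     (\<forall>f \<in> model_space 2 \<theta>. \<forall>g \<in> model_space 2 \<theta>.
        continuous_on (cball 0 1) f \<longrightarrow> continuous_on (cball 0 1) g \<longrightarrow>
        L2_inner (A f) g = cm_integral \<mu> (\<lambda>z. f z * cnj (g z)))"

end

theory Submission
  imports Defs "HOL-Real_Asymp.Real_Asymp"
begin

text \<open>
  Let \<open>\<phi>\<close> be a symbol of \<open>A \<ge> 0\<close>. The functional \<open>F \<mapsto> \<integral> \<phi> F dm\<close> on the real bounded functions \<open>F\<close> with
  \<open>\<theta> * cnj z * F\<close> in \<open>H\<^sup>2\<close> is positive: if \<open>F\<close> is bounded below by a positive constant, then Szego's
  factorization gives \<open>F = norm h ^ 2\<close> with a bounded \<open>h\<close> in \<open>K\<^sub>\<theta>\<close>, so that the integral is \<open>(A h, h)\<close>.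
  Unless \<open>\<theta>\<close> is constant, this space contains the function \<open>norm (1 - cnj (\<theta> 0) * \<theta>) ^ 2\<close>, which is bounded below, so by the Hahn-Banach theorem
  the functional is compatible with a positive functional on the continuous functions, that is a measure \<open>\<mu>\<close>.
  For continuous \<open>f\<close> in \<open>K\<^sub>\<theta>\<close> it satisfies \<open>\<integral> norm f ^ 2 d\<mu> = (A f, f)\<close>, which is both the
  Carleson estimate and, by polarization, the quasisymbol property. A general operator is a combination of
  nonnegative ones and the identity.
\<close>

section \<open>Square integrable functions\<close>

text \<open>A symbol \<open>\<phi>\<close> is only in \<open>L^2\<close>, so
  \<open>\<phi> * F\<close> is integrated against bounded \<open>F\<close> only, and the form of
  \<open>A\<close> is known on genuine elements of the model space, whereas Szego's factorization
  yields merely a boundary function. Fatou's theorem closes this gap: it turns a function described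
  by its Fourier coefficients into an analytic one with these boundary values, and the Hilbert space
  part can then be done on the circle alone (\<open>H2b\<close>, \<open>Kb\<close>). The functions
  on which positivity is known need not be continuous, so the functional is not given on a subspace
  of the continuous functions. Instead, for continuous \<open>u\<close>, \<open>p u\<close> is the
  infimum of the functional over the admissible majorants of \<open>u\<close>. It is sublinear, and
  a linear \<open>l \<le> p\<close> is automatically positive. If \<open>u = norm h ^ 2\<close> is
  itself admissible, the bounds for \<open>u\<close> and \<open>- u\<close> together force
  \<open>l u\<close> to have the right value. Positivity concerns real symbols, so a complex symbol
  is split into its real and imaginary parts. For \<open>A \<ge> 0\<close> the form of the imaginary
  part vanishes.\<close>

definition L2 :: "'a measure \<Rightarrow> ('a \<Rightarrow> complex) set" where
  "L2 M = {f \<in> borel_measurable M. integrable M (\<lambda>x. (norm (f x))\<^sup>2)}"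

definition L2_ip :: "'a measure \<Rightarrow> ('a \<Rightarrow> complex) \<Rightarrow> ('a \<Rightarrow> complex) \<Rightarrow> complex" where
  "L2_ip M f g = (\<integral>x. f x * cnj (g x) \<partial>M)"

definition L2_sq :: "'a measure \<Rightarrow> ('a \<Rightarrow> complex) \<Rightarrow> real" where
  "L2_sq M f = (\<integral>x. (norm (f x))\<^sup>2 \<partial>M)"

lemma norm_add_sq_le: "(norm (a + b :: complex))\<^sup>2 \<le> 2 * (norm a)\<^sup>2 + 2 * (norm b)\<^sup>2"
proof -
  have "(norm (a + b))\<^sup>2 \<le> (norm a + norm b)\<^sup>2"
    by (intro power_mono norm_triangle_ineq) auto
  also have "\<dots> \<le> 2 * (norm a)\<^sup>2 + 2 * (norm b)\<^sup>2"
    using sum_squares_bound[of "norm a" "norm b"] by (simp add: power2_sum)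
  finally show ?thesis .
qed

lemma borel_measurable_cnj [measurable]:
  "f \<in> borel_measurable M \<Longrightarrow> (\<lambda>x. cnj (f x)) \<in> borel_measurable M"
  by (rule borel_measurable_continuous_on[where f = cnj]) (auto intro: continuous_intros)

lemma L2_measurable [measurable_dest]: "f \<in> L2 M \<Longrightarrow> f \<in> borel_measurable M"
  by (simp add: L2_def)

lemma L2_integrable_sq: "f \<in> L2 M \<Longrightarrow> integrable M (\<lambda>x. (norm (f x))\<^sup>2)"
  by (simp add: L2_def)

lemma L2_bound:
  assumes "g \<in> L2 M" "f \<in> borel_measurable M" "AE x in M. norm (f x) \<le> C * norm (g x)"
  shows "f \<in> L2 M"
proof -
  note [measurable] = assms(2)
  have "integrable M (\<lambda>x. C\<^sup>2 * (norm (g x))\<^sup>2)"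
    using assms(1) by (intro integrable_mult_right) (auto simp: L2_def)
  then have "integrable M (\<lambda>x. (norm (f x))\<^sup>2)"
  proof (rule Bochner_Integration.integrable_bound)
    show "AE x in M. norm ((norm (f x))\<^sup>2) \<le> norm (C\<^sup>2 * (norm (g x))\<^sup>2)"
      using assms(3)
    proof eventually_elim
      case (elim x)
      then have "(norm (f x))\<^sup>2 \<le> (C * norm (g x))\<^sup>2" by (intro power_mono) auto
      then show ?case by (simp add: power_mult_distrib)
    qed
  qed simp
  then show ?thesis using assms(2) by (simp add: L2_def)
qed

lemma L2_add: assumes "f \<in> L2 M" "g \<in> L2 M" shows "(\<lambda>x. f x + g x) \<in> L2 M"
proof -
  note [measurable] = assms[THEN L2_measurable]
  have "integrable M (\<lambda>x. 2 * (norm (f x))\<^sup>2 + 2 * (norm (g x))\<^sup>2)"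
    using assms by (intro Bochner_Integration.integrable_add integrable_mult_right) (auto simp: L2_def)
  then have "integrable M (\<lambda>x. (norm (f x + g x))\<^sup>2)"
    by (rule Bochner_Integration.integrable_bound) (auto intro: norm_add_sq_le order_trans)
  then show ?thesis by (simp add: L2_def)
qed

lemma L2_cmult: "f \<in> L2 M \<Longrightarrow> (\<lambda>x. c * f x) \<in> L2 M"
  by (rule L2_bound[where C = "norm c" and g = f]) (auto simp: norm_mult)

lemma L2_mult_bounded:
  assumes "f \<in> L2 M" "g \<in> borel_measurable M" "AE x in M. norm (g x) \<le> C"
  shows "(\<lambda>x. g x * f x) \<in> L2 M" "(\<lambda>x. f x * g x) \<in> L2 M"
proof -
  note [measurable] = assms(2) assms(1)[THEN L2_measurable]
  have *: "AE x in M. norm (g x * f x) \<le> C * norm (f x)"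
    using assms(3) by eventually_elim (auto simp: norm_mult intro: mult_right_mono)
  show "(\<lambda>x. g x * f x) \<in> L2 M"
    by (rule L2_bound[OF assms(1) _ *]) simp
  then show "(\<lambda>x. f x * g x) \<in> L2 M" by (simp add: mult.commute)
qed

lemma L2_diff: "f \<in> L2 M \<Longrightarrow> g \<in> L2 M \<Longrightarrow> (\<lambda>x. f x - g x) \<in> L2 M"
  using L2_add[of f M "\<lambda>x. -1 * g x"] L2_cmult[of g M "-1"] by simp

lemma L2_cnj: "f \<in> L2 M \<Longrightarrow> (\<lambda>x. cnj (f x)) \<in> L2 M"
  by (rule L2_bound[where C = 1 and g = f]) auto

lemma L2_AE_cong:
  assumes "f \<in> L2 M" "g \<in> borel_measurable M" "AE x in M. f x = g x"
  shows "g \<in> L2 M"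
  by (rule L2_bound[OF assms(1,2), where C = 1]) (use assms(3) in auto)

lemma L2_mult_integrable:
  assumes "f \<in> L2 M" "g \<in> L2 M" shows "integrable M (\<lambda>x. f x * g x)"
proof -
  note [measurable] = assms[THEN L2_measurable]
  have "integrable M (\<lambda>x. (norm (f x))\<^sup>2 + (norm (g x))\<^sup>2)"
    using assms by (intro Bochner_Integration.integrable_add) (auto simp: L2_def)
  then show ?thesis
  proof (rule Bochner_Integration.integrable_bound)
    have "norm (a * b) \<le> norm ((norm a)\<^sup>2 + (norm b)\<^sup>2)" for a b :: complex
    proof -
      have "0 \<le> norm a * norm b" by simp
      then have "norm a * norm b \<le> (norm a)\<^sup>2 + (norm b)\<^sup>2"
        using sum_squares_bound[of "norm a" "norm b"] by linarith
      then show ?thesis by (simp add: norm_mult)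
    qed
    then show "AE x in M. norm (f x * g x) \<le> norm ((norm (f x))\<^sup>2 + (norm (g x))\<^sup>2)"
      by auto
  qed simp
qed

lemma ip_integrable:
  assumes "f \<in> L2 M" "g \<in> L2 M" shows "integrable M (\<lambda>x. f x * cnj (g x))"
  using L2_mult_integrable[OF assms(1) L2_cnj[OF assms(2)]] .

lemma ip_add_left:
  assumes "f \<in> L2 M" "g \<in> L2 M" "h \<in> L2 M"
  shows "L2_ip M (\<lambda>x. f x + g x) h = L2_ip M f h + L2_ip M g h"
  unfolding L2_ip_def by (simp add: ring_distribs ip_integrable assms)

lemma ip_diff_left:
  assumes "f \<in> L2 M" "g \<in> L2 M" "h \<in> L2 M"
  shows "L2_ip M (\<lambda>x. f x - g x) h = L2_ip M f h - L2_ip M g h"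
  unfolding L2_ip_def by (simp add: ring_distribs ip_integrable assms)

lemma ip_mult_left: "L2_ip M (\<lambda>x. c * f x) h = c * L2_ip M f h"
  unfolding L2_ip_def by (simp add: mult.assoc)

lemma ip_cnj: "L2_ip M g f = cnj (L2_ip M f g)"
  unfolding L2_ip_def using Bochner_Integration.integral_cnj[of M "\<lambda>x. f x * cnj (g x)"] by (simp add: mult.commute)

lemma L2_sq_nonneg: "L2_sq M f \<ge> 0"
  by (simp add: L2_sq_def)

lemma ip_AE_cong:
  assumes "AE x in M. f x = f' x" "AE x in M. g x = g' x"
   and [measurable]: "f \<in> borel_measurable M" "g \<in> borel_measurable M"
       "f' \<in> borel_measurable M" "g' \<in> borel_measurable M"
  shows "L2_ip M f g = L2_ip M f' g'"
  unfolding L2_ip_def by (rule integral_cong_AE) (measurable, use assms(1,2) in auto)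

lemma L2_sq_zero_iff: "f \<in> L2 M \<Longrightarrow> L2_sq M f = 0 \<longleftrightarrow> (AE x in M. f x = 0)"
  unfolding L2_sq_def by (subst integral_nonneg_eq_0_iff_AE) (auto simp: L2_def)

lemma L2_sq_diff_mult:
  assumes "f \<in> L2 M" "g \<in> L2 M"
  shows "L2_sq M (\<lambda>x. f x - c * g x) = L2_sq M f - 2 * Re (cnj c * L2_ip M f g) + (norm c)\<^sup>2 * L2_sq M g"
proof -
  define R where "R x = Re (cnj c * (f x * cnj (g x)))" for x
  have "(norm (f x - c * g x))\<^sup>2 = (norm (f x))\<^sup>2 - 2 * R x + (norm c)\<^sup>2 * (norm (g x))\<^sup>2" for x
    unfolding cmod_power2 R_def by (simp add: power2_eq_square algebra_simps)
  then have "L2_sq M (\<lambda>x. f x - c * g x) =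
      (\<integral>x. (norm (f x))\<^sup>2 - 2 * R x + (norm c)\<^sup>2 * (norm (g x))\<^sup>2 \<partial>M)"
    by (simp add: L2_sq_def)
  also have "\<dots> = L2_sq M f - 2 * (\<integral>x. R x \<partial>M) + (norm c)\<^sup>2 * L2_sq M g"
  proof -
    have "integrable M R"
      unfolding R_def using assms by (intro integrable_Re integrable_mult_right ip_integrable)
    then show ?thesis using assms by (simp add: L2_sq_def L2_integrable_sq)
  qed
  also have "(\<integral>x. R x \<partial>M) = Re (cnj c * L2_ip M f g)"
    unfolding R_def using assms
    by (subst integral_Re) (auto simp: ip_integrable integrable_mult_right L2_ip_def simp del: times_complex.sel)
  finally show ?thesis .
qed

lemma ip_zero_right: "AE x in M. g x = 0 \<Longrightarrow> L2_ip M f g = 0"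
  unfolding L2_ip_def by (rule integral_eq_zero_AE) auto

lemma L2_Cauchy_Schwarz:
  assumes "f \<in> L2 M" "g \<in> L2 M"
  shows "(norm (L2_ip M f g))\<^sup>2 \<le> L2_sq M f * L2_sq M g"
proof (cases "L2_sq M g = 0")
  case True
  then show ?thesis using assms by (simp add: L2_sq_zero_iff ip_zero_right L2_sq_nonneg)
next
  case False
  then have pos: "L2_sq M g > 0" using L2_sq_nonneg[of M g] by simp
  define c where "c = L2_ip M f g / L2_sq M g"
  have "0 \<le> L2_sq M f - 2 * Re (cnj c * L2_ip M f g) + (norm c)\<^sup>2 * L2_sq M g"
    using L2_sq_diff_mult[OF assms, of c] L2_sq_nonneg by metis
  moreover have "Re (cnj c * L2_ip M f g) = (norm (L2_ip M f g))\<^sup>2 / L2_sq M g"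
    unfolding c_def cmod_power2 by (simp add: power2_eq_square add_divide_distrib)
  moreover have "(norm c)\<^sup>2 * L2_sq M g = (norm (L2_ip M f g))\<^sup>2 / L2_sq M g"
    using pos by (simp add: c_def norm_divide power_divide power2_eq_square)
  ultimately have "(norm (L2_ip M f g))\<^sup>2 / L2_sq M g \<le> L2_sq M f" by simp
  then show ?thesis using pos by (simp add: divide_le_eq)
qed

section \<open>Completeness and orthogonal projection\<close>

lemma nn_integral_L2_sq:
  "f \<in> L2 M \<Longrightarrow> (\<integral>\<^sup>+x. ennreal ((norm (f x))\<^sup>2) \<partial>M) = ennreal (L2_sq M f)"
  unfolding L2_sq_def by (rule nn_integral_eq_integral) (auto simp: L2_def)

text \<open>Completeness for sequences with a geometric rate: this is the rate of a minimizing
  sequence whose squared distances are within \<open>(1/4)^n\<close> of the infimum, so no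
  subsequence has to be chosen. The rate leaves room for weights \<open>2^n\<close>, under which the
  squared increments are still summable almost everywhere.\<close>

lemma L2_fast_Cauchy_limit:
  fixes v :: "nat \<Rightarrow> 'a \<Rightarrow> complex"
  assumes v: "\<And>n. v n \<in> L2 M"
    and Cauchy: "\<And>m n. L2_sq M (\<lambda>x. v m x - v n x) \<le> C * ((1/4)^m + (1/4)^n)"
  obtains w where "w \<in> L2 M" "(\<lambda>n. L2_sq M (\<lambda>x. v n x - w x)) \<longlonglongrightarrow> 0"
proof -
  note [measurable] = v[THEN L2_measurable]
  define d where "d n x = v (Suc n) x - v n x" for n x
  have C: "C \<ge> 0" using Cauchy[of 0 0] by (simp add: L2_sq_def)
  have dL2: "d n \<in> L2 M" for n unfolding d_def by (intro L2_diff v)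
  have "(\<integral>\<^sup>+x. (\<Sum>n. ennreal (2^n * (norm (d n x))\<^sup>2)) \<partial>M) = (\<Sum>n. \<integral>\<^sup>+x. ennreal (2^n * (norm (d n x))\<^sup>2) \<partial>M)"
    by (rule nn_integral_suminf) (simp add: d_def)
  also have "\<dots> = (\<Sum>n. ennreal (2^n * L2_sq M (d n)))"
    using dL2 by (intro arg_cong[where f = suminf] ext)
      (auto simp: ennreal_mult nn_integral_cmult nn_integral_L2_sq L2_sq_nonneg)
  also have "\<dots> \<le> (\<Sum>n. ennreal ((1/2)^n * (2 * C)))"
  proof (intro suminf_le ennreal_leI)
    fix n :: nat
    have "L2_sq M (d n) \<le> C * ((1/4)^Suc n + (1/4)^n)" unfolding d_def by (rule Cauchy)
    also have "\<dots> \<le> C * (2 * (1/4)^n)" using C by (intro mult_left_mono) auto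
    finally have "2^n * L2_sq M (d n) \<le> 2^n * (C * (2 * (1/4)^n))" by (intro mult_left_mono) auto
    also have "\<dots> = (2 * (1/4))^n * (2 * C)" by (subst power_mult_distrib) simp
    finally show "2^n * L2_sq M (d n) \<le> (1/2)^n * (2 * C)" by simp
  qed auto
  also have "\<dots> = ennreal (\<Sum>n. (1/2)^n * (2 * C))"
    using C by (intro suminf_ennreal2 summable_mult2 summable_geometric) auto
  finally have fin: "(\<integral>\<^sup>+x. (\<Sum>n. ennreal (2^n * (norm (d n x))\<^sup>2)) \<partial>M) \<noteq> \<infinity>"
    by (auto simp: top_unique)
  have conv: "AE x in M. convergent (\<lambda>n. v n x)"
  proof -
    have "AE x in M. (\<Sum>n. ennreal (2^n * (norm (d n x))\<^sup>2)) \<noteq> \<infinity>"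
      by (rule nn_integral_noteq_infinite[OF _ fin]) (simp add: d_def)
    then show ?thesis
    proof eventually_elim
      case (elim x)
      have "summable (\<lambda>n. 2^n * (norm (d n x))\<^sup>2)"
        by (rule summable_suminf_not_top) (use elim in auto)
      then have S: "summable (\<lambda>n. (1/2)^n + 2^n * (norm (d n x))\<^sup>2)"
        by (intro summable_add summable_geometric) auto
      have "summable (\<lambda>n. d n x)"
      proof (rule summable_comparison_test'[OF S, of 0])
        fix n :: nat
        \<comment> \<open>Either the increment is at most \<open>(1/2)^n\<close>, or
          \<open>2^n * norm (d n x)\<close> is at least 1 and the squared term takes over.\<close>
        have "norm (d n x) \<le> (1/2)^n + 2^n * (norm (d n x))\<^sup>2"
        proof (cases "norm (d n x) \<le> (1/2)^n")
          case True
          then show ?thesis by (smt (verit) mult_nonneg_nonneg zero_le_power zero_le_power2)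
        next
          case False
          then have "1 \<le> 2^n * norm (d n x)"
            by (simp add: power_one_over field_simps)
          then have "norm (d n x) * 1 \<le> norm (d n x) * (2^n * norm (d n x))"
            by (intro mult_left_mono) auto
          also have "\<dots> = 2^n * (norm (d n x))\<^sup>2" by (simp add: power2_eq_square)
          finally show ?thesis by (simp add: add_increasing)
        qed
        then show "norm (d n x) \<le> (1/2)^n + 2^n * (norm (d n x))\<^sup>2" .
      qed
      then have "convergent (\<lambda>n. (\<Sum>k<n. d k x))" by (simp add: summable_iff_convergent)
      then have "convergent (\<lambda>n. v 0 x + (\<Sum>k<n. d k x))"
        by (intro convergent_add convergent_const)
      moreover have "v 0 x + (\<Sum>k<n. d k x) = v n x" for n
        unfolding d_def by (subst sum_lessThan_telescope[of "\<lambda>k. v k x"]) simp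
      ultimately show ?case by simp
    qed
  qed
  define w where "w x = lim (\<lambda>n. v n x)" for x
  have [measurable]: "w \<in> borel_measurable M" unfolding w_def by measurable
  have lim: "AE x in M. (\<lambda>n. v n x) \<longlonglongrightarrow> w x"
    using conv by eventually_elim (simp add: w_def convergent_LIMSEQ_iff)
  \<comment> \<open>Fatou's lemma in the index \<open>m\<close>: the limit inherits the Cauchy
    estimate, and membership of \<open>w\<close> in \<open>L2\<close> follows from it.\<close>
  have est: "(\<integral>\<^sup>+x. ennreal ((norm (v n x - w x))\<^sup>2) \<partial>M) \<le> ennreal (2 * C * (1/4)^n)" for n
  proof -
    have "(\<integral>\<^sup>+x. ennreal ((norm (v n x - w x))\<^sup>2) \<partial>M)
        = (\<integral>\<^sup>+x. liminf (\<lambda>m. ennreal ((norm (v n x - v m x))\<^sup>2)) \<partial>M)"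
    proof (intro nn_integral_cong_AE)
      show "AE x in M. ennreal ((norm (v n x - w x))\<^sup>2) = liminf (\<lambda>m. ennreal ((norm (v n x - v m x))\<^sup>2))"
        using lim
      proof eventually_elim
        case (elim x)
        have "(\<lambda>m. ennreal ((norm (v n x - v m x))\<^sup>2)) \<longlonglongrightarrow> ennreal ((norm (v n x - w x))\<^sup>2)"
          using elim by (intro tendsto_intros)
        then show ?case by (rule lim_imp_Liminf[symmetric, OF sequentially_bot])
      qed
    qed
    also have "\<dots> \<le> liminf (\<lambda>m. (\<integral>\<^sup>+x. ennreal ((norm (v n x - v m x))\<^sup>2) \<partial>M))"
      by (rule nn_integral_liminf) simp
    also have "\<dots> \<le> liminf (\<lambda>m. ennreal (2 * C * (1/4)^n))"
    proof (intro Liminf_mono eventually_sequentiallyI[of n])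
      fix m assume "n \<le> m"
      then have "C * ((1/4)^n + (1/4)^m) \<le> C * ((1/4)^n + (1/4)^n)"
        using C by (intro mult_left_mono add_left_mono power_decreasing) auto
      then have "L2_sq M (\<lambda>x. v n x - v m x) \<le> 2 * C * (1/4)^n"
        using Cauchy[of n m] by simp
      then show "(\<integral>\<^sup>+x. ennreal ((norm (v n x - v m x))\<^sup>2) \<partial>M) \<le> ennreal (2 * C * (1/4)^n)"
        using v by (subst nn_integral_L2_sq) (auto intro: L2_diff ennreal_leI)
    qed
    also have "\<dots> = ennreal (2 * C * (1/4)^n)" by (simp add: Liminf_const)
    finally show ?thesis .
  qed
  have diffL2: "(\<lambda>x. v n x - w x) \<in> L2 M" for n
  proof -
    have "integrable M (\<lambda>x. (norm (v n x - w x))\<^sup>2)"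
      by (rule integrableI_bounded) (use est[of n] in \<open>auto simp: top_unique less_top[symmetric]\<close>)
    then show ?thesis by (simp add: L2_def)
  qed
  have "w \<in> L2 M" using L2_diff[OF v[of 0] diffL2[of 0]] by simp
  moreover have "(\<lambda>n. L2_sq M (\<lambda>x. v n x - w x)) \<longlonglongrightarrow> 0"
  proof (rule tendsto_sandwich[where f = "\<lambda>_. 0" and h = "\<lambda>n. 2 * C * (1/4)^n"])
    show "(\<lambda>n. 2 * C * (1/4)^n) \<longlonglongrightarrow> 0" by (intro tendsto_mult_right_zero LIMSEQ_power_zero) auto
    show "\<forall>\<^sub>F n in sequentially. L2_sq M (\<lambda>x. v n x - w x) \<le> 2 * C * (1/4)^n"
      using est diffL2 C by (auto simp: nn_integral_L2_sq)
  qed (auto simp: L2_sq_nonneg)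
  ultimately show ?thesis by (rule that)
qed

text \<open>Closed subspaces enter only as annihilators of sets of test functions. Linearity and
  closedness are then automatic, and one projection theorem serves all spaces without a topology on
  functions modulo null sets.\<close>

definition annihilator :: "'a measure \<Rightarrow> ('a \<Rightarrow> complex) set \<Rightarrow> ('a \<Rightarrow> complex) set" where
  "annihilator M S = {v \<in> L2 M. \<forall>g\<in>S. L2_ip M v g = 0}"

lemma annihilator_add_mult:
  assumes "S \<subseteq> L2 M" "f \<in> annihilator M S" "g \<in> annihilator M S"
  shows "(\<lambda>x. f x + c * g x) \<in> annihilator M S"
  using assms unfolding annihilator_def
  by (auto intro: L2_add L2_cmult simp: ip_add_left L2_cmult ip_mult_left subset_iff)

lemma annihilator_closed:
  assumes S: "S \<subseteq> L2 M" and v: "\<And>n. v n \<in> annihilator M S" and w: "w \<in> L2 M"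
    and lim: "(\<lambda>n. L2_sq M (\<lambda>x. v n x - w x)) \<longlonglongrightarrow> 0"
  shows "w \<in> annihilator M S"
proof -
  have "L2_ip M w g = 0" if "g \<in> S" for g
  proof -
    have g: "g \<in> L2 M" using S that by auto
    have vL: "v n \<in> L2 M" "L2_ip M (v n) g = 0" for n using v[of n] that by (auto simp: annihilator_def)
    have "(norm (L2_ip M w g))\<^sup>2 \<le> L2_sq M (\<lambda>x. v n x - w x) * L2_sq M g" for n
      using L2_Cauchy_Schwarz[OF L2_diff[OF vL(1)[of n] w] g] vL w g by (simp add: ip_diff_left)
    moreover have "(\<lambda>n. L2_sq M (\<lambda>x. v n x - w x) * L2_sq M g) \<longlonglongrightarrow> 0 * L2_sq M g"
      by (intro tendsto_intros lim)
    ultimately have "(norm (L2_ip M w g))\<^sup>2 \<le> 0"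
      by (intro tendsto_lowerbound[where F = sequentially]) auto
    then show ?thesis by simp
  qed
  then show ?thesis using w by (auto simp: annihilator_def)
qed

lemma L2_sq_parallelogram:
  assumes "f \<in> L2 M" "g \<in> L2 M"
  shows "L2_sq M (\<lambda>x. f x + g x) + L2_sq M (\<lambda>x. f x - g x) = 2 * L2_sq M f + 2 * L2_sq M g"
  using L2_sq_diff_mult[OF assms, of 1] L2_sq_diff_mult[OF assms, of "-1"] by simp

text \<open>Orthogonality is read off from the minimizing sequence: the squared inner product of
  \<open>h - v n\<close> with \<open>u\<close> is at most a multiple of \<open>(1/4)^n\<close>, and
  Cauchy-Schwarz carries this over to the limit \<open>k\<close>.\<close>

lemma projection_exists:
  assumes S: "S \<subseteq> L2 M" and h: "h \<in> L2 M"
  obtains k where "k \<in> annihilator M S"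
    "\<And>v. v \<in> annihilator M S \<Longrightarrow> L2_ip M (\<lambda>x. h x - k x) v = 0"
proof -
  let ?V = "annihilator M S"
  define D where "D = (\<lambda>v. L2_sq M (\<lambda>x. h x - v x)) ` ?V"
  define d where "d = Inf D"
  have VL: "v \<in> L2 M" if "v \<in> ?V" for v using that by (simp add: annihilator_def)
  have zero: "(\<lambda>x. 0) \<in> ?V" by (auto simp: annihilator_def L2_def L2_ip_def)
  have ne: "D \<noteq> {}" using zero by (auto simp: D_def)
  have bdd: "bdd_below D" by (auto simp: D_def L2_sq_nonneg intro!: bdd_belowI[of _ 0])
  have dle: "d \<le> L2_sq M (\<lambda>x. h x - v x)" if "v \<in> ?V" for v
    unfolding d_def by (rule cInf_lower) (use that bdd in \<open>auto simp: D_def\<close>)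
  have "\<exists>v\<in>?V. L2_sq M (\<lambda>x. h x - v x) < d + (1/4)^n" for n
  proof -
    have "Inf D < d + (1/4)^n" by (simp add: d_def)
    then show ?thesis using cInf_lessD[OF ne, of "d + (1/4)^n"] by (auto simp: D_def)
  qed
  then obtain v where v: "\<And>n. v n \<in> ?V" "\<And>n. L2_sq M (\<lambda>x. h x - v n x) < d + (1/4)^n" by metis
  have vL: "v n \<in> L2 M" for n using v VL by auto
  have "L2_sq M (\<lambda>x. v m x - v n x) \<le> 2 * ((1/4)^m + (1/4)^n)" for m n
  proof -
    have "(\<lambda>x. v m x + (-1) * v n x) \<in> ?V" using v S by (intro annihilator_add_mult) auto
    have "(\<lambda>x. (\<lambda>_. 0) x + (1/2) * (v m x + 1 * v n x)) \<in> ?V"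
      using v S zero by (intro annihilator_add_mult)
    \<comment> \<open>The midpoint of two approximants competes for the infimum; with the
      parallelogram law this bounds the distance between them.\<close>
    then have "d \<le> L2_sq M (\<lambda>x. h x - (1/2) * (v m x + v n x))" using dle by simp
    also have "(\<lambda>x. h x - (1/2) * (v m x + v n x)) = (\<lambda>x. (1/2) * ((h x - v m x) + (h x - v n x)))"
      by (auto simp: algebra_simps fun_eq_iff)
    also have "L2_sq M \<dots> = (1/4) * L2_sq M (\<lambda>x. (h x - v m x) + (h x - v n x))"
      unfolding L2_sq_def by (simp only: norm_mult power_mult_distrib integral_mult_right_zero) (simp add: norm_divide power_divide)
    finally have "4 * d \<le> L2_sq M (\<lambda>x. (h x - v m x) + (h x - v n x))" by simp
    moreover have "L2_sq M (\<lambda>x. (h x - v m x) + (h x - v n x)) + L2_sq M (\<lambda>x. (h x - v m x) - (h x - v n x))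
        = 2 * L2_sq M (\<lambda>x. h x - v m x) + 2 * L2_sq M (\<lambda>x. h x - v n x)"
      by (intro L2_sq_parallelogram L2_diff h vL)
    moreover have "L2_sq M (\<lambda>x. (h x - v m x) - (h x - v n x)) = L2_sq M (\<lambda>x. v m x - v n x)"
      unfolding L2_sq_def by (simp add: norm_minus_commute)
    ultimately show ?thesis using v(2)[of m] v(2)[of n] by simp
  qed
  then obtain k where k: "k \<in> L2 M" "(\<lambda>n. L2_sq M (\<lambda>x. v n x - k x)) \<longlonglongrightarrow> 0"
    using L2_fast_Cauchy_limit[of v M 2, OF vL] by blast
  have kV: "k \<in> ?V" by (rule annihilator_closed[OF S v(1) k])
  have r: "(\<lambda>x. h x - k x) \<in> L2 M" by (intro L2_diff h k)
  have orth: "L2_ip M (\<lambda>x. h x - k x) u = 0" if u: "u \<in> ?V" for u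
  proof -
    have uL: "u \<in> L2 M" by (rule VL[OF u])
    have perp: "(norm (L2_ip M (\<lambda>x. h x - v n x) u))\<^sup>2 \<le> (1/4)^n * (1 + L2_sq M u)" for n
    proof -
      define z where "z = L2_ip M (\<lambda>x. h x - v n x) u"
      \<comment> \<open>The optimal step would be \<open>1 / L2_sq M u\<close>; the added 1 keeps it
        defined when \<open>u\<close> is null and reappears as the 1 in the bound.\<close>
      define t where "t = 1 / (1 + L2_sq M u)"
      have s: "L2_sq M u \<ge> 0" by (rule L2_sq_nonneg)
      have t: "t > 0" "t * (1 + L2_sq M u) = 1" using s by (auto simp: t_def)
      have "(\<lambda>x. v n x + (of_real t * z) * u x) \<in> ?V" using v u S by (intro annihilator_add_mult)
      then have "d \<le> L2_sq M (\<lambda>x. h x - (v n x + (of_real t * z) * u x))" by (rule dle)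
      also have "\<dots> = L2_sq M (\<lambda>x. (h x - v n x) - (of_real t * z) * u x)"
        by (simp add: algebra_simps)
      also have "\<dots> = L2_sq M (\<lambda>x. h x - v n x) - 2 * Re (cnj (of_real t * z) * z)
          + (norm (of_real t * z))\<^sup>2 * L2_sq M u"
        unfolding z_def by (rule L2_sq_diff_mult[OF L2_diff[OF h vL] uL])
      also have "Re (cnj (of_real t * z) * z) = t * (norm z)\<^sup>2"
        unfolding cmod_power2 by (simp add: power2_eq_square algebra_simps)
      also have "(norm (of_real t * z))\<^sup>2 = t * t * (norm z)\<^sup>2"
        by (simp add: norm_mult power_mult_distrib power2_eq_square)
      finally have "2 * (t * (norm z)\<^sup>2) \<le> (1/4)^n + t * (norm z)\<^sup>2 * (t * L2_sq M u)"
        using v(2)[of n] by (simp add: algebra_simps)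
      moreover have "t * L2_sq M u \<le> 1" using t by (simp add: algebra_simps)
      then have "t * (norm z)\<^sup>2 * (t * L2_sq M u) \<le> t * (norm z)\<^sup>2 * 1"
        using t by (intro mult_left_mono) auto
      ultimately have "t * (norm z)\<^sup>2 \<le> (1/4)^n" by simp
      then have "(1 + L2_sq M u) * (t * (norm z)\<^sup>2) \<le> (1 + L2_sq M u) * (1/4)^n"
        using s by (intro mult_left_mono) auto
      moreover have "(1 + L2_sq M u) * (t * (norm z)\<^sup>2) = (norm z)\<^sup>2"
        using t(2) by (metis mult.assoc mult.commute mult_1)
      ultimately have "(norm z)\<^sup>2 \<le> (1 + L2_sq M u) * (1/4)^n" by metis
      then show ?thesis by (simp add: z_def mult.commute)
    qed
    have "(norm (L2_ip M (\<lambda>x. h x - k x) u))\<^sup>2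
        \<le> 2 * ((1/4)^n * (1 + L2_sq M u)) + 2 * (L2_sq M (\<lambda>x. v n x - k x) * L2_sq M u)" for n
    proof -
      have "L2_ip M (\<lambda>x. h x - k x) u = L2_ip M (\<lambda>x. (h x - v n x) + (v n x - k x)) u" by simp
      also have "\<dots> = L2_ip M (\<lambda>x. h x - v n x) u + L2_ip M (\<lambda>x. v n x - k x) u"
        by (intro ip_add_left L2_diff h vL k uL)
      finally show ?thesis
        using norm_add_sq_le[of "L2_ip M (\<lambda>x. h x - v n x) u" "L2_ip M (\<lambda>x. v n x - k x) u"]
          perp[of n] L2_Cauchy_Schwarz[OF L2_diff[OF vL[of n] k(1)] uL] by simp
    qed
    moreover have "(\<lambda>n. 2 * ((1/4)^n * (1 + L2_sq M u)) + 2 * (L2_sq M (\<lambda>x. v n x - k x) * L2_sq M u))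
        \<longlonglongrightarrow> 2 * (0 * (1 + L2_sq M u)) + 2 * (0 * L2_sq M u)"
      by (intro tendsto_intros k LIMSEQ_power_zero) auto
    ultimately have "(norm (L2_ip M (\<lambda>x. h x - k x) u))\<^sup>2 \<le> 0"
      by (intro tendsto_lowerbound[where F = sequentially]) auto
    then show ?thesis by simp
  qed
  show ?thesis by (rule that[OF kV orth])
qed

section \<open>Fourier coefficients on the circle\<close>

lemma space_circle_measure [simp]: "space circle_measure = circle"
  by (simp add: circle_measure_def space_restrict_space)

lemma sets_circle_measure [measurable_cong]: "sets circle_measure = sets circle_borel"
  by (simp add: circle_measure_def)

lemma cis_measurable_circle [measurable]: "cis \<in> measurable borel circle_borel"
  by (rule measurable_restrict_space2)
    (auto simp: dist_norm intro!: borel_measurable_continuous_onI continuous_intros)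

lemma circle_measure_density:
  "circle_measure = distr (density lborel (\<lambda>t. ennreal (indicator {0..<2 * pi} t / (2 * pi)))) circle_borel cis"
proof -
  have "uniform_measure lborel {0..<2 * pi} = density lborel (\<lambda>t. ennreal (indicator {0..<2 * pi} t / (2 * pi)))"
    unfolding uniform_measure_def
    by (intro density_cong AE_I2) (auto simp: divide_ennreal split: split_indicator simp flip: ennreal_1)
  then show ?thesis by (simp add: circle_measure_def)
qed

lemma prob_space_circle_measure: "prob_space circle_measure"
  unfolding circle_measure_def
  by (intro prob_space.prob_space_distr prob_space_uniform_measure) auto

interpretation circle: prob_space circle_measure
  by (rule prob_space_circle_measure)

lemma nn_integral_circle_measure:
  assumes "f \<in> borel_measurable circle_borel"
  shows "(\<integral>\<^sup>+z. f z \<partial>circle_measure) =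
    (\<integral>\<^sup>+t. ennreal (indicator {0..<2 * pi} t / (2 * pi)) * f (cis t) \<partial>lborel)"
proof -
  note [measurable] = assms
  show ?thesis unfolding circle_measure_density
    by (subst nn_integral_distr, measurable, subst nn_integral_density) auto
qed

lemma integral_circle_measure:
  fixes f :: "complex \<Rightarrow> complex"
  assumes "f \<in> borel_measurable circle_borel"
  shows "(\<integral>z. f z \<partial>circle_measure) = (\<integral>t. (indicator {0..<2 * pi} t / (2 * pi)) *\<^sub>R f (cis t) \<partial>lborel)"
proof -
  note [measurable] = assms
  show ?thesis unfolding circle_measure_density
    by (subst integral_distr, measurable, subst integral_density) auto
qed

lemma AE_circle_measureD:
  assumes "AE z in circle_measure. P z"
  shows "AE t in lborel. t \<in> {0..<2 * pi} \<longrightarrow> P (cis t)"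
proof -
  have "AE t in density lborel (\<lambda>t. ennreal (indicator {0..<2 * pi} t / (2 * pi))). P (cis t)"
    by (rule AE_distrD[OF _ assms[unfolded circle_measure_density]]) simp
  then have "AE t in lborel. 0 < ennreal (indicator {0..<2 * pi} t / (2 * pi)) \<longrightarrow> P (cis t)"
    by (subst (asm) AE_density) auto
  then show ?thesis by eventually_elim (auto simp: zero_less_divide_iff)
qed

text \<open>The null set is moved to the circle by the Borel inverse of \<open>cis\<close> on \<open>{0..<2 * pi}\<close>, so that
  no measurability of \<open>P\<close> is needed.\<close>

lemma AE_circle_measureI:
  assumes "AE t in lborel. t \<in> {0..<2 * pi} \<longrightarrow> P (cis t)"
  shows "AE z in circle_measure. P z"
proof -
  obtain N where N: "N \<in> null_sets lborel" "{t. \<not> (t \<in> {0..<2 * pi} \<longrightarrow> P (cis t))} \<subseteq> N"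
    using assms unfolding eventually_ae_filter by auto
  then have [measurable]: "N \<in> sets borel" by auto
  \<comment> \<open>The principal argument lies in \<open>(-pi, pi]\<close>; the shift by
    \<open>2 * pi\<close> moves it to \<open>{0..<2 * pi}\<close>, where it inverts
    \<open>cis\<close>.\<close>
  define \<tau> where "\<tau> z = (if Im (Ln z) < 0 then Im (Ln z) + 2 * pi else Im (Ln z))" for z
  have [measurable]: "\<tau> \<in> borel_measurable circle_borel"
    unfolding \<tau>_def by (intro measurable_restrict_space1) measurable
  have cis_\<tau>: "cis (\<tau> z) = z" if "norm z = 1" for z
  proof -
    have "z \<noteq> 0" using that by auto
    have "cis (Im (Ln z)) = z"
      using exp_Ln[OF \<open>z \<noteq> 0\<close>] Re_Ln[OF \<open>z \<noteq> 0\<close>] that by (metis exp_eq_polar mult_1 ln_one exp_zero of_real_1)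
    then show ?thesis by (auto simp: \<tau>_def cis.ctr cos_add sin_add complex_eq_iff)
  qed
  have \<tau>_range: "0 \<le> \<tau> z" "\<tau> z < 2 * pi" if "norm z = 1" for z
  proof -
    have "z \<noteq> 0" using that by auto
    then show "0 \<le> \<tau> z" "\<tau> z < 2 * pi"
      using mpi_less_Im_Ln[of z] Im_Ln_le_pi[of z] pi_gt_zero by (auto simp: \<tau>_def)
  qed
  have \<tau>_cis: "\<tau> (cis t) = t" if "t \<in> {0..<2 * pi}" for t
  proof -
    have eq: "cis (\<tau> (cis t)) = cis t" by (rule cis_\<tau>) simp
    have "sin (\<tau> (cis t)) = sin t \<and> cos (\<tau> (cis t)) = cos t"
      using eq by (simp add: complex_eq_iff)
    then obtain n :: int where n: "\<tau> (cis t) = t + 2 * pi * n"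
      unfolding sin_cos_eq_iff by auto
    have *: "2 * pi * n < 2 * pi * 1" "2 * pi * (-1) < 2 * pi * n"
      using that \<tau>_range[OF norm_cis, of t] n by (simp_all only: atLeastLessThan_iff) linarith+
    have "0 < 2 * pi" by simp
    note * [THEN mult_less_cancel_left_pos[OF this, THEN iffD1]]
    then have "n = 0" by linarith
    then show ?thesis using n by simp
  qed
  have "AE z in circle_measure. \<tau> z \<notin> N"
  proof -
    have "AE t in lborel. t \<notin> N" by (rule AE_not_in[OF N(1)])
    then have "AE t in uniform_measure lborel {0..<2*pi}. \<tau> (cis t) \<notin> N"
      by (intro AE_uniform_measureI) (auto elim!: eventually_mono simp: \<tau>_cis)
    moreover have "{z \<in> space circle_borel. \<tau> z \<notin> N} \<in> sets circle_borel" by measurable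
    ultimately show ?thesis unfolding circle_measure_def by (subst AE_distr_iff) auto
  qed
  then show ?thesis
    using AE_space by eventually_elim (use N(2) cis_\<tau> \<tau>_range in \<open>force\<close>)
qed

lemma cnj_circle: "norm z = 1 \<Longrightarrow> cnj z = inverse z"
  by (rule inverse_unique[symmetric]) (simp add: complex_norm_square[symmetric])

lemma continuous_circle_measurable [measurable]:
  fixes f :: "complex \<Rightarrow> 'b::topological_space"
  shows "continuous_on circle f \<Longrightarrow> f \<in> borel_measurable circle_measure"
  by (simp add: measurable_cong_sets[OF sets_circle_measure refl] borel_measurable_continuous_on_restrict)

lemma continuous_on_circle_bounded:
  fixes f :: "complex \<Rightarrow> 'a::real_normed_vector"
  assumes "continuous_on circle f"
  obtains C where "\<And>z. z \<in> circle \<Longrightarrow> norm (f z) \<le> C"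
  using compact_imp_bounded[OF compact_continuous_image[OF assms compact_sphere]]
  unfolding bounded_iff by blast

lemma powi_measurable_circle [measurable]: "(\<lambda>z. z powi k) \<in> borel_measurable circle_measure"
  by (intro continuous_circle_measurable continuous_intros) auto

lemma id_measurable_circle [measurable]: "(\<lambda>z. z) \<in> borel_measurable circle_measure"
  by (intro continuous_circle_measurable continuous_intros)

lemma integral_circle_powi: "(\<integral>z. z powi k \<partial>circle_measure) = (if k = 0 then 1 else 0)"
proof (cases "k = 0")
  case True
  then show ?thesis by (simp add: circle.prob_space[simplified])
next
  case False
  define F where "F t = cis (of_int k * t) / (\<i> * of_int k)" for t :: real
  have deriv: "(F has_vector_derivative cis (of_int k * t)) (at t within {0..2 * pi})" for t
  proof -
    have "((\<lambda>z. exp (\<i> * of_int k * z) / (\<i> * of_int k)) has_field_derivative exp (\<i> * of_int k * of_real t))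
        (at (of_real t))"
      using False by (auto intro!: derivative_eq_intros)
    from has_vector_derivative_real_field[OF this] show ?thesis
      by (simp add: F_def[abs_def] cis_conv_exp mult.assoc)
  qed
  have "(\<integral>z. z powi k \<partial>circle_measure)
      = (\<integral>t. (indicator {0..<2 * pi} t / (2 * pi)) *\<^sub>R (cis t powi k) \<partial>lborel)"
    by (rule integral_circle_measure) (simp flip: measurable_cong_sets[OF sets_circle_measure refl])
  also have "\<dots> = (\<integral>t. (1 / (2 * pi)) *\<^sub>R (indicator {0..2 * pi} t *\<^sub>R cis (of_int k * t)) \<partial>lborel)"
  proof (rule integral_cong_AE)
    show "AE t in lborel. (indicator {0..<2 * pi} t / (2 * pi)) *\<^sub>R (cis t powi k) =
        (1 / (2 * pi)) *\<^sub>R (indicator {0..2 * pi} t *\<^sub>R cis (of_int k * t))"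
      using AE_lborel_singleton[of "2 * pi"]
      by eventually_elim (auto split: split_indicator simp: cis_power_int mult.commute)
    have [measurable]: "cis \<in> borel_measurable borel"
      by (intro borel_measurable_continuous_onI continuous_intros)
    show "(\<lambda>t. (indicator {0..<2 * pi} t / (2 * pi)) *\<^sub>R (cis t powi k)) \<in> borel_measurable lborel"
      unfolding cis_power_int by measurable
  qed (auto intro!: borel_measurable_continuous_onI continuous_intros borel_measurable_scaleR)
  also have "\<dots> = (1 / (2 * pi)) *\<^sub>R (\<integral>t. indicator {0..2 * pi} t *\<^sub>R cis (of_int k * t) \<partial>lborel)"
    by (rule integral_scaleR_right)
  also have "(\<integral>t. indicator {0..2 * pi} t *\<^sub>R cis (of_int k * t) \<partial>lborel) = F (2 * pi) - F 0"
    by (rule integral_FTC_Icc) (auto intro!: deriv continuous_intros)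
  also have "F (2 * pi) = F 0"
    using cis_multiple_2pi[of "of_int k"] by (simp add: F_def mult.commute mult.left_commute)
  finally show ?thesis using False by simp
qed

lemma bounded_measurable_integrable_circle:
  fixes f :: "complex \<Rightarrow> 'b::{banach, second_countable_topology}"
  assumes "f \<in> borel_measurable circle_measure" "AE z in circle_measure. norm (f z) \<le> C"
  shows "integrable circle_measure f"
  by (rule circle.integrable_const_bound[OF assms(2,1)])

lemma integrable_mult_bounded:
  fixes f g :: "'a \<Rightarrow> complex"
  assumes "integrable M f" "g \<in> borel_measurable M" "AE x in M. norm (g x) \<le> C"
  shows "integrable M (\<lambda>x. f x * g x)" "integrable M (\<lambda>x. g x * f x)"
proof -
  note [measurable] = assms(1)[THEN borel_measurable_integrable] assms(2)
  have "integrable M (\<lambda>x. C * norm (f x))" using assms(1) by (intro integrable_mult_right integrable_norm)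
  then show "integrable M (\<lambda>x. f x * g x)"
  proof (rule Bochner_Integration.integrable_bound)
    show "AE x in M. norm (f x * g x) \<le> norm (C * norm (f x))"
      using assms(3)
    proof eventually_elim
      case (elim x)
      then have "norm (f x) * norm (g x) \<le> norm (f x) * C" by (intro mult_left_mono) auto
      also have "\<dots> \<le> \<bar>C * norm (f x)\<bar>" by (simp add: mult.commute)
      finally show ?case by (simp add: norm_mult)
    qed
  qed simp
  then show "integrable M (\<lambda>x. g x * f x)" by (simp add: mult.commute)
qed

lemma integrable_mult_powi:
  assumes "integrable circle_measure f"
  shows "integrable circle_measure (\<lambda>z. f z * z powi k)"
  by (rule integrable_mult_bounded[OF assms, where C = 1]) (auto simp: norm_power_int intro!: AE_I2)

text \<open>Multiplication by a real linear function, that is by \<open>a z + b cnj z\<close>, preserves the functions all of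
  whose Fourier coefficients vanish, and hence so does multiplication by a real polynomial.\<close>

lemma integral_mult_continuous_eq_0:
  fixes u :: "complex \<Rightarrow> real"
  assumes f: "integrable circle_measure f"
    and zero: "\<And>k::int. (\<integral>z. f z * z powi k \<partial>circle_measure) = 0"
    and u: "continuous_on circle u"
  shows "(\<integral>z. f z * complex_of_real (u z) \<partial>circle_measure) = 0"
proof -
  let ?m = circle_measure
  define Z where "Z = {f. integrable ?m f \<and> (\<forall>k::int. (\<integral>z. f z * z powi k \<partial>?m) = 0)}"
  have poly: "\<forall>f\<in>Z. (\<lambda>z. f z * complex_of_real (g z)) \<in> Z" if "real_polynomial_function g" for g
    using that
  proof (induction g rule: real_polynomial_function.induct)
    case (linear g)
    \<comment> \<open>The Wirtinger coefficients of the real linear map \<open>g\<close>. Since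
      \<open>cnj z = inverse z\<close> on the circle, multiplication by \<open>g\<close> merely
      shifts the indices of Fourier coefficients.\<close>
    define c d where "c = complex_of_real (g 1) / 2 - \<i> * complex_of_real (g \<i>) / 2"
      and "d = complex_of_real (g 1) / 2 + \<i> * complex_of_real (g \<i>) / 2"
    have g: "complex_of_real (g z) = c * z + d * cnj z" for z
    proof -
      interpret bounded_linear g by fact
      have "z = Re z *\<^sub>R 1 + Im z *\<^sub>R \<i>" by (simp add: complex_eq_iff)
      then have "g z = g (Re z *\<^sub>R 1 + Im z *\<^sub>R \<i>)" by (rule arg_cong)
      also have "\<dots> = Re z * g 1 + Im z * g \<i>" by (simp only: add scaleR real_scaleR_def)
      finally show ?thesis by (simp add: c_def d_def complex_eq_iff field_simps)
    qed
    show ?case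
    proof
      fix f assume f: "f \<in> Z"
      define h where "h k z = c * (f z * z powi (k + 1)) + d * (f z * z powi (k - 1))" for k z
      have eq: "f z * complex_of_real (g z) * z powi k = h k z" if "z \<in> space ?m" for z k
      proof -
        have "norm z = 1" using that by simp
        then have "z \<noteq> 0" by auto
        then have "z powi (k + 1) = z powi k * z" "z powi (k - 1) = z powi k * inverse z"
          by (simp_all add: power_int_add power_int_diff divide_inverse)
        then show ?thesis unfolding g h_def cnj_circle[OF \<open>norm z = 1\<close>]
          by (simp only: distrib_left distrib_right mult_ac)
      qed
      have "integrable ?m (h k)" for k
        unfolding h_def using f
        by (intro Bochner_Integration.integrable_add integrable_mult_right integrable_mult_powi) (auto simp: Z_def)
      moreover have "integrable ?m (\<lambda>z. f z * complex_of_real (g z) * z powi k) = integrable ?m (h k)" for k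
        by (rule Bochner_Integration.integrable_cong[OF refl eq])
      ultimately have i: "integrable ?m (\<lambda>z. f z * complex_of_real (g z) * z powi k)" for k
        by simp
      have "integral\<^sup>L ?m (h k) = 0" for k
        unfolding h_def using f integrable_mult_powi[of f] by (simp add: Z_def)
      moreover have "(\<integral>z. f z * complex_of_real (g z) * z powi k \<partial>?m) = integral\<^sup>L ?m (h k)" for k
        by (rule Bochner_Integration.integral_cong[OF refl eq])
      ultimately have "(\<integral>z. f z * complex_of_real (g z) * z powi k \<partial>?m) = 0" for k
        by simp
      then show "(\<lambda>z. f z * complex_of_real (g z)) \<in> Z"
        using i[of 0] by (auto simp: Z_def)
    qed
  next
    case (const c)
    then show ?case by (auto simp: Z_def mult.assoc mult.left_commute[of _ "complex_of_real c"] mult.commute[of _ "complex_of_real c"])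
  next
    case (add g h)
    show ?case
    proof
      fix f assume "f \<in> Z"
      with add have "(\<lambda>z. f z * complex_of_real (g z)) \<in> Z" "(\<lambda>z. f z * complex_of_real (h z)) \<in> Z" by auto
      then show "(\<lambda>z. f z * complex_of_real (g z + h z)) \<in> Z"
        by (auto simp: Z_def ring_distribs integrable_mult_powi)
    qed
  next
    case (mult g h)
    show ?case
    proof
      fix f assume "f \<in> Z"
      then have "(\<lambda>z. f z * complex_of_real (g z)) \<in> Z" by (rule bspec[OF mult.IH(1)])
      from bspec[OF mult.IH(2) this] have "(\<lambda>z. f z * complex_of_real (g z) * complex_of_real (h z)) \<in> Z" .
      then show "(\<lambda>z. f z * complex_of_real (g z * h z)) \<in> Z"
        by (simp add: mult.assoc)
    qed
  qed
  have fZ: "f \<in> Z" using f zero by (simp add: Z_def)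
  have int: "integrable ?m (\<lambda>z. f z * complex_of_real (u z))" if uc: "continuous_on circle u" for u
  proof -
    obtain C where "\<And>z. z \<in> circle \<Longrightarrow> norm (u z) \<le> C"
      by (fact continuous_on_circle_bounded[OF uc])
    then show ?thesis using uc
      by (intro integrable_mult_bounded[OF f, where C = C] borel_measurable_of_real continuous_circle_measurable AE_I2) auto
  qed
  have *: "norm (\<integral>z. f z * complex_of_real (u z) \<partial>?m) \<le> e * (\<integral>z. norm (f z) \<partial>?m)" if "e > 0" for e
  proof -
    obtain g where g: "real_polynomial_function g" "\<And>z. z \<in> circle \<Longrightarrow> \<bar>u z - g z\<bar> < e"
      using Stone_Weierstrass_real_polynomial_function[OF compact_sphere u \<open>e > 0\<close>] by metis
    have gc: "continuous_on circle g"
      using g(1) by (intro continuous_on_polymonial_function) (simp add: real_polynomial_function_eq)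
    have "(\<integral>z. f z * complex_of_real (g z) * z powi 0 \<partial>?m) = 0"
      using bspec[OF poly[OF g(1)] fZ] unfolding Z_def by blast
    then have "(\<integral>z. f z * complex_of_real (u z) \<partial>?m)
        = (\<integral>z. f z * complex_of_real (u z) - f z * complex_of_real (g z) \<partial>?m)"
      using int[OF u] int[OF gc] by simp
    also have "norm \<dots> \<le> (\<integral>z. e * norm (f z) \<partial>?m)"
    proof (rule Bochner_Integration.integral_norm_bound_integral)
      fix z assume "z \<in> space ?m"
      then have "\<bar>u z - g z\<bar> \<le> e" using g(2)[of z] by auto
      then have "norm (f z) * \<bar>u z - g z\<bar> \<le> norm (f z) * e" by (intro mult_left_mono) auto
      moreover have "f z * complex_of_real (u z) - f z * complex_of_real (g z) = f z * complex_of_real (u z - g z)"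
        by (simp add: right_diff_distrib)
      ultimately show "norm (f z * complex_of_real (u z) - f z * complex_of_real (g z)) \<le> e * norm (f z)"
        by (simp only: norm_mult norm_of_real mult.commute)
    next
      show "integrable ?m (\<lambda>z. f z * complex_of_real (u z) - f z * complex_of_real (g z))"
        by (intro Bochner_Integration.integrable_diff int u gc)
      show "integrable ?m (\<lambda>z. e * norm (f z))"
        by (intro integrable_mult_right integrable_norm f)
    qed
    finally show ?thesis by simp
  qed
  have "norm (\<integral>z. f z * complex_of_real (u z) \<partial>?m) \<le> 0"
  proof (rule field_le_epsilon)
    fix e :: real assume e: "e > 0"
    define I where "I = (\<integral>z. norm (f z) \<partial>?m)"
    have I: "I \<ge> 0" by (simp add: I_def)
    \<comment> \<open>Dividing by \<open>1 + I\<close> rather than by \<open>I\<close> covers the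
      case that \<open>f\<close> is null.\<close>
    have "norm (\<integral>z. f z * complex_of_real (u z) \<partial>?m) \<le> e / (1 + I) * I"
      unfolding I_def by (rule *[OF divide_pos_pos]) (use e I in \<open>auto simp: I_def add_pos_nonneg\<close>)
    also have "\<dots> \<le> e" using e I by (simp add: field_simps)
    finally show "norm (\<integral>z. f z * complex_of_real (u z) \<partial>?m) \<le> 0 + e" by simp
  qed
  then show ?thesis by simp
qed

text \<open>Continuous cutoffs decrease to the indicator of a closed set, so integrals over closed
  sets vanish. Closed sets are stable under intersection and generate the Borel sets, hence all
  Borel integrals vanish.\<close>

lemma AE_eq_0_if_continuous:
  assumes f: "integrable circle_measure f"
    and cont: "\<And>u :: complex \<Rightarrow> real. continuous_on circle u \<Longrightarrow> (\<integral>z. f z * complex_of_real (u z) \<partial>circle_measure) = 0"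
  shows "AE z in circle_measure. f z = 0"
proof -
  let ?m = circle_measure
  have closed: "(\<integral>z. f z * indicator A z \<partial>?m) = 0" if "closed A" for A
  proof (cases "A = {}")
    case False
    define u where "u n z = max 0 (1 - real n * infdist z A)" for n z
    have lim: "(\<lambda>n. \<integral>z. f z * complex_of_real (u n z) \<partial>?m) \<longlonglongrightarrow> (\<integral>z. f z * indicator A z \<partial>?m)"
    proof (rule integral_dominated_convergence)
      have u_cont: "continuous_on circle (u n)" for n
        unfolding u_def by (intro continuous_intros)
      note [measurable] = borel_measurable_integrable[OF f] continuous_circle_measurable[OF u_cont]
      show "integrable ?m (\<lambda>z. norm (f z))" using f by simp
      have [measurable]: "indicator A \<in> borel_measurable ?m"
        using that by (intro measurable_cong_sets[OF sets_circle_measure refl, THEN equalityD2, THEN subsetD] measurable_restrict_space1) auto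
      show "(\<lambda>z. f z * indicator A z) \<in> borel_measurable ?m" by measurable
      show "(\<lambda>z. f z * complex_of_real (u n z)) \<in> borel_measurable ?m" for n by measurable
      have "0 \<le> u n z \<and> u n z \<le> 1" for n z by (auto simp: u_def infdist_nonneg)
      then show "AE z in ?m. norm (f z * complex_of_real (u n z)) \<le> norm (f z)" for n
        by (auto simp: norm_mult intro!: AE_I2 mult_left_le)
      show "AE z in ?m. (\<lambda>n. f z * complex_of_real (u n z)) \<longlonglongrightarrow> f z * indicator A z"
      proof (intro AE_I2 tendsto_mult tendsto_const)
        fix z
        show "(\<lambda>n. complex_of_real (u n z)) \<longlonglongrightarrow> indicator A z"
        proof (cases "z \<in> A")
          case True
          then show ?thesis by (simp add: u_def)
        next
          case z: False
          then have "infdist z A > 0"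
            using in_closed_iff_infdist_zero[OF that False, of z] infdist_nonneg[of z A] by linarith
          then obtain N where N: "1 < real N * infdist z A"
            using reals_Archimedean3 by blast
          have "u n z = 0" if "n \<ge> N" for n
          proof -
            have "real N * infdist z A \<le> real n * infdist z A" using that infdist_nonneg by (intro mult_right_mono) auto
            then show ?thesis using N by (simp add: u_def)
          qed
          then have "\<forall>\<^sub>F n in sequentially. complex_of_real (u n z) = 0"
            by (auto intro!: eventually_sequentiallyI[of N])
          then show ?thesis using z by (simp add: tendsto_eventually)
        qed
      qed
    qed
    moreover have "(\<integral>z. f z * complex_of_real (u n z) \<partial>?m) = 0" for n
      unfolding u_def by (intro cont continuous_intros)
    ultimately show ?thesis by (simp add: LIMSEQ_const_iff)
  qed simp
  note [measurable] = borel_measurable_integrable[OF f]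
  have ind_meas: "indicator A \<in> borel_measurable ?m" if "A \<in> sets borel" for A :: "complex set"
    using that by (subst measurable_cong_sets[OF sets_circle_measure refl]) (intro measurable_restrict_space1, simp)
  have int: "integrable ?m (\<lambda>z. f z * indicator A z)" if "A \<in> sets borel" for A
    by (rule integrable_mult_bounded[OF f ind_meas[OF that], where C = 1])
      (auto split: split_indicator)
  have borel: "(\<integral>z. f z * indicator A z \<partial>?m) = 0" if "A \<in> sets borel" for A
  proof -
    have "Int_stable (Collect closed :: complex set set)" by (auto simp: Int_stable_def)
    moreover have "Collect closed \<subseteq> Pow (UNIV :: complex set)" by simp
    moreover have "A \<in> sigma_sets UNIV (Collect closed)"
      using that by (simp add: borel_eq_closed)
    ultimately show ?thesis
    proof (induction rule: sigma_sets_induct_disjoint)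
      case (basic A)
      then show ?case using closed by simp
    next
      case empty
      show ?case by simp
    next
      case (compl A)
      then have A: "A \<in> sets borel" by (simp add: borel_eq_closed)
      have "f z * indicator (UNIV - A) z = f z * indicator UNIV z - f z * indicator A z" for z
        by (auto split: split_indicator)
      then show ?case
        using compl int[OF A] int[of UNIV] closed[of UNIV] by simp
    next
      case (union A)
      have A: "A n \<in> sets borel" for n using union(2) by (auto simp: borel_eq_closed)
      have "(\<lambda>n. \<integral>z. f z * indicator (\<Union>i<n. A i) z \<partial>?m) \<longlonglongrightarrow> (\<integral>z. f z * indicator (\<Union>i. A i) z \<partial>?m)"
      proof (rule integral_dominated_convergence)
        show "integrable ?m (\<lambda>z. norm (f z))" using f by simp
        show "(\<lambda>z. f z * indicator (\<Union>i. A i) z) \<in> borel_measurable ?m"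
          using A by (intro borel_measurable_times ind_meas) auto
        show "(\<lambda>z. f z * indicator (\<Union>i<n. A i) z) \<in> borel_measurable ?m" for n
          using A by (intro borel_measurable_times ind_meas) auto
        show "AE z in ?m. norm (f z * indicator (\<Union>i<n. A i) z) \<le> norm (f z)" for n
          by (auto split: split_indicator)
        show "AE z in ?m. (\<lambda>n. f z * indicator (\<Union>i<n. A i) z) \<longlonglongrightarrow> f z * indicator (\<Union>i. A i) z"
          by (intro AE_I2 tendsto_mult tendsto_const LIMSEQ_indicator_UN)
      qed
      moreover have "(\<integral>z. f z * indicator (\<Union>i<n. A i) z \<partial>?m) = 0" for n
      proof -
        have "indicator (\<Union>i<n. A i) z = (\<Sum>i<n. indicator (A i) z :: complex)" for z
          using union(1) by (subst indicator_UN_disjoint) (auto simp: disjoint_family_on_def)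
        then have "(\<integral>z. f z * indicator (\<Union>i<n. A i) z \<partial>?m) = (\<integral>z. (\<Sum>i<n. f z * indicator (A i) z) \<partial>?m)"
          by (simp only: sum_distrib_left)
        also have "\<dots> = (\<Sum>i<n. \<integral>z. f z * indicator (A i) z \<partial>?m)"
          by (rule Bochner_Integration.integral_sum) (rule int[OF A])
        finally show ?thesis using union(3) by simp
      qed
      ultimately show ?case by (simp add: LIMSEQ_const_iff)
    qed
  qed
  show ?thesis
  proof (rule circle.density_zero[OF f])
    fix A assume "A \<in> sets ?m"
    then obtain B where B: "B \<in> sets borel" "A = B \<inter> circle"
      by (auto simp: sets_circle_measure sets_restrict_space)
    have "set_lebesgue_integral ?m A f = (\<integral>z. f z * indicator B z \<partial>?m)"
      unfolding set_lebesgue_integral_def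
      by (rule Bochner_Integration.integral_cong) (auto simp: B split: split_indicator)
    then show "set_lebesgue_integral ?m A f = 0" using borel[OF B(1)] by simp
  qed
qed

text \<open>The \<open>L^1\<close> form is used on \<open>F * norm p ^ 2\<close> in Szego's
  factorization, which is known only as a product of two \<open>L2\<close> functions.\<close>

lemma Fourier_uniqueness:
  assumes f: "integrable circle_measure f"
    and zero: "\<And>k::int. (\<integral>z. f z * z powi k \<partial>circle_measure) = 0"
  shows "AE z in circle_measure. f z = 0"
  using AE_eq_0_if_continuous[OF f] integral_mult_continuous_eq_0[OF f zero] by blast

lemma L2_circle_bounded:
  assumes "f \<in> borel_measurable circle_measure" "AE z in circle_measure. norm (f z) \<le> C"
  shows "f \<in> L2 circle_measure"
proof -
  have "(\<lambda>_. 1) \<in> L2 circle_measure" by (simp add: L2_def)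
  from L2_mult_bounded[OF this assms] show ?thesis by simp
qed

lemma L2_powi: "(\<lambda>z. z powi k) \<in> L2 circle_measure"
  by (rule L2_circle_bounded[where C = 1]) (auto simp: norm_power_int)

lemma L2_circle_mult_powi: "f \<in> L2 circle_measure \<Longrightarrow> (\<lambda>z. f z * z powi k) \<in> L2 circle_measure"
  by (rule L2_mult_bounded[where C = 1]) (auto simp: norm_power_int)

lemma L2_circle_integrable: "f \<in> L2 circle_measure \<Longrightarrow> integrable circle_measure f"
  using L2_mult_integrable[of f circle_measure "\<lambda>_. 1"] by (simp add: L2_def)

lemma cnj_powi: "norm z = 1 \<Longrightarrow> cnj z powi k = z powi (- k)"
  by (simp add: cnj_circle power_int_inverse power_int_minus)

section \<open>Boundary functions of the Hardy space\<close>

text \<open>The boundary functions of \<open>H\<^sup>2\<close>.\<close>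

definition H2b :: "(complex \<Rightarrow> complex) set" where
  "H2b = {f \<in> L2 circle_measure. \<forall>k::int. k \<ge> 1 \<longrightarrow> (\<integral>z. f z * z powi k \<partial>circle_measure) = 0}"

lemma H2b_L2: "f \<in> H2b \<Longrightarrow> f \<in> L2 circle_measure"
  by (simp add: H2b_def)

lemma H2b_zero: "f \<in> H2b \<Longrightarrow> k \<ge> 1 \<Longrightarrow> (\<integral>z. f z * z powi k \<partial>circle_measure) = 0"
  by (simp add: H2b_def)

lemma ip_powi: "L2_ip circle_measure f (\<lambda>z. z powi (- k)) = (\<integral>z. f z * z powi k \<partial>circle_measure)"
  unfolding L2_ip_def by (rule Bochner_Integration.integral_cong) (auto simp: cnj_powi)

lemma powi_add_circle: "norm (z::complex) = 1 \<Longrightarrow> z powi k * z powi l = z powi (k + l)"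
  by (subst power_int_add) auto

text \<open>The double annihilator \<open>W\<close> of the nonnegative powers lies in \<open>H2b\<close>, and what remains
  of a function in \<open>H2b\<close> after projection to \<open>W\<close> has no Fourier coefficients at all.\<close>

lemma H2b_mult_zero:
  assumes f: "f \<in> H2b" and g: "g \<in> H2b" and k: "k \<ge> 1"
  shows "(\<integral>z. f z * g z * z powi k \<partial>circle_measure) = 0"
proof -
  let ?m = circle_measure
  define G where "G = {g \<in> L2 ?m. \<forall>k::int. k \<ge> 0 \<longrightarrow> L2_ip ?m g (\<lambda>z. z powi k) = 0}"
  have GL: "G \<subseteq> L2 ?m" by (auto simp: G_def)
  obtain w where w: "w \<in> annihilator ?m G"
    and orth: "\<And>v. v \<in> annihilator ?m G \<Longrightarrow> L2_ip ?m (\<lambda>z. f z - w z) v = 0"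
    using projection_exists[OF GL H2b_L2[OF f]] by blast
  have wL: "w \<in> L2 ?m" using w by (simp add: annihilator_def)
  note fL = H2b_L2[OF f] and gL = H2b_L2[OF g]
  have pos: "(\<lambda>z. z powi k) \<in> annihilator ?m G" if "k \<ge> 0" for k
    using that by (auto simp: annihilator_def G_def L2_powi ip_cnj[of ?m "\<lambda>z. z powi k"])
  have neg: "(\<lambda>z. z powi (- k)) \<in> G" if "k \<ge> 1" for k
  proof -
    have "L2_ip ?m (\<lambda>z. z powi (- k)) (\<lambda>z. z powi l) = 0" if "l \<ge> 0" for l
    proof -
      have "L2_ip ?m (\<lambda>z. z powi (- k)) (\<lambda>z. z powi l) = (\<integral>z. z powi (- k) * z powi (- l) \<partial>?m)"
        using ip_powi[of "\<lambda>z. z powi (- k)" "- l"] by simp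
      also have "\<dots> = (\<integral>z. z powi (- k - l) \<partial>?m)"
        by (rule Bochner_Integration.integral_cong) (auto simp: powi_add_circle)
      finally show ?thesis using \<open>k \<ge> 1\<close> that by (simp add: integral_circle_powi)
    qed
    then show ?thesis by (simp add: G_def L2_powi)
  qed
  have "(\<integral>z. (f z - w z) * z powi l \<partial>?m) = 0" for l
  proof (cases "l \<ge> 1")
    case True
    have "L2_ip ?m w (\<lambda>z. z powi (- l)) = 0" using w neg[OF True] by (simp add: annihilator_def)
    then show ?thesis using H2b_zero[OF f True] ip_powi[of w l]
      by (simp add: left_diff_distrib L2_circle_integrable L2_circle_mult_powi fL wL)
  next
    case False
    then show ?thesis using orth[OF pos[of "- l"]] ip_powi[of "\<lambda>z. f z - w z" l] by simp
  qed
  then have fw: "AE z in ?m. f z - w z = 0"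
    by (intro Fourier_uniqueness L2_circle_integrable L2_diff fL wL)
  \<comment> \<open>\<open>g * z^k\<close> has only frequencies from \<open>k\<close> on, so its
    conjugate is orthogonal to all nonnegative powers. The integral becomes an inner product of
    \<open>f\<close> with an element of \<open>G\<close>, and no two Fourier series have to be
    multiplied.\<close>
  have conjG: "(\<lambda>z. cnj (g z * z powi k)) \<in> G"
  proof -
    have "L2_ip ?m (\<lambda>z. cnj (g z * z powi k)) (\<lambda>z. z powi l) = 0" if "l \<ge> 0" for l
    proof -
      have "L2_ip ?m (\<lambda>z. cnj (g z * z powi k)) (\<lambda>z. z powi l) = cnj (\<integral>z. g z * z powi k * z powi l \<partial>?m)"
        unfolding L2_ip_def by (subst Bochner_Integration.integral_cnj[symmetric]) simp
      also have "(\<integral>z. g z * z powi k * z powi l \<partial>?m) = (\<integral>z. g z * z powi (k + l) \<partial>?m)"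
        by (rule Bochner_Integration.integral_cong) (auto simp: mult.assoc powi_add_circle)
      also have "\<dots> = 0" using that k by (intro H2b_zero[OF g]) auto
      finally show ?thesis by simp
    qed
    then show ?thesis by (simp add: G_def L2_cnj L2_circle_mult_powi gL del: complex_cnj_mult)
  qed
  have "(\<integral>z. f z * g z * z powi k \<partial>?m) = L2_ip ?m f (\<lambda>z. cnj (g z * z powi k))"
    by (simp add: L2_ip_def mult.assoc)
  also have "\<dots> = L2_ip ?m w (\<lambda>z. cnj (g z * z powi k))"
    using fw
    by (intro ip_AE_cong borel_measurable_cnj borel_measurable_times powi_measurable_circle
        L2_measurable[OF fL] L2_measurable[OF wL] L2_measurable[OF gL]) auto
  also have "\<dots> = 0" using w conjG by (simp add: annihilator_def)
  finally show ?thesis .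
qed

text \<open>Termwise integration of the geometric series. With \<open>e = cnj\<close> it expands the
  Cauchy kernel, with the identity the part of the Poisson kernel that is antianalytic in
  \<open>w\<close>.\<close>

lemma powser_integral_sums:
  fixes e :: "complex \<Rightarrow> complex"
  assumes f: "integrable circle_measure f" and w: "norm w < 1"
    and e: "e \<in> borel_measurable circle_measure" "\<And>z. norm z = 1 \<Longrightarrow> norm (e z) = 1"
  shows "(\<lambda>n. w ^ n * (\<integral>z. f z * e z ^ n \<partial>circle_measure)) sums
    (\<integral>z. f z / (1 - w * e z) \<partial>circle_measure)"
proof -
  let ?m = circle_measure
  let ?F = "\<lambda>n z. f z * (w * e z) ^ n"
  note [measurable] = e(1)
  have norm_F: "norm (?F n z) = norm (f z) * norm w ^ n" if "norm z = 1" for n z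
    using e(2)[OF that] by (simp add: norm_mult norm_power)
  have int: "integrable ?m (?F n)" for n
    by (rule integrable_mult_bounded[OF f, where C = 1])
      (use w e(2) in \<open>auto simp: norm_mult norm_power intro!: AE_I2 power_le_one\<close>)
  have "(\<lambda>n. integral\<^sup>L ?m (?F n)) sums (\<integral>z. (\<Sum>n. ?F n z) \<partial>?m)"
  proof (rule sums_integral[OF int])
    show "AE z in ?m. summable (\<lambda>n. norm (?F n z))"
      using w by (auto simp: norm_F intro!: AE_I2 summable_mult summable_geometric)
    have "(\<integral>z. norm (?F n z) \<partial>?m) = (\<integral>z. norm (f z) \<partial>?m) * norm w ^ n" for n
      by (subst Bochner_Integration.integral_cong[OF refl norm_F]) auto
    then show "summable (\<lambda>n. \<integral>z. norm (?F n z) \<partial>?m)"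
      using w by (auto intro!: summable_mult summable_geometric)
  qed
  moreover have "(\<integral>z. (\<Sum>n. ?F n z) \<partial>?m) = (\<integral>z. f z / (1 - w * e z) \<partial>?m)"
  proof (rule Bochner_Integration.integral_cong[OF refl])
    fix z assume "z \<in> space ?m"
    then have "norm (w * e z) < 1" using w e(2)[of z] by (simp add: norm_mult)
    then show "(\<Sum>n. ?F n z) = f z / (1 - w * e z)"
      by (simp add: suminf_mult summable_geometric suminf_geometric divide_inverse)
  qed
  moreover have "integral\<^sup>L ?m (?F n) = w ^ n * (\<integral>z. f z * e z ^ n \<partial>?m)" for n
    by (subst integral_mult_right_zero[symmetric]) (simp add: power_mult_distrib mult.left_commute)
  ultimately show ?thesis by simp
qed

text \<open>Bound \<open>norm d\<close> by \<open>min (norm d) K + (norm d)\<^sup>2 / K\<close>.\<close>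

lemma L1_convergence_of_L2_bounded:
  fixes d :: "nat \<Rightarrow> complex \<Rightarrow> complex"
  assumes d: "\<And>n. d n \<in> L2 circle_measure" "\<And>n. L2_sq circle_measure (d n) \<le> C"
    and lim: "AE z in circle_measure. (\<lambda>n. d n z) \<longlonglongrightarrow> 0"
  shows "(\<lambda>n. \<integral>z. norm (d n z) \<partial>circle_measure) \<longlonglongrightarrow> 0"
proof (rule LIMSEQ_I)
  let ?m = circle_measure
  fix e :: real assume e: "e > 0"
  note [measurable] = d(1)[THEN L2_measurable]
  have C: "C \<ge> 0" using d(2)[of 0] L2_sq_nonneg order_trans by blast
  \<comment> \<open>Chosen so that the tail \<open>C / K\<close> is below \<open>e / 2\<close>; the
    truncated part is left to dominated convergence.\<close>
  define K where "K = 2 * (C + 1) / e"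
  have K: "K > 0" "C / K < e / 2" using e C by (auto simp: K_def field_simps)
  have "(\<lambda>n. \<integral>z. min (norm (d n z)) K \<partial>?m) \<longlonglongrightarrow> (\<integral>z. 0 \<partial>?m)"
  proof (rule integral_dominated_convergence[where w = "\<lambda>_. K"])
    show "AE z in ?m. (\<lambda>n. min (norm (d n z)) K) \<longlonglongrightarrow> 0"
      using lim
    proof eventually_elim
      case (elim z)
      have "(\<lambda>n. min (norm (d n z)) K) \<longlonglongrightarrow> min (norm (0::complex)) K"
        by (intro tendsto_intros elim)
      then show ?case using K by simp
    qed
  qed (use K in auto)
  then have "(\<lambda>n. \<integral>z. min (norm (d n z)) K \<partial>?m) \<longlonglongrightarrow> 0" by simp
  from LIMSEQ_D[OF this half_gt_zero[OF e]] obtain N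
    where N: "\<And>n. n \<ge> N \<Longrightarrow> \<bar>\<integral>z. min (norm (d n z)) K \<partial>?m\<bar> < e / 2"
    by auto
  have "norm ((\<integral>z. norm (d n z) \<partial>?m) - 0) < e" if "n \<ge> N" for n
  proof -
    have i: "integrable ?m (\<lambda>z. min (norm (d n z)) K)"
      by (rule bounded_measurable_integrable_circle[where C = K]) (use K in auto)
    have "(\<integral>z. norm (d n z) \<partial>?m) \<le> (\<integral>z. min (norm (d n z)) K + (norm (d n z))\<^sup>2 / K \<partial>?m)"
    proof (rule integral_mono)
      show "integrable ?m (\<lambda>z. min (norm (d n z)) K + (norm (d n z))\<^sup>2 / K)"
        by (intro Bochner_Integration.integrable_add integrable_divide L2_integrable_sq i d(1))
      show "norm (d n z) \<le> min (norm (d n z)) K + (norm (d n z))\<^sup>2 / K" for z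
      proof (cases "norm (d n z) \<le> K")
        case False
        then have "norm (d n z) * K \<le> norm (d n z) * norm (d n z)" by (intro mult_left_mono) auto
        then have "norm (d n z) \<le> (norm (d n z))\<^sup>2 / K"
          using K by (simp add: power2_eq_square field_simps)
        then show ?thesis using False K by simp
      qed (use K in auto)
    qed (intro integrable_norm L2_circle_integrable d(1))
    also have "\<dots> = (\<integral>z. min (norm (d n z)) K \<partial>?m) + L2_sq ?m (d n) / K"
      using i L2_integrable_sq[OF d(1)] by (simp add: L2_sq_def)
    also have "\<dots> < e / 2 + e / 2"
    proof (rule add_strict_mono)
      have "L2_sq ?m (d n) / K \<le> C / K" using d(2) K by (intro divide_right_mono) auto
      then show "L2_sq ?m (d n) / K < e / 2" using K(2) by (rule le_less_trans)
    qed (use N[OF that] in auto)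
    finally show ?thesis by simp
  qed
  then show "\<exists>N. \<forall>n\<ge>N. norm ((\<integral>z. norm (d n z) \<partial>?m) - 0) < e" by blast
qed

text \<open>The points \<open>r n * \<zeta>\<close> have distance exactly \<open>1 - r n\<close>
  from \<open>\<zeta>\<close>, so the Stolz region of aperture 2 contains them.\<close>

lemma radial_limit:
  assumes "has_nontangential_limit f l \<zeta>" "norm \<zeta> = 1"
    and r: "\<And>n. 0 \<le> r n" "\<And>n. r n < 1" "r \<longlonglongrightarrow> 1"
  shows "(\<lambda>n. f (complex_of_real (r n) * \<zeta>)) \<longlonglongrightarrow> l"
proof -
  define X where "X n = complex_of_real (r n) * \<zeta>" for n
  have dist: "dist (X n) \<zeta> = 1 - r n" for n
  proof -
    have "X n - \<zeta> = complex_of_real (r n - 1) * \<zeta>" by (simp add: X_def algebra_simps)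
    then have "dist (X n) \<zeta> = \<bar>r n - 1\<bar>" using assms(2) by (simp only: dist_norm norm_mult norm_of_real mult_1_right)
    then show ?thesis using r(2)[of n] by simp
  qed
  have "norm (X n) = r n" for n using assms(2) r(1)[of n] by (simp add: X_def norm_mult)
  then have "X n \<in> stolz_region 2 \<zeta> - {\<zeta>}" for n
    using dist[of n] r(1,2)[of n] by (auto simp: stolz_region_def)
  moreover have "X \<longlonglongrightarrow> \<zeta>"
  proof -
    have "(\<lambda>n. complex_of_real (r n) * \<zeta>) \<longlonglongrightarrow> complex_of_real 1 * \<zeta>" by (intro tendsto_intros r)
    then show ?thesis by (simp add: X_def[abs_def])
  qed
  moreover have "(f \<longlongrightarrow> l) (at \<zeta> within stolz_region 2 \<zeta>)"
    using assms(1) by (auto simp: has_nontangential_limit_def)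
  ultimately show ?thesis
    unfolding tendsto_at_iff_sequentially by (auto simp: X_def[abs_def] o_def)
qed

lemma dilation_continuous:
  assumes "f holomorphic_on disc" "0 \<le> r" "r < 1"
  shows "continuous_on circle (\<lambda>z. f (complex_of_real r * z))"
  by (rule continuous_on_compose2[OF holomorphic_on_imp_continuous_on[OF assms(1)]])
    (use assms in \<open>auto intro!: continuous_intros simp: norm_mult\<close>)

text \<open>The power series converges absolutely and uniformly on the circle of radius
  \<open>r\<close>, and its terms times \<open>z powi k\<close> have frequencies
  \<open>n + k \<ge> 1\<close>.\<close>

lemma dilation_Fourier_coeff:
  assumes f: "f holomorphic_on disc" and r: "0 \<le> r" "r < 1" and k: "k \<ge> 1"
  shows "(\<integral>z. f (complex_of_real r * z) * z powi k \<partial>circle_measure) = 0"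
proof -
  let ?m = circle_measure
  define a where "a n = (deriv ^^ n) f 0 / fact n" for n
  have S: "(\<lambda>n. a n * w ^ n) sums f w" if "norm w < 1" for w
    using holomorphic_power_series[OF f, of w] that by (simp add: a_def)
  define F where "F n z = a n * (of_real r * z) ^ n * z powi k" for n and z :: complex
  have abs: "summable (\<lambda>n. norm (a n * complex_of_real r ^ n))"
  proof (rule powser_insidea)
    show "summable (\<lambda>n. a n * (complex_of_real ((1 + r) / 2)) ^ n)"
      using S[of "complex_of_real ((1 + r) / 2)"] r by (auto intro: sums_summable simp del: of_real_add of_real_divide)
    show "norm (complex_of_real r) < norm (complex_of_real ((1 + r) / 2))"
      using r by (simp del: of_real_add of_real_divide)
  qed
  have norm_F: "norm (F n z) = norm (a n * complex_of_real r ^ n)" if "norm z = 1" for n z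
    using that by (simp add: F_def norm_mult norm_power norm_power_int)
  have cont: "continuous_on circle (F n)" for n
    unfolding F_def by (intro continuous_intros) auto
  have int: "integrable ?m (F n)" for n
    by (rule bounded_measurable_integrable_circle[where C = "norm (a n * complex_of_real r ^ n)"])
      (auto simp: norm_F cont intro!: AE_I2)
  have "(\<lambda>n. integral\<^sup>L ?m (F n)) sums (\<integral>z. (\<Sum>n. F n z) \<partial>?m)"
  proof (rule sums_integral[OF int])
    show "AE z in ?m. summable (\<lambda>n. norm (F n z))" using abs by (auto simp: norm_F)
    have "(\<integral>z. norm (F n z) \<partial>?m) = norm (a n * complex_of_real r ^ n)" for n
      by (subst Bochner_Integration.integral_cong[OF refl norm_F]) (auto simp: circle.prob_space[simplified])
    then show "summable (\<lambda>n. \<integral>z. norm (F n z) \<partial>?m)" using abs by simp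
  qed
  moreover have "(\<integral>z. (\<Sum>n. F n z) \<partial>?m) = (\<integral>z. f (complex_of_real r * z) * z powi k \<partial>?m)"
  proof (rule Bochner_Integration.integral_cong[OF refl])
    fix z assume "z \<in> space ?m"
    then have "norm (complex_of_real r * z) < 1" using r by (simp add: norm_mult)
    from sums_mult2[OF S[OF this], of "z powi k"]
    show "(\<Sum>n. F n z) = f (complex_of_real r * z) * z powi k"
      by (simp add: F_def sums_iff)
  qed
  moreover have "integral\<^sup>L ?m (F n) = 0" for n
  proof -
    have "integral\<^sup>L ?m (F n) = (\<integral>z. a n * of_real r ^ n * z powi (int n + k) \<partial>?m)"
      by (rule Bochner_Integration.integral_cong)
        (auto simp: F_def power_mult_distrib powi_add_circle[symmetric])
    then show ?thesis using k by (simp add: integral_circle_powi)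
  qed
  ultimately show ?thesis by (simp add: sums_iff)
qed

text \<open>Fatou's lemma along the dilations puts the boundary function into \<open>L2\<close>. The
  Fourier coefficients pass to the limit by \<open>L^1\<close> convergence of the dilations, which
  follows from almost everywhere convergence and the uniform \<open>L2\<close> bound.\<close>

lemma Hardy_imp_H2b:
  assumes "f \<in> Hardy 2"
  shows "f \<in> H2b"
proof -
  let ?m = circle_measure
  have hol: "f holomorphic_on disc" and [measurable]: "f \<in> borel_measurable ?m"
    and bv: "AE \<zeta> in ?m. has_nontangential_limit f (f \<zeta>) \<zeta>"
    using assms by (auto simp: Hardy_def has_own_boundary_values_def)
  obtain C where C: "\<And>r. 0 \<le> r \<Longrightarrow> r < 1 \<Longrightarrow> (\<integral>z. (norm (f (of_real r * z)))\<^sup>2 \<partial>?m) \<le> C"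
    using assms by (auto simp: Hardy_def)
  define r where "r n = 1 - 1 / (real n + 1)" for n
  have r: "0 \<le> r n" "r n < 1" for n by (auto simp: r_def)
  have rlim: "r \<longlonglongrightarrow> 1" unfolding r_def
    using tendsto_diff[OF tendsto_const[of 1] LIMSEQ_inverse_real_of_nat] by (simp add: inverse_eq_divide add.commute)
  define g where "g n z = f (complex_of_real (r n) * z)" for n z
  have cont: "continuous_on circle (g n)" for n
    unfolding g_def by (rule dilation_continuous[OF hol r])
  have [measurable]: "g n \<in> borel_measurable ?m" for n using cont by simp
  have gL: "g n \<in> L2 ?m" for n
  proof -
    obtain B where "\<And>z. z \<in> circle \<Longrightarrow> norm (g n z) \<le> B"
      by (fact continuous_on_circle_bounded[OF cont])
    then show ?thesis by (intro L2_circle_bounded[where C = B]) auto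
  qed
  have gC: "L2_sq ?m (g n) \<le> C" for n unfolding L2_sq_def g_def by (rule C[OF r])
  have lim: "AE z in ?m. (\<lambda>n. g n z) \<longlonglongrightarrow> f z"
    using bv AE_space
    by eventually_elim (auto simp: g_def intro: radial_limit r rlim)
  have "(\<integral>\<^sup>+z. ennreal ((norm (f z))\<^sup>2) \<partial>?m) = (\<integral>\<^sup>+z. liminf (\<lambda>n. ennreal ((norm (g n z))\<^sup>2)) \<partial>?m)"
  proof (intro nn_integral_cong_AE)
    show "AE z in ?m. ennreal ((norm (f z))\<^sup>2) = liminf (\<lambda>n. ennreal ((norm (g n z))\<^sup>2))"
      using lim
    proof eventually_elim
      case (elim z)
      then have "(\<lambda>n. ennreal ((norm (g n z))\<^sup>2)) \<longlonglongrightarrow> ennreal ((norm (f z))\<^sup>2)"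
        by (intro tendsto_intros)
      then show ?case by (rule lim_imp_Liminf[symmetric, OF sequentially_bot])
    qed
  qed
  also have "\<dots> \<le> liminf (\<lambda>n. \<integral>\<^sup>+z. ennreal ((norm (g n z))\<^sup>2) \<partial>?m)"
    by (rule nn_integral_liminf) simp
  also have "\<dots> \<le> liminf (\<lambda>n. ennreal C)"
    using gL gC by (intro Liminf_mono always_eventually) (auto simp: nn_integral_L2_sq ennreal_leI)
  finally have bound: "(\<integral>\<^sup>+z. ennreal ((norm (f z))\<^sup>2) \<partial>?m) \<le> ennreal C" by (simp add: Liminf_const)
  have "integrable ?m (\<lambda>z. (norm (f z))\<^sup>2)"
    by (rule integrableI_bounded) (use bound in \<open>auto simp: top_unique less_top[symmetric]\<close>)
  then have fL: "f \<in> L2 ?m" by (simp add: L2_def)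
  have L1: "(\<lambda>n. \<integral>z. norm (g n z - f z) \<partial>?m) \<longlonglongrightarrow> 0"
  proof (rule L1_convergence_of_L2_bounded[where C = "2 * C + 2 * L2_sq ?m f"])
    show "L2_sq ?m (\<lambda>z. g n z - f z) \<le> 2 * C + 2 * L2_sq ?m f" for n
      using L2_sq_parallelogram[OF gL[of n] fL] gC[of n] L2_sq_nonneg[of ?m "\<lambda>z. g n z + f z"] by linarith
    show "AE z in ?m. (\<lambda>n. g n z - f z) \<longlonglongrightarrow> 0" using lim by (simp add: LIM_zero_iff)
  qed (intro L2_diff gL fL)
  have "(\<integral>z. f z * z powi k \<partial>?m) = 0" if k: "k \<ge> 1" for k
  proof -
    have "norm (\<integral>z. f z * z powi k \<partial>?m) \<le> (\<integral>z. norm (g n z - f z) \<partial>?m)" for n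
    proof -
      have "(\<integral>z. g n z * z powi k \<partial>?m) = 0"
        unfolding g_def by (rule dilation_Fourier_coeff[OF hol r k])
      then have "norm (\<integral>z. f z * z powi k \<partial>?m) = norm (\<integral>z. (g n z - f z) * z powi k \<partial>?m)"
        by (simp add: left_diff_distrib L2_circle_integrable L2_circle_mult_powi gL fL)
      also have "\<dots> \<le> (\<integral>z. norm (g n z - f z) \<partial>?m)"
        by (rule Bochner_Integration.integral_norm_bound_integral)
          (auto simp: norm_mult norm_power_int intro!: L2_circle_integrable L2_circle_mult_powi integrable_norm L2_diff gL fL)
      finally show ?thesis .
    qed
    then have "norm (\<integral>z. f z * z powi k \<partial>?m) \<le> 0"
      by (intro tendsto_lowerbound[OF L1]) auto
    then show ?thesis by simp
  qed
  then show ?thesis using fL by (simp add: H2b_def)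
qed

section \<open>The Fatou theorem\<close>

definition poisson :: "complex \<Rightarrow> complex \<Rightarrow> real" where
  "poisson w z = (1 - (norm w)\<^sup>2) / (norm (z - w))\<^sup>2"

lemma poisson_nonneg: "norm w < 1 \<Longrightarrow> poisson w z \<ge> 0"
  by (simp add: poisson_def power_le_one)

lemma poisson_measurable [measurable]: "poisson w \<in> borel_measurable circle_measure"
  unfolding poisson_def[abs_def] by measurable

lemma poisson_bound:
  assumes "norm w < 1" "norm z = 1"
  shows "poisson w z \<le> 1 / (1 - norm w)\<^sup>2"
proof -
  have "1 - norm w \<le> norm (z - w)" using norm_triangle_ineq2[of z w] assms by simp
  then have "(1 - norm w)\<^sup>2 \<le> (norm (z - w))\<^sup>2" using assms by (intro power_mono) auto
  then show ?thesis unfolding poisson_def using assms by (intro frac_le) auto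
qed

text \<open>Lets the integration over the evaluation point, after an exchange of integrals, become
  the one that gives total mass 1.\<close>

lemma poisson_flip:
  assumes "norm z = 1" "norm v = 1"
  shows "poisson (complex_of_real r * z) v = poisson (complex_of_real r * v) z"
proof -
  have eq: "cnj v * (v - of_real r * z) = cnj (cnj z * (z - of_real r * v))"
    using assms complex_norm_square[of v] complex_norm_square[of z] by (simp add: algebra_simps)
  have "norm (v - of_real r * z) = norm (cnj v * (v - of_real r * z))"
    using assms by (simp add: norm_mult)
  also have "\<dots> = norm (cnj z) * norm (z - of_real r * v)"
    unfolding eq by (simp only: complex_mod_cnj norm_mult)
  finally show ?thesis using assms by (simp add: poisson_def norm_mult)
qed

text \<open>The first summand is the Cauchy kernel, analytic in \<open>w\<close>. The second is
  antianalytic and vanishes at \<open>w = 0\<close>, so that the constant is counted once.\<close>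

lemma poisson_kernel_eq:
  assumes w: "norm w < 1" and z: "norm z = 1"
  shows "1 / (1 - w * cnj z) + (1 / (1 - cnj w * z) - 1) = complex_of_real (poisson w z)"
proof -
  have zz: "z * cnj z = 1" using z complex_norm_square[of z] by simp
  have ne: "1 - w * cnj z \<noteq> 0" "1 - cnj w * z \<noteq> 0"
  proof -
    have "norm (w * cnj z) < 1" "norm (cnj w * z) < 1" using w z by (simp_all add: norm_mult)
    then show "1 - w * cnj z \<noteq> 0" "1 - cnj w * z \<noteq> 0" by auto
  qed
  have "norm (z - w) = norm (cnj z * (z - w))" using z by (simp add: norm_mult)
  also have "cnj z * (z - w) = 1 - w * cnj z" using zz by (simp add: algebra_simps)
  finally have "complex_of_real ((norm (z - w))\<^sup>2) = (1 - w * cnj z) * (1 - cnj w * z)"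
    using complex_norm_square[of "1 - w * cnj z"] by simp
  then have "complex_of_real (poisson w z) = (1 - w * cnj w) / ((1 - w * cnj z) * (1 - cnj w * z))"
    using complex_norm_square[of w] unfolding poisson_def of_real_divide by simp
  moreover have "w * cnj w = (w * cnj z) * (cnj w * z)"
    using zz by (simp add: mult_ac)
  moreover have "1 / (1 - a) + (1 / (1 - b) - 1) = (1 - a * b) / ((1 - a) * (1 - b))"
    if "1 - a \<noteq> 0" "1 - b \<noteq> 0" for a b :: complex
    using that by (simp add: divide_simps) (simp add: algebra_simps)
  ultimately show ?thesis using ne by simp
qed

lemma cauchy_kernel_bound:
  assumes "norm w < 1" "norm z = 1"
  shows "norm (1 / (1 - w * cnj z)) \<le> 1 / (1 - norm w)" "norm (1 / (1 - cnj w * z)) \<le> 1 / (1 - norm w)"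
proof -
  have "1 - norm w \<le> norm (1 - w * cnj z)" "1 - norm w \<le> norm (1 - cnj w * z)"
    using norm_triangle_ineq2[of 1 "w * cnj z"] norm_triangle_ineq2[of 1 "cnj w * z"] assms
    by (simp_all add: norm_mult)
  then show "norm (1 / (1 - w * cnj z)) \<le> 1 / (1 - norm w)" "norm (1 / (1 - cnj w * z)) \<le> 1 / (1 - norm w)"
    using assms by (auto simp: norm_divide intro!: frac_le)
qed

text \<open>The analytic extension of a boundary function. As a Cauchy integral it is visibly
  holomorphic; for \<open>f\<close> in \<open>H2b\<close> it agrees with the Poisson integral, whose
  positive kernel controls the boundary behaviour.\<close>

definition cauchy_transform :: "(complex \<Rightarrow> complex) \<Rightarrow> complex \<Rightarrow> complex" where
  "cauchy_transform f w = (\<integral>z. f z / (1 - w * cnj z) \<partial>circle_measure)"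

lemma cauchy_transform_holomorphic:
  assumes "f \<in> H2b" shows "cauchy_transform f holomorphic_on disc"
proof (rule power_series_holomorphic)
  fix w :: complex assume "w \<in> disc"
  then have "norm w < 1" by simp
  from powser_integral_sums[OF L2_circle_integrable[OF H2b_L2[OF assms]] this, of cnj]
  show "(\<lambda>n. (\<integral>z. f z * cnj z ^ n \<partial>circle_measure) * (w - 0) ^ n) sums cauchy_transform f w"
    by (simp add: cauchy_transform_def mult.commute)
qed

text \<open>The antianalytic part of the Poisson kernel pairs \<open>f\<close> with the powers
  \<open>z^n\<close>. For \<open>n \<ge> 1\<close> these integrals vanish, and the term
  \<open>n = 0\<close> cancels against the subtracted constant.\<close>

lemma cauchy_transform_poisson:
  assumes f: "f \<in> H2b" and w: "norm w < 1"
  shows "cauchy_transform f w = (\<integral>z. f z * complex_of_real (poisson w z) \<partial>circle_measure)"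
proof -
  let ?m = circle_measure
  have fi: "integrable ?m f" by (intro L2_circle_integrable H2b_L2 f)
  have i1: "integrable ?m (\<lambda>z. f z * (1 / (1 - w * cnj z)))"
    by (rule integrable_mult_bounded[OF fi, where C = "1 / (1 - norm w)"])
      (use w in \<open>auto intro!: AE_I2 cauchy_kernel_bound simp del: norm_divide\<close>)
  have i2: "integrable ?m (\<lambda>z. f z * (1 / (1 - cnj w * z)))"
    by (rule integrable_mult_bounded[OF fi, where C = "1 / (1 - norm w)"])
      (use w in \<open>auto intro!: AE_I2 cauchy_kernel_bound simp del: norm_divide\<close>)
  have "(\<lambda>n. cnj w ^ n * (\<integral>z. f z * z ^ n \<partial>?m)) sums (\<integral>z. f z / (1 - cnj w * z) \<partial>?m)"
    using w by (intro powser_integral_sums fi) auto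
  moreover have "(\<lambda>n. cnj w ^ n * (\<integral>z. f z * z ^ n \<partial>?m)) sums (\<integral>z. f z \<partial>?m)"
  proof -
    have "(\<lambda>n. cnj w ^ n * (\<integral>z. f z * z ^ n \<partial>?m)) sums (\<Sum>n\<in>{0}. cnj w ^ n * (\<integral>z. f z * z ^ n \<partial>?m))"
    proof (rule sums_finite)
      show "cnj w ^ n * (\<integral>z. f z * z ^ n \<partial>?m) = 0" if "n \<notin> {0}" for n
        using that H2b_zero[OF f, of "int n"] by simp
    qed simp
    then show ?thesis by simp
  qed
  ultimately have eq: "(\<integral>z. f z / (1 - cnj w * z) \<partial>?m) = (\<integral>z. f z \<partial>?m)"
    by (rule sums_unique2)
  have "(\<integral>z. f z * complex_of_real (poisson w z) \<partial>?m)
      = (\<integral>z. f z * (1 / (1 - w * cnj z)) + (f z * (1 / (1 - cnj w * z)) - f z) \<partial>?m)"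
  proof (rule Bochner_Integration.integral_cong[OF refl])
    fix z assume "z \<in> space ?m"
    then have "norm z = 1" by simp
    show "f z * complex_of_real (poisson w z) = f z * (1 / (1 - w * cnj z)) + (f z * (1 / (1 - cnj w * z)) - f z)"
      unfolding poisson_kernel_eq[OF w \<open>norm z = 1\<close>, symmetric] by (simp only: algebra_simps mult_1_right mult_1_left)
  qed
  also have "\<dots> = cauchy_transform f w + ((\<integral>z. f z / (1 - cnj w * z) \<partial>?m) - (\<integral>z. f z \<partial>?m))"
    using i1 i2 fi by (simp add: cauchy_transform_def)
  finally show ?thesis using eq by simp
qed

lemma const_H2b: "(\<lambda>z. c) \<in> H2b"
  by (auto simp: H2b_def integral_circle_powi intro: L2_circle_bounded[where C = "norm c"])

text \<open>This is the Poisson formula for the constant 1, whose Cauchy transform is 1.\<close>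

lemma integral_poisson:
  assumes w: "norm w < 1"
  shows "(\<integral>z. poisson w z \<partial>circle_measure) = 1"
proof -
  let ?m = circle_measure
  have one: "(\<lambda>z. 1) \<in> H2b" by (rule const_H2b)
  have "(\<lambda>n. w ^ n * (\<integral>z. 1 * cnj z ^ n \<partial>?m)) sums (\<integral>z. 1 / (1 - w * cnj z) \<partial>?m)"
    using w by (intro powser_integral_sums) auto
  moreover have "(\<lambda>n. w ^ n * (\<integral>z. 1 * cnj z ^ n \<partial>?m)) sums 1"
  proof -
    have *: "(\<integral>z. 1 * cnj z ^ n \<partial>?m) = (if n = 0 then 1 else 0)" for n
    proof -
      have "(\<integral>z. 1 * cnj z ^ n \<partial>?m) = (\<integral>z. z powi (- int n) \<partial>?m)"
        by (rule Bochner_Integration.integral_cong) (auto simp: cnj_powi[symmetric])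
      then show ?thesis by (simp add: integral_circle_powi)
    qed
    have "(\<lambda>n. w ^ n * (\<integral>z. 1 * cnj z ^ n \<partial>?m)) sums (\<Sum>n\<in>{0}. w ^ n * (\<integral>z. 1 * cnj z ^ n \<partial>?m))"
      by (rule sums_finite) (simp_all only: *, simp_all)
    then show ?thesis by (simp only: *) simp
  qed
  ultimately have "cauchy_transform (\<lambda>z. 1) w = 1"
    unfolding cauchy_transform_def by (rule sums_unique2)
  then have "complex_of_real (\<integral>z. poisson w z \<partial>?m) = 1"
    using cauchy_transform_poisson[OF one w] by simp
  then show ?thesis by (metis of_real_eq_1_iff)
qed

lemma poisson_integrable: "norm w < 1 \<Longrightarrow> integrable circle_measure (poisson w)"
  by (rule bounded_measurable_integrable_circle[where C = "1 / (1 - norm w)\<^sup>2"])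
    (auto simp: poisson_nonneg intro!: AE_I2 poisson_bound)

text \<open>Jensen's inequality for the probability density \<open>poisson w\<close>, obtained from
  Cauchy-Schwarz by splitting the kernel into two factors \<open>sqrt (poisson w z)\<close>.\<close>

lemma cauchy_transform_bound:
  assumes f: "f \<in> H2b" and w: "norm w < 1"
  shows "ennreal ((norm (cauchy_transform f w))\<^sup>2)
    \<le> (\<integral>\<^sup>+v. ennreal (poisson w v * (norm (f v))\<^sup>2) \<partial>circle_measure)"
proof -
  let ?m = circle_measure
  define s where "s z = complex_of_real (sqrt (poisson w z))" for z
  note [measurable] = L2_measurable[OF H2b_L2[OF f]]
  have [measurable]: "s \<in> borel_measurable ?m" unfolding s_def by measurable
  have s_bound: "norm (s z) \<le> 1 / (1 - norm w)" if "norm z = 1" for z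
  proof -
    have "sqrt (poisson w z) \<le> sqrt (1 / (1 - norm w)\<^sup>2)"
      by (intro real_sqrt_le_mono poisson_bound w that)
    then show ?thesis using w by (simp add: s_def real_sqrt_divide poisson_nonneg)
  qed
  have sL: "s \<in> L2 ?m" by (rule L2_circle_bounded[where C = "1 / (1 - norm w)"]) (use s_bound in auto)
  have fsL: "(\<lambda>z. f z * s z) \<in> L2 ?m"
    by (rule L2_mult_bounded[where C = "1 / (1 - norm w)"]) (use s_bound f in \<open>auto intro: H2b_L2\<close>)
  have ss: "s z * s z = complex_of_real (poisson w z)" for z
    using poisson_nonneg[OF w, of z] unfolding s_def of_real_mult[symmetric] by simp
  have norm_s: "(norm (s z))\<^sup>2 = poisson w z" for z
    using poisson_nonneg[OF w, of z] by (simp add: s_def)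
  have "cauchy_transform f w = L2_ip ?m (\<lambda>z. f z * s z) s"
    unfolding cauchy_transform_poisson[OF f w] L2_ip_def ss[symmetric] by (simp add: s_def mult.assoc)
  moreover have "L2_sq ?m s = 1"
    unfolding L2_sq_def norm_s by (rule integral_poisson[OF w])
  ultimately have "(norm (cauchy_transform f w))\<^sup>2 \<le> L2_sq ?m (\<lambda>z. f z * s z)"
    using L2_Cauchy_Schwarz[OF fsL sL] by simp
  then have "ennreal ((norm (cauchy_transform f w))\<^sup>2) \<le> (\<integral>\<^sup>+v. ennreal ((norm (f v * s v))\<^sup>2) \<partial>?m)"
    by (simp add: nn_integral_L2_sq[OF fsL] ennreal_leI)
  also have "\<dots> = (\<integral>\<^sup>+v. ennreal (poisson w v * (norm (f v))\<^sup>2) \<partial>?m)"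
    by (simp add: norm_mult power_mult_distrib norm_s mult.commute)
  finally show ?thesis .
qed

text \<open>Integrate the pointwise bound over the circle: by Tonelli's theorem and the symmetry of
  the kernel each \<open>norm (f v) ^ 2\<close> is weighted with total mass 1.\<close>

lemma cauchy_transform_dilation_bound:
  assumes f: "f \<in> H2b" and r: "0 \<le> r" "r < 1"
  shows "(\<integral>z. (norm (cauchy_transform f (complex_of_real r * z)))\<^sup>2 \<partial>circle_measure) \<le> L2_sq circle_measure f"
proof (rule integral_real_bounded)
  let ?m = circle_measure
  note [measurable] = L2_measurable[OF H2b_L2[OF f]]
  interpret pair_sigma_finite ?m ?m ..
  have rz: "norm (complex_of_real r * z) < 1" if "norm z = 1" for z
    using that r by (simp add: norm_mult)
  have "(\<integral>\<^sup>+z. ennreal ((norm (cauchy_transform f (complex_of_real r * z)))\<^sup>2) \<partial>?m)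
      \<le> (\<integral>\<^sup>+z. (\<integral>\<^sup>+v. ennreal (poisson (complex_of_real r * z) v * (norm (f v))\<^sup>2) \<partial>?m) \<partial>?m)"
    by (intro nn_integral_mono cauchy_transform_bound f rz) simp
  also have "\<dots> = (\<integral>\<^sup>+v. (\<integral>\<^sup>+z. ennreal (poisson (complex_of_real r * z) v * (norm (f v))\<^sup>2) \<partial>?m) \<partial>?m)"
    unfolding poisson_def by (rule Fubini') measurable
  also have "\<dots> = (\<integral>\<^sup>+v. ennreal ((norm (f v))\<^sup>2) \<partial>?m)"
  proof (rule nn_integral_cong)
    fix v assume "v \<in> space ?m"
    then have v: "norm v = 1" by simp
    have "(\<integral>\<^sup>+z. ennreal (poisson (complex_of_real r * z) v * (norm (f v))\<^sup>2) \<partial>?m)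
        = (\<integral>\<^sup>+z. ennreal (poisson (complex_of_real r * v) z) * ennreal ((norm (f v))\<^sup>2) \<partial>?m)"
      by (rule nn_integral_cong) (simp add: poisson_flip[OF _ v] ennreal_mult poisson_nonneg rz v)
    also have "\<dots> = (\<integral>\<^sup>+z. ennreal (poisson (complex_of_real r * v) z) \<partial>?m) * ennreal ((norm (f v))\<^sup>2)"
      by (rule nn_integral_multc) simp
    also have "(\<integral>\<^sup>+z. ennreal (poisson (complex_of_real r * v) z) \<partial>?m) = 1"
      using rz[OF v]
      by (subst nn_integral_eq_integral) (auto simp: poisson_integrable poisson_nonneg integral_poisson)
    finally show "(\<integral>\<^sup>+z. ennreal (poisson (complex_of_real r * z) v * (norm (f v))\<^sup>2) \<partial>?m) = ennreal ((norm (f v))\<^sup>2)"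
      by simp
  qed
  also have "\<dots> = ennreal (L2_sq ?m f)" by (rule nn_integral_L2_sq[OF H2b_L2[OF f]])
  finally show "(\<integral>\<^sup>+z. ennreal ((norm (cauchy_transform f (complex_of_real r * z)))\<^sup>2) \<partial>?m) \<le> ennreal (L2_sq ?m f)" .
qed (rule L2_sq_nonneg)

section \<open>Lebesgue points on the circle\<close>

lemma cis_diff_norm: "norm (cis s - cis t) = 2 * \<bar>sin ((s - t) / 2)\<bar>"
proof -
  have "cis s - cis t = cis t * (cis (s - t) - 1)"
    by (simp add: right_diff_distrib cis_mult)
  then have "norm (cis s - cis t) = norm (cis (s - t) - 1)" by (simp add: norm_mult)
  then show ?thesis using dist_exp_i_1[of "s - t"] by (simp add: cis_conv_exp)
qed

lemma sin_ge_half: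
  assumes "0 \<le> x" "x \<le> pi / 3" shows "x / 2 \<le> sin x"
proof (cases "x = 0")
  case False
  then have "0 < x" using assms by simp
  then obtain z where z: "0 < z" "z < x" "sin x - sin 0 = (x - 0) * cos z"
    using MVT2[of 0 x sin cos] by auto
  have "cos (pi / 3) \<le> cos z" using z assms by (intro cos_monotone_0_pi_le) auto
  then have "x * (1 / 2) \<le> x * cos z" using \<open>0 < x\<close> by (intro mult_left_mono) (auto simp: cos_60)
  then show ?thesis using z by simp
qed simp

text \<open>Replaces small chords by small arcs. At \<open>t = 0\<close> this would fail, since
  angles just below \<open>2 * pi\<close> are near in the plane but far in the parameter.\<close>

lemma cis_local_inverse:
  assumes t: "0 < t" "t < 2 * pi"
  obtains d where "d > 0" "\<And>s. 0 \<le> s \<Longrightarrow> s < 2 * pi \<Longrightarrow> norm (cis s - cis t) < d \<Longrightarrow> \<bar>s - t\<bar> \<le> 2 * norm (cis s - cis t)"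
proof -
  \<comment> \<open>\<open>b < pi\<close> bounds the half angle \<open>y\<close> over the whole
    parameter interval. Between \<open>pi / 3\<close> and \<open>b\<close> the sine has a positive
    minimum, so a short chord forces \<open>y \<le> pi / 3\<close>, where the sine is at least half
    its argument. The \<open>pi / 3\<close> in the maximum keeps that range nonempty.\<close>
  define b where "b = max (pi / 3) (max t (2 * pi - t) / 2)"
  have b: "pi / 3 \<le> b" "b < pi" using t by (auto simp: b_def)
  obtain x0 where x0: "x0 \<in> {pi / 3..b}" "\<And>x. x \<in> {pi / 3..b} \<Longrightarrow> sin x0 \<le> sin x"
    using continuous_attains_inf[OF compact_Icc _ continuous_on_sin[OF continuous_on_id], of "pi / 3" b] b
    by auto
  have "0 < sin x0" using x0(1) b pi_gt_zero by (intro sin_gt_zero) auto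
  moreover have "\<bar>s - t\<bar> \<le> 2 * norm (cis s - cis t)"
    if s: "0 \<le> s" "s < 2 * pi" "norm (cis s - cis t) < sin x0" for s
  proof -
    define y where "y = \<bar>s - t\<bar> / 2"
    have y: "0 \<le> y" "y \<le> b" using s t by (auto simp: y_def b_def max_def)
    have "\<bar>sin ((s - t) / 2)\<bar> = \<bar>sin y\<bar>"
    proof (cases "s \<ge> t")
      case False
      then have "(s - t) / 2 = - y" by (simp add: y_def field_simps)
      then show ?thesis by (simp only: sin_minus abs_minus_cancel)
    qed (simp add: y_def)
    also have "\<dots> = sin y" using y b by (simp add: sin_ge_zero)
    finally have eq: "norm (cis s - cis t) = 2 * sin y" by (simp add: cis_diff_norm)
    have "sin y \<ge> 0" using y b by (simp add: sin_ge_zero)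
    have "y \<le> pi / 3"
    proof (rule ccontr)
      assume "\<not> y \<le> pi / 3"
      then have "sin x0 \<le> sin y" using y by (intro x0(2)) auto
      then show False using s(3) \<open>sin y \<ge> 0\<close> unfolding eq by linarith
    qed
    then have "y / 2 \<le> sin y" using y by (intro sin_ge_half)
    then show ?thesis unfolding eq by (simp add: y_def)
  qed
  ultimately show ?thesis by (rule that)
qed

text \<open>The library supplies the Lebesgue differentiation theorem for intervals to the right of a
  point; applying it to \<open>norm (g x - q)\<close> for all \<open>q\<close> in a countable dense set and to
  the reflected function yields two-sided Lebesgue points.\<close>

lemma right_Lebesgue_points:
  fixes g :: "real \<Rightarrow> complex"
  assumes g: "integrable lborel g"
  shows "AE t in lborel. \<forall>e>0. \<exists>d>0. \<forall>h. 0 < h \<and> h < d \<longrightarrow>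
    (\<integral>\<^sup>+s. ennreal (norm (g s - g t)) * indicator {t..t + h} s \<partial>lborel) \<le> ennreal (e * h)"
proof -
  obtain D :: "complex set" where D: "countable D" "\<And>X. open X \<Longrightarrow> X \<noteq> {} \<Longrightarrow> \<exists>q\<in>D. q \<in> X"
    using countable_dense_exists by blast
  have int: "integrable lborel (\<lambda>s. indicator {a..b} s *\<^sub>R norm (g s - q))" for a b q
  proof -
    have "integrable lborel (\<lambda>s. indicator {a..b} s *\<^sub>R g s - indicator {a..b} s *\<^sub>R q)"
    proof (rule Bochner_Integration.integrable_diff)
      show "integrable lborel (\<lambda>s. indicator {a..b} s *\<^sub>R g s)"
        by (rule integrable_mult_indicator[OF _ g]) simp
      show "integrable lborel (\<lambda>s. indicator {a..b} s *\<^sub>R q)"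
        by (intro integrable_scaleR_left impI integrable_real_indicator) (auto simp: emeasure_lborel_Icc_eq)
    qed
    then have "integrable lborel (\<lambda>s. norm (indicator {a..b} s *\<^sub>R g s - indicator {a..b} s *\<^sub>R q))"
      by (rule integrable_norm)
    then show ?thesis
      by (rule Bochner_Integration.integrable_cong[THEN iffD1, rotated 2]) (auto split: split_indicator)
  qed
  have point: "AE t in lborel. \<forall>e>0. \<exists>d>0. \<forall>h. 0 < h \<and> h < d \<longrightarrow>
      (\<integral>\<^sup>+s. ennreal (norm (g s - q)) * indicator {t..t + h} s \<partial>lborel) \<le> ennreal ((norm (g t - q) + e) * h)" for q
  proof -
    have on: "(\<lambda>s. norm (g s - q)) integrable_on cbox a b" for a b
      using set_borel_integral_eq_integral(1)[of "{a..b}" "\<lambda>s. norm (g s - q)"] int[of a b q]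
      by (simp add: set_integrable_def)
    obtain N where N: "negligible N" and
      lim: "\<And>t e. t \<notin> N \<Longrightarrow> 0 < e \<Longrightarrow> \<exists>d>0. \<forall>h. 0 < h \<and> h < d \<longrightarrow>
        norm (integral (cbox t (t + h *\<^sub>R One)) (\<lambda>s. norm (g s - q)) /\<^sub>R h ^ DIM(real) - norm (g t - q)) < e"
      using integrable_ccontinuous_explicit[OF on] by metis
    have "AE t in lebesgue. t \<notin> N" using N by (simp add: negligible_iff_null_sets AE_not_in)
    then have "AE t in lborel. t \<notin> N" by (simp add: AE_completion_iff)
    then show ?thesis
    proof eventually_elim
      case (elim t)
      show ?case
      proof (intro allI impI)
        fix e :: real assume "e > 0"
        then obtain d where d: "d > 0" "\<And>h. 0 < h \<Longrightarrow> h < d \<Longrightarrow>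
            norm (integral (cbox t (t + h *\<^sub>R One)) (\<lambda>s. norm (g s - q)) /\<^sub>R h ^ DIM(real) - norm (g t - q)) < e"
          using lim[OF elim] by blast
        have "(\<integral>\<^sup>+s. ennreal (norm (g s - q)) * indicator {t..t + h} s \<partial>lborel) \<le> ennreal ((norm (g t - q) + e) * h)"
          if h: "0 < h" "h < d" for h
        proof -
          define I where "I = integral {t..t + h} (\<lambda>s. norm (g s - q))"
          have "\<bar>I / h - norm (g t - q)\<bar> < e"
            using d(2)[OF h] by (simp add: I_def divide_inverse mult.commute)
          then have "I / h \<le> norm (g t - q) + e" by linarith
          then have I: "I \<le> (norm (g t - q) + e) * h" using h by (simp add: divide_le_eq)
          have "(\<integral>\<^sup>+s. ennreal (norm (g s - q)) * indicator {t..t + h} s \<partial>lborel)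
              = (\<integral>\<^sup>+s. ennreal (indicator {t..t + h} s *\<^sub>R norm (g s - q)) \<partial>lborel)"
            by (rule nn_integral_cong) (auto split: split_indicator)
          also have "\<dots> = ennreal (\<integral>s. indicator {t..t + h} s *\<^sub>R norm (g s - q) \<partial>lborel)"
            by (rule nn_integral_eq_integral[OF int]) auto
          also have "(\<integral>s. indicator {t..t + h} s *\<^sub>R norm (g s - q) \<partial>lborel) = I"
            using set_borel_integral_eq_integral(2)[of "{t..t + h}" "\<lambda>s. norm (g s - q)"] int[of t "t + h" q]
            by (simp add: set_integrable_def set_lebesgue_integral_def I_def)
          finally show ?thesis using I by (simp add: ennreal_leI)
        qed
        then show "\<exists>d>0. \<forall>h. 0 < h \<and> h < d \<longrightarrow>
            (\<integral>\<^sup>+s. ennreal (norm (g s - q)) * indicator {t..t + h} s \<partial>lborel) \<le> ennreal ((norm (g t - q) + e) * h)"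
          using d(1) by blast
      qed
    qed
  qed
  have "AE t in lborel. \<forall>q\<in>D. \<forall>e>0. \<exists>d>0. \<forall>h. 0 < h \<and> h < d \<longrightarrow>
      (\<integral>\<^sup>+s. ennreal (norm (g s - q)) * indicator {t..t + h} s \<partial>lborel) \<le> ennreal ((norm (g t - q) + e) * h)"
    using point by (subst AE_ball_countable[OF D(1)]) blast
  then show ?thesis
  proof eventually_elim
    case (elim t)
    show ?case
    proof (intro allI impI)
      fix e :: real assume e: "e > 0"
      \<comment> \<open>Replacing \<open>g t\<close> by the nearby \<open>q\<close> costs
        \<open>e / 3\<close> in the integrand and \<open>e / 3\<close> in the limiting value;
        differentiation at \<open>t\<close> costs the last third.\<close>
      obtain q where q: "q \<in> D" "norm (g t - q) < e / 3"
        using D(2)[of "ball (g t) (e / 3)"] e by (auto simp: dist_norm)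
      obtain d where d: "d > 0" "\<And>h. 0 < h \<Longrightarrow> h < d \<Longrightarrow>
          (\<integral>\<^sup>+s. ennreal (norm (g s - q)) * indicator {t..t + h} s \<partial>lborel) \<le> ennreal ((norm (g t - q) + e / 3) * h)"
        using elim[rule_format, OF q(1), of "e / 3"] e by auto
      have "(\<integral>\<^sup>+s. ennreal (norm (g s - g t)) * indicator {t..t + h} s \<partial>lborel) \<le> ennreal (e * h)"
        if h: "0 < h" "h < d" for h
      proof -
        note [measurable] = borel_measurable_integrable[OF g, simplified]
        have "(\<integral>\<^sup>+s. ennreal (norm (g s - g t)) * indicator {t..t + h} s \<partial>lborel)
            \<le> (\<integral>\<^sup>+s. ennreal (norm (g s - q)) * indicator {t..t + h} s + ennreal (e / 3) * indicator {t..t + h} s \<partial>lborel)"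
        proof (rule nn_integral_mono)
          fix s
          have "norm (g s - g t) \<le> norm (g s - q) + e / 3"
            using q(2) norm_triangle_ineq4[of "g s - q" "g t - q"] by simp
          then have "ennreal (norm (g s - g t)) \<le> ennreal (norm (g s - q)) + ennreal (e / 3)"
            using e by (simp add: ennreal_plus[symmetric] ennreal_leI del: ennreal_plus)
          then show "ennreal (norm (g s - g t)) * indicator {t..t + h} s
              \<le> ennreal (norm (g s - q)) * indicator {t..t + h} s + ennreal (e / 3) * indicator {t..t + h} s"
            by (auto split: split_indicator)
        qed
        also have "\<dots> = (\<integral>\<^sup>+s. ennreal (norm (g s - q)) * indicator {t..t + h} s \<partial>lborel) + ennreal (e / 3) * ennreal h"
          using h by (subst nn_integral_add) (auto simp: nn_integral_cmult_indicator)
        also have "\<dots> \<le> ennreal ((norm (g t - q) + e / 3) * h) + ennreal (e / 3) * ennreal h"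
          using d(2)[OF h] by (rule add_right_mono)
        also have "\<dots> = ennreal ((norm (g t - q) + e / 3) * h + (e / 3) * h)"
          using e h by (simp add: ennreal_mult[symmetric] ennreal_plus[symmetric] del: ennreal_plus)
        also have "\<dots> \<le> ennreal (e * h)"
        proof (rule ennreal_leI)
          have "(norm (g t - q) + e / 3 + e / 3) * h \<le> e * h" using q(2) h by (intro mult_right_mono) auto
          then show "(norm (g t - q) + e / 3) * h + (e / 3) * h \<le> e * h" by (simp add: algebra_simps)
        qed
        finally show ?thesis .
      qed
      then show "\<exists>d>0. \<forall>h. 0 < h \<and> h < d \<longrightarrow>
          (\<integral>\<^sup>+s. ennreal (norm (g s - g t)) * indicator {t..t + h} s \<partial>lborel) \<le> ennreal (e * h)"
        using d(1) by blast
    qed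
  qed
qed

lemma nn_integral_lborel_reflect:
  fixes f :: "real \<Rightarrow> ennreal"
  assumes [measurable]: "f \<in> borel_measurable borel"
  shows "(\<integral>\<^sup>+s. f (- s) \<partial>lborel) = (\<integral>\<^sup>+s. f s \<partial>lborel)"
  using nn_integral_real_affine[of f "-1" 0] by simp

lemma Lebesgue_points:
  fixes g :: "real \<Rightarrow> complex"
  assumes g: "integrable lborel g"
  shows "AE t in lborel. \<forall>e>0. \<exists>d>0. \<forall>h. 0 < h \<and> h < d \<longrightarrow>
    (\<integral>\<^sup>+s. ennreal (norm (g s - g t)) * indicator {t - h..t + h} s \<partial>lborel) \<le> ennreal (e * h)"
proof -
  note [measurable] = borel_measurable_integrable[OF g, simplified]
  have g': "integrable lborel (\<lambda>s. g (- s))"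
    using lborel_integrable_real_affine[OF g, of "-1" 0] by simp
  have "AE t in lborel. \<forall>e>0. \<exists>d>0. \<forall>h. 0 < h \<and> h < d \<longrightarrow>
    (\<integral>\<^sup>+s. ennreal (norm (g (- s) - g (- t))) * indicator {t..t + h} s \<partial>lborel) \<le> ennreal (e * h)"
    (is "AE t in lborel. ?Q t") by (rule right_Lebesgue_points[OF g'])
  then have "AE t in distr lborel borel uminus. ?Q t"
    by (simp only: lborel_distr_uminus)
  then have left: "AE t in lborel. ?Q (- t)"
    by (rule AE_distrD[rotated]) simp
  show ?thesis
    using left right_Lebesgue_points[OF g]
  proof eventually_elim
    case (elim t)
    show ?case
    proof (intro allI impI)
      fix e :: real assume e: "e > 0"
      obtain d1 where d1: "d1 > 0" "\<And>h. 0 < h \<Longrightarrow> h < d1 \<Longrightarrow>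
          (\<integral>\<^sup>+s. ennreal (norm (g (- s) - g (- (- t)))) * indicator {- t..- t + h} s \<partial>lborel) \<le> ennreal (e / 2 * h)"
        using elim(1)[rule_format, of "e / 2"] e by auto
      obtain d2 where d2: "d2 > 0" "\<And>h. 0 < h \<Longrightarrow> h < d2 \<Longrightarrow>
          (\<integral>\<^sup>+s. ennreal (norm (g s - g t)) * indicator {t..t + h} s \<partial>lborel) \<le> ennreal (e / 2 * h)"
        using elim(2)[rule_format, of "e / 2"] e by auto
      have "(\<integral>\<^sup>+s. ennreal (norm (g s - g t)) * indicator {t - h..t + h} s \<partial>lborel) \<le> ennreal (e * h)"
        if h: "0 < h" "h < min d1 d2" for h
      proof -
        have "(\<integral>\<^sup>+s. ennreal (norm (g s - g t)) * indicator {t - h..t + h} s \<partial>lborel)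
            \<le> (\<integral>\<^sup>+s. ennreal (norm (g s - g t)) * indicator {t - h..t} s + ennreal (norm (g s - g t)) * indicator {t..t + h} s \<partial>lborel)"
          by (rule nn_integral_mono) (auto split: split_indicator)
        also have "\<dots> = (\<integral>\<^sup>+s. ennreal (norm (g s - g t)) * indicator {t - h..t} s \<partial>lborel)
            + (\<integral>\<^sup>+s. ennreal (norm (g s - g t)) * indicator {t..t + h} s \<partial>lborel)"
          by (rule nn_integral_add) auto
        also have "(\<integral>\<^sup>+s. ennreal (norm (g s - g t)) * indicator {t - h..t} s \<partial>lborel)
            = (\<integral>\<^sup>+s. ennreal (norm (g (- s) - g t)) * indicator {t - h..t} (- s) \<partial>lborel)"
          by (rule nn_integral_lborel_reflect[symmetric]) simp
        also have "\<dots> = (\<integral>\<^sup>+s. ennreal (norm (g (- s) - g (- (- t)))) * indicator {- t..- t + h} s \<partial>lborel)"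
          by (rule nn_integral_cong) (auto split: split_indicator)
        also have "\<dots> + (\<integral>\<^sup>+s. ennreal (norm (g s - g t)) * indicator {t..t + h} s \<partial>lborel)
            \<le> ennreal (e / 2 * h) + ennreal (e / 2 * h)"
          using h by (intro add_mono d1(2) d2(2)) auto
        also have "\<dots> = ennreal (e * h)"
          using e h by (simp add: ennreal_plus[symmetric] del: ennreal_plus)
        finally show ?thesis .
      qed
      then show "\<exists>d>0. \<forall>h. 0 < h \<and> h < d \<longrightarrow>
          (\<integral>\<^sup>+s. ennreal (norm (g s - g t)) * indicator {t - h..t + h} s \<partial>lborel) \<le> ennreal (e * h)"
        using d1(1) d2(1) by (intro exI[of _ "min d1 d2"]) auto
    qed
  qed
qed

text \<open>Formulated with chords \<open>dist v \<zeta>\<close>, the quantity in which the Poisson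
  kernel is estimated below, and deduced from Lebesgue points of the pullback under
  \<open>cis\<close>.\<close>

lemma Lebesgue_points_circle:
  fixes f :: "complex \<Rightarrow> complex"
  assumes f: "integrable circle_measure f"
  shows "AE \<zeta> in circle_measure. \<forall>e>0. \<exists>d>0. \<forall>h. 0 < h \<and> h < d \<longrightarrow>
    (\<integral>\<^sup>+v. ennreal (norm (f v - f \<zeta>)) * indicator {v. dist v \<zeta> \<le> h} v \<partial>circle_measure) \<le> ennreal (e * h)"
proof (rule AE_circle_measureI)
  let ?m = circle_measure
  have f_meas: "f \<in> borel_measurable circle_borel"
    using borel_measurable_integrable[OF f] by (simp add: measurable_cong_sets[OF sets_circle_measure refl])
  note [measurable] = this
  define g where "g t = indicator {0..<2 * pi} t *\<^sub>R f (cis t)" for t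
  have "integrable lborel (\<lambda>t. (indicator {0..<2 * pi} t / (2 * pi)) *\<^sub>R f (cis t))"
  proof -
    have "integrable (density lborel (\<lambda>t. ennreal (indicator {0..<2 * pi} t / (2 * pi)))) (\<lambda>t. f (cis t))"
      by (rule integrable_distr[OF _ f[unfolded circle_measure_density]]) simp
    then show ?thesis by (subst (asm) integrable_density) auto
  qed
  then have "integrable lborel (\<lambda>t. (2 * pi) *\<^sub>R ((indicator {0..<2 * pi} t / (2 * pi)) *\<^sub>R f (cis t)))"
    by (rule integrable_scaleR_right)
  then have g: "integrable lborel g" by (simp add: g_def[abs_def])
  \<comment> \<open>The circle is cut open at the parameter 0, where chords do not control the
    parameter; this single point is discarded.\<close>
  have "AE t in lborel. t \<noteq> (0::real)" by (rule AE_lborel_singleton)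
  with Lebesgue_points[OF g]
  show "AE t in lborel. t \<in> {0..<2 * pi} \<longrightarrow> (\<forall>e>0. \<exists>d>0. \<forall>h. 0 < h \<and> h < d \<longrightarrow>
    (\<integral>\<^sup>+v. ennreal (norm (f v - f (cis t))) * indicator {v. dist v (cis t) \<le> h} v \<partial>?m) \<le> ennreal (e * h))"
  proof eventually_elim
    case (elim t)
    show ?case
    proof (intro allI impI)
      fix e :: real assume e: "e > 0" and "t \<in> {0..<2 * pi}"
      then have t: "0 < t" "t < 2 * pi" using elim(2) by auto
      obtain d1 where d1: "d1 > 0" "\<And>h. 0 < h \<Longrightarrow> h < d1 \<Longrightarrow>
          (\<integral>\<^sup>+s. ennreal (norm (g s - g t)) * indicator {t - h..t + h} s \<partial>lborel) \<le> ennreal (e / 2 * h)"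
        using elim(1)[rule_format, of "e / 2"] e by auto
      obtain d2 where d2: "d2 > 0" "\<And>s. 0 \<le> s \<Longrightarrow> s < 2 * pi \<Longrightarrow> norm (cis s - cis t) < d2 \<Longrightarrow>
          \<bar>s - t\<bar> \<le> 2 * norm (cis s - cis t)"
        using cis_local_inverse[OF t] by metis
      have "(\<integral>\<^sup>+v. ennreal (norm (f v - f (cis t))) * indicator {v. dist v (cis t) \<le> h} v \<partial>?m) \<le> ennreal (e * h)"
        if h: "0 < h" "h < min (d1 / 2) d2" for h
      proof -
        have [measurable]: "{v. dist v (cis t) \<le> h} \<in> sets borel"
          using closed_cball[of "cis t" h] by (simp add: cball_def dist_commute)
        have [measurable]: "indicator {v. dist v (cis t) \<le> h} \<in> borel_measurable circle_borel"
          by (rule measurable_restrict_space1) simp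
        have "(\<integral>\<^sup>+v. ennreal (norm (f v - f (cis t))) * indicator {v. dist v (cis t) \<le> h} v \<partial>?m)
            = (\<integral>\<^sup>+s. ennreal (indicator {0..<2 * pi} s / (2 * pi)) *
                (ennreal (norm (f (cis s) - f (cis t))) * indicator {v. dist v (cis t) \<le> h} (cis s)) \<partial>lborel)"
          by (rule nn_integral_circle_measure) measurable
        also have "\<dots> \<le> (\<integral>\<^sup>+s. ennreal (norm (g s - g t)) * indicator {t - 2 * h..t + 2 * h} s \<partial>lborel)"
        proof (rule nn_integral_mono)
          fix s
          show "ennreal (indicator {0..<2 * pi} s / (2 * pi)) *
                (ennreal (norm (f (cis s) - f (cis t))) * indicator {v. dist v (cis t) \<le> h} (cis s))
              \<le> ennreal (norm (g s - g t)) * indicator {t - 2 * h..t + 2 * h} s"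
          proof (cases "s \<in> {0..<2 * pi} \<and> dist (cis s) (cis t) \<le> h")
            case True
            then have "norm (cis s - cis t) < d2" using h by (simp add: dist_norm)
            then have "\<bar>s - t\<bar> \<le> 2 * norm (cis s - cis t)" using True by (intro d2(2)) auto
            also have "\<dots> \<le> 2 * h" using True by (simp add: dist_norm)
            finally have s: "s \<in> {t - 2 * h..t + 2 * h}" by auto
            have gs: "g s - g t = f (cis s) - f (cis t)" using True t by (simp add: g_def)
            have "1 / (2 * pi) \<le> 1" using pi_gt3 by simp
            then have "ennreal (1 / (2 * pi)) \<le> 1" by (metis ennreal_1 ennreal_leI)
            from mult_right_mono[OF this, of "ennreal (norm (g s - g t))"] s True gs
            show ?thesis by simp
          qed (auto split: split_indicator)
        qed
        \<comment> \<open>The arc may be twice as long as the chord, hence \<open>e / 2\<close> in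
          the choice of \<open>d1\<close> and \<open>d1 / 2\<close> in the range of
          \<open>h\<close>.\<close>
        also have "\<dots> \<le> ennreal (e / 2 * (2 * h))" using h by (intro d1(2)) auto
        finally show ?thesis by simp
      qed
      then show "\<exists>d>0. \<forall>h. 0 < h \<and> h < d \<longrightarrow>
          (\<integral>\<^sup>+v. ennreal (norm (f v - f (cis t))) * indicator {v. dist v (cis t) \<le> h} v \<partial>?m) \<le> ennreal (e * h)"
        using d1(1) d2(1) by (intro exI[of _ "min (d1 / 2) d2"]) auto
    qed
  qed
qed

section \<open>Nontangential convergence of Poisson integrals\<close>

lemma nn_integral_layer:
  assumes "0 < a" "0 \<le> c"
  shows "(\<integral>\<^sup>+h. ennreal (2 * c / h ^ 3) * indicator {a..} h \<partial>lborel) = ennreal (c / a\<^sup>2)"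
proof -
  have "(\<integral>\<^sup>+h. ennreal (2 * c / h ^ 3) * indicator {a..} h \<partial>lborel) = ennreal (0 - (- c / a\<^sup>2))"
  proof (rule nn_integral_FTC_atLeast)
    fix x assume "a \<le> x"
    then have "x > 0" using assms by simp
    then show "DERIV (\<lambda>h. - c / h\<^sup>2) x :> 2 * c / x ^ 3"
      by (auto intro!: derivative_eq_intros simp: power2_eq_square power3_eq_cube field_simps)
    show "0 \<le> 2 * c / x ^ 3" using \<open>x > 0\<close> assms by simp
  next
    show "((\<lambda>h. - c / h\<^sup>2) \<longlongrightarrow> 0) at_top" by real_asymp
  qed measurable
  then show ?thesis by simp
qed

lemma nn_integral_inverse_square:
  assumes "0 < a" "0 \<le> c"
  shows "(\<integral>\<^sup>+h. ennreal (c / h\<^sup>2) * indicator {a..} h \<partial>lborel) = ennreal (c / a)"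
proof -
  have "(\<integral>\<^sup>+h. ennreal (c / h\<^sup>2) * indicator {a..} h \<partial>lborel) = ennreal (0 - (- c / a))"
  proof (rule nn_integral_FTC_atLeast)
    fix x assume "a \<le> x"
    then have "x > 0" using assms by simp
    then show "DERIV (\<lambda>h. - c / h) x :> c / x\<^sup>2"
      by (auto intro!: derivative_eq_intros simp: power2_eq_square field_simps)
    show "0 \<le> c / x\<^sup>2" using assms by simp
  next
    show "((\<lambda>h. - c / h) \<longlongrightarrow> 0) at_top" by real_asymp
  qed measurable
  then show ?thesis by simp
qed

text \<open>The kernel \<open>y / (max y r)\<^sup>2\<close>, a majorant of the Poisson kernel in a Stolz region, is the
  superposition of the normalized indicators of \<open>r \<le> h\<close> with weights \<open>2 y / h\<^sup>3\<close> for \<open>h \<ge> y\<close>.\<close>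

lemma kernel_estimate:
  fixes G :: "complex \<Rightarrow> real"
  assumes [measurable]: "G \<in> borel_measurable circle_measure" and G: "\<And>v. G v \<ge> 0"
    and d: "0 < d" and e: "0 \<le> e" and I: "0 \<le> I" and y: "0 < y"
    and small: "\<And>h. 0 < h \<Longrightarrow> h < d \<Longrightarrow>
      (\<integral>\<^sup>+v. ennreal (G v) * indicator {v. dist v \<zeta> \<le> h} v \<partial>circle_measure) \<le> ennreal (e * h)"
    and total: "(\<integral>\<^sup>+v. ennreal (G v) \<partial>circle_measure) \<le> ennreal I"
  shows "(\<integral>\<^sup>+v. ennreal (G v * (y / (max y (dist v \<zeta>))\<^sup>2)) \<partial>circle_measure) \<le> ennreal (2 * e + I * y / d\<^sup>2)"
proof -
  let ?m = circle_measure
  interpret pair_sigma_finite ?m lborel ..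
  have dist_meas [measurable]: "(\<lambda>v. dist v \<zeta>) \<in> borel_measurable ?m" by measurable
  let ?k = "\<lambda>h. ennreal (2 * y / h ^ 3) * indicator {y..} h"
  have "(\<integral>\<^sup>+v. ennreal (G v * (y / (max y (dist v \<zeta>))\<^sup>2)) \<partial>?m)
      = (\<integral>\<^sup>+v. (\<integral>\<^sup>+h. ?k h * (ennreal (G v) * (if dist v \<zeta> \<le> h then 1 else 0)) \<partial>lborel) \<partial>?m)"
  proof (rule nn_integral_cong)
    fix v
    let ?a = "max y (dist v \<zeta>)"
    have "(\<integral>\<^sup>+h. ?k h * (ennreal (G v) * (if dist v \<zeta> \<le> h then 1 else 0)) \<partial>lborel)
        = (\<integral>\<^sup>+h. ennreal (G v) * (ennreal (2 * y / h ^ 3) * indicator {?a..} h) \<partial>lborel)"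
      by (rule nn_integral_cong) (auto split: split_indicator simp: mult.commute)
    also have "\<dots> = ennreal (G v) * ennreal (y / ?a\<^sup>2)"
      using y by (subst nn_integral_cmult) (auto simp: nn_integral_layer)
    also have "\<dots> = ennreal (G v * (y / ?a\<^sup>2))"
      by (rule ennreal_mult[symmetric]) (use G[of v] y in auto)
    finally show "ennreal (G v * (y / ?a\<^sup>2)) = (\<integral>\<^sup>+h. ?k h * (ennreal (G v) * (if dist v \<zeta> \<le> h then 1 else 0)) \<partial>lborel)"
      by (rule sym)
  qed
  also have "\<dots> = (\<integral>\<^sup>+h. (\<integral>\<^sup>+v. ?k h * (ennreal (G v) * (if dist v \<zeta> \<le> h then 1 else 0)) \<partial>?m) \<partial>lborel)"
  proof -
    define H where "H v h = ?k h * (ennreal (G v) * (if dist v \<zeta> \<le> h then 1 else 0))" for v h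
    let ?N = "?m \<Otimes>\<^sub>M (lborel :: real measure)"
    have fst_meas: "(\<lambda>x. dist (fst x) \<zeta>) \<in> borel_measurable ?N" "(\<lambda>x. ennreal (G (fst x))) \<in> borel_measurable ?N"
      using measurable_compose[OF measurable_fst dist_meas]
        measurable_compose[OF measurable_compose[OF measurable_fst assms(1)] measurable_ennreal] by auto
    have snd_meas: "snd \<in> borel_measurable ?N"
      using measurable_snd[of ?m "lborel :: real measure"] by simp
    have "(\<lambda>h. ?k h) \<in> borel_measurable borel" by measurable
    from measurable_compose[OF snd_meas this]
    have A: "(\<lambda>x. ?k (snd x)) \<in> borel_measurable ?N" .
    have B: "(\<lambda>x. if dist (fst x) \<zeta> \<le> snd x then 1 else 0 :: ennreal) \<in> borel_measurable ?N"
      by (intro measurable_If borel_measurable_le fst_meas snd_meas) simp_all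
    have "(\<lambda>x. ?k (snd x) * (ennreal (G (fst x)) * (if dist (fst x) \<zeta> \<le> snd x then 1 else 0))) \<in> borel_measurable ?N"
      by (rule borel_measurable_times_ennreal[OF A borel_measurable_times_ennreal[OF fst_meas(2) B]])
    then have "case_prod H \<in> borel_measurable (?m \<Otimes>\<^sub>M lborel)"
      unfolding H_def[abs_def] case_prod_unfold .
    from Fubini'[OF this, symmetric] show ?thesis unfolding H_def .
  qed
  \<comment> \<open>For \<open>y \<le> h < d\<close> the local bound \<open>e * h\<close> turns the
    weight \<open>2 * y / h ^ 3\<close> into \<open>2 * y * e / h ^ 2\<close>, which integrates to
    at most \<open>2 * e\<close>. For \<open>h \<ge> d\<close> the total mass \<open>I\<close> is
    used and gives \<open>I * y / d ^ 2\<close>.\<close>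
  also have "\<dots> \<le> (\<integral>\<^sup>+h. ennreal (2 * y * e / h\<^sup>2) * indicator {y..} h
      + ennreal (2 * (y * I) / h ^ 3) * indicator {d..} h \<partial>lborel)"
  proof (rule nn_integral_mono)
    fix h :: real
    let ?G = "\<integral>\<^sup>+v. ennreal (G v) * (if dist v \<zeta> \<le> h then 1 else 0) \<partial>?m"
    have eq: "(\<integral>\<^sup>+v. ?k h * (ennreal (G v) * (if dist v \<zeta> \<le> h then 1 else 0)) \<partial>?m) = ?k h * ?G"
      by (rule nn_integral_cmult) measurable
    show "(\<integral>\<^sup>+v. ?k h * (ennreal (G v) * (if dist v \<zeta> \<le> h then 1 else 0)) \<partial>?m)
        \<le> ennreal (2 * y * e / h\<^sup>2) * indicator {y..} h + ennreal (2 * (y * I) / h ^ 3) * indicator {d..} h"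
    proof (cases "y \<le> h")
      case True
      then have h: "h > 0" using y by simp
      show ?thesis
      proof (cases "h < d")
        case small_h: True
        have "?G = (\<integral>\<^sup>+v. ennreal (G v) * indicator {v. dist v \<zeta> \<le> h} v \<partial>?m)"
          by (rule nn_integral_cong) (auto split: split_indicator)
        also have "\<dots> \<le> ennreal (e * h)" by (rule small[OF h small_h])
        finally have "?k h * ?G \<le> ennreal (2 * y / h ^ 3) * ennreal (e * h)"
          using True by (auto intro: mult_left_mono)
        also have "\<dots> = ennreal (2 * y * e / h\<^sup>2)"
          using h e y by (simp add: ennreal_mult[symmetric] power2_eq_square power3_eq_cube field_simps)
        finally show ?thesis unfolding eq using True by (simp add: add_increasing2)
      next
        case False
        have "?G \<le> (\<integral>\<^sup>+v. ennreal (G v) \<partial>?m)"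
          by (rule nn_integral_mono) auto
        also note total
        finally have "?k h * ?G \<le> ennreal (2 * y / h ^ 3) * ennreal I"
          using True by (auto intro: mult_left_mono)
        also have "\<dots> = ennreal (2 * (y * I) / h ^ 3)"
          using h I y by (simp add: ennreal_mult[symmetric] field_simps)
        finally show ?thesis unfolding eq using False by (simp add: add_increasing)
      qed
    qed (simp add: eq)
  qed
  also have "\<dots> = (\<integral>\<^sup>+h. ennreal (2 * y * e / h\<^sup>2) * indicator {y..} h \<partial>lborel)
      + (\<integral>\<^sup>+h. ennreal (2 * (y * I) / h ^ 3) * indicator {d..} h \<partial>lborel)"
    by (rule nn_integral_add) measurable
  also have "\<dots> = ennreal (2 * y * e / y) + ennreal (y * I / d\<^sup>2)"
    using y e d I by (simp add: nn_integral_inverse_square nn_integral_layer)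
  also have "\<dots> = ennreal (2 * e + I * y / d\<^sup>2)"
    using y e d I by (simp add: ennreal_plus[symmetric] mult.commute del: ennreal_plus)
  finally show ?thesis .
qed

text \<open>In the Stolz region \<open>dist w \<zeta> < \<alpha> * (1 - norm w) \<le> \<alpha> *
  norm (v - w)\<close>. So \<open>norm (v - w)\<close> dominates both \<open>1 - norm w\<close> and
  \<open>dist v \<zeta>\<close> up to the factor \<open>1 + \<alpha>\<close>; the 2 comes from
  \<open>1 - norm w ^ 2 \<le> 2 * (1 - norm w)\<close>.\<close>

lemma poisson_stolz_bound:
  assumes w: "w \<in> stolz_region \<alpha> \<zeta>" and v: "norm v = 1" and \<alpha>: "\<alpha> > 1"
  shows "poisson w v \<le> 2 * (1 + \<alpha>)\<^sup>2 * ((1 - norm w) / (max (1 - norm w) (dist v \<zeta>))\<^sup>2)"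
proof -
  let ?y = "1 - norm w"
  have y: "?y > 0" "dist w \<zeta> < \<alpha> * ?y" using w by (auto simp: stolz_region_def)
  have 1: "?y \<le> norm (v - w)" using norm_triangle_ineq2[of v w] v by simp
  have "dist v \<zeta> \<le> dist v w + dist w \<zeta>" by (rule dist_triangle)
  also have "\<dots> \<le> norm (v - w) + \<alpha> * norm (v - w)"
    using y 1 \<alpha> by (intro add_mono order_trans[OF less_imp_le[OF y(2)]] mult_left_mono) (auto simp: dist_norm)
  finally have "dist v \<zeta> \<le> (1 + \<alpha>) * norm (v - w)" by (simp add: algebra_simps)
  moreover have "?y \<le> (1 + \<alpha>) * norm (v - w)"
    using 1 y mult_right_mono[of 1 "1 + \<alpha>" "norm (v - w)"] \<alpha> by simp
  ultimately have M: "max ?y (dist v \<zeta>) \<le> (1 + \<alpha>) * norm (v - w)" by simp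
  then have M2: "(max ?y (dist v \<zeta>))\<^sup>2 \<le> (1 + \<alpha>)\<^sup>2 * (norm (v - w))\<^sup>2"
    using y power_mono[OF M, of 2] by (simp add: power_mult_distrib)
  have pos: "(max ?y (dist v \<zeta>))\<^sup>2 > 0" "(norm (v - w))\<^sup>2 > 0" using y 1 by auto
  have "1 - (norm w)\<^sup>2 = ?y * (1 + norm w)" by (simp add: power2_eq_square algebra_simps)
  also have "\<dots> \<le> ?y * 2" using y by (intro mult_left_mono) auto
  finally have "poisson w v \<le> 2 * ?y / (norm (v - w))\<^sup>2"
    unfolding poisson_def by (intro divide_right_mono) auto
  also have "\<dots> \<le> 2 * ?y * ((1 + \<alpha>)\<^sup>2 / (max ?y (dist v \<zeta>))\<^sup>2)"
  proof -
    have "1 / (norm (v - w))\<^sup>2 \<le> (1 + \<alpha>)\<^sup>2 / (max ?y (dist v \<zeta>))\<^sup>2"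
      using M2 pos by (simp add: divide_simps mult.commute)
    from mult_left_mono[OF this, of "2 * ?y"] show ?thesis using y by simp
  qed
  also have "2 * p * (q / r) = 2 * q * (p / r)" for p q r :: real by simp
  finally show ?thesis .
qed

lemma poisson_integral_nontangential:
  assumes f: "integrable circle_measure f" and \<alpha>: "\<alpha> > 1" and e0: "e0 > 0"
    and point: "\<forall>e>0. \<exists>d>0. \<forall>h. 0 < h \<and> h < d \<longrightarrow>
      (\<integral>\<^sup>+v. ennreal (norm (f v - f \<zeta>)) * indicator {v. dist v \<zeta> \<le> h} v \<partial>circle_measure) \<le> ennreal (e * h)"
  obtains \<delta> where "\<delta> > 0" "\<And>w. w \<in> stolz_region \<alpha> \<zeta> \<Longrightarrow> 1 - norm w < \<delta> \<Longrightarrow>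
    norm ((\<integral>v. f v * complex_of_real (poisson w v) \<partial>circle_measure) - f \<zeta>) < e0"
proof -
  let ?m = circle_measure
  note [measurable] = borel_measurable_integrable[OF f]
  define K where "K = 2 * (1 + \<alpha>)\<^sup>2"
  have K: "K > 0" using \<alpha> by (simp add: K_def)
  \<comment> \<open>With this \<open>e\<close> the local part \<open>K * (2 * e)\<close> is
    \<open>e0 / 2\<close>. The \<open>\<delta>\<close> below keeps the rest at most
    \<open>e0 / 4\<close>, with \<open>I + 1\<close> in place of \<open>I\<close> to allow for
    \<open>I = 0\<close>.\<close>
  define e where "e = e0 / (4 * K)"
  have e: "e > 0" using e0 K by (simp add: e_def)
  obtain d where d: "d > 0" "\<And>h. 0 < h \<Longrightarrow> h < d \<Longrightarrow>
      (\<integral>\<^sup>+v. ennreal (norm (f v - f \<zeta>)) * indicator {v. dist v \<zeta> \<le> h} v \<partial>?m) \<le> ennreal (e * h)"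
    using point e by blast
  define I where "I = (\<integral>v. norm (f v - f \<zeta>) \<partial>?m)"
  have fi: "integrable ?m (\<lambda>v. norm (f v - f \<zeta>))" using f by simp
  have I: "I \<ge> 0" "(\<integral>\<^sup>+v. ennreal (norm (f v - f \<zeta>)) \<partial>?m) \<le> ennreal I"
    using nn_integral_eq_integral[OF fi] by (auto simp: I_def)
  define \<delta> where "\<delta> = e0 * d\<^sup>2 / (4 * K * (I + 1))"
  have \<delta>: "\<delta> > 0" using e0 d K I by (simp add: \<delta>_def)
  have "norm ((\<integral>v. f v * complex_of_real (poisson w v) \<partial>?m) - f \<zeta>) < e0"
    if w: "w \<in> stolz_region \<alpha> \<zeta>" and small: "1 - norm w < \<delta>" for w
  proof -
    let ?y = "1 - norm w"
    have nw: "norm w < 1" using w by (simp add: stolz_region_def)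
    have bd: "norm (complex_of_real (poisson w v)) \<le> 1 / ?y\<^sup>2" if "norm v = 1" for v
      using poisson_bound[OF nw that] poisson_nonneg[OF nw, of v] by simp
    have i1: "integrable ?m (\<lambda>v. f v * complex_of_real (poisson w v))"
      by (rule integrable_mult_bounded[OF f, where C = "1 / ?y\<^sup>2"]) (use bd in \<open>auto simp del: norm_of_real\<close>)
    have "f \<zeta> = (\<integral>v. f \<zeta> * complex_of_real (poisson w v) \<partial>?m)"
      using integral_poisson[OF nw] by simp
    then have "(\<integral>v. f v * complex_of_real (poisson w v) \<partial>?m) - f \<zeta>
        = (\<integral>v. f v * complex_of_real (poisson w v) \<partial>?m) - (\<integral>v. f \<zeta> * complex_of_real (poisson w v) \<partial>?m)"
      by simp
    also have "\<dots> = (\<integral>v. (f v - f \<zeta>) * complex_of_real (poisson w v) \<partial>?m)"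
      using i1 poisson_integrable[OF nw] by (simp add: left_diff_distrib)
    also have "norm \<dots> \<le> (\<integral>v. norm ((f v - f \<zeta>) * complex_of_real (poisson w v)) \<partial>?m)"
      by (rule integral_norm_bound)
    also have "\<dots> \<le> K * (2 * e + I * ?y / d\<^sup>2)"
    proof (rule integral_real_bounded)
      show "0 \<le> K * (2 * e + I * ?y / d\<^sup>2)" using K e I nw by simp
      have "(\<integral>\<^sup>+v. ennreal (norm ((f v - f \<zeta>) * complex_of_real (poisson w v))) \<partial>?m)
          \<le> (\<integral>\<^sup>+v. ennreal K * ennreal (norm (f v - f \<zeta>) * (?y / (max ?y (dist v \<zeta>))\<^sup>2)) \<partial>?m)"
      proof (rule nn_integral_mono)
        fix v assume "v \<in> space ?m"
        then have "norm v = 1" by simp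
        then have "norm (f v - f \<zeta>) * poisson w v \<le> norm (f v - f \<zeta>) * (K * (?y / (max ?y (dist v \<zeta>))\<^sup>2))"
          unfolding K_def by (intro mult_left_mono poisson_stolz_bound w \<alpha>) auto
        then have "norm ((f v - f \<zeta>) * complex_of_real (poisson w v))
            \<le> K * (norm (f v - f \<zeta>) * (?y / (max ?y (dist v \<zeta>))\<^sup>2))"
          using poisson_nonneg[OF nw, of v] by (simp add: norm_mult mult_ac)
        then show "ennreal (norm ((f v - f \<zeta>) * complex_of_real (poisson w v)))
            \<le> ennreal K * ennreal (norm (f v - f \<zeta>) * (?y / (max ?y (dist v \<zeta>))\<^sup>2))"
          using K nw by (subst ennreal_mult[symmetric]) (auto intro: ennreal_leI)
      qed
      also have "\<dots> = ennreal K * (\<integral>\<^sup>+v. ennreal (norm (f v - f \<zeta>) * (?y / (max ?y (dist v \<zeta>))\<^sup>2)) \<partial>?m)"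
        by (rule nn_integral_cmult) measurable
      also have "\<dots> \<le> ennreal K * ennreal (2 * e + I * ?y / d\<^sup>2)"
        using d e I nw by (intro mult_left_mono kernel_estimate) auto
      also have "\<dots> = ennreal (K * (2 * e + I * ?y / d\<^sup>2))"
        using K e I nw by (intro ennreal_mult[symmetric]) auto
      finally show "(\<integral>\<^sup>+v. ennreal (norm ((f v - f \<zeta>) * complex_of_real (poisson w v))) \<partial>?m)
          \<le> ennreal (K * (2 * e + I * ?y / d\<^sup>2))" .
    qed
    also have "\<dots> < e0"
    proof -
      have "K * (2 * e) = e0 / 2" using K by (simp add: e_def)
      moreover have "K * (I * ?y / d\<^sup>2) \<le> K * (I * \<delta> / d\<^sup>2)"
        using K I small by (intro mult_left_mono divide_right_mono) auto
      moreover have "K * (I * \<delta> / d\<^sup>2) = e0 / 4 * (I / (I + 1))"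
        using K d I by (simp add: \<delta>_def)
      moreover have "e0 / 4 * (I / (I + 1)) \<le> e0 / 4 * 1"
        using e0 I by (intro mult_left_mono) auto
      ultimately have "K * (2 * e) + K * (I * ?y / d\<^sup>2) < e0" using e0 by linarith
      then show ?thesis by (simp only: distrib_left)
    qed
    finally show ?thesis .
  qed
  with \<delta> show ?thesis by (rule that)
qed

text \<open>The converse of \<open>Hardy_imp_H2b\<close>. \<open>F\<close> is the Cauchy transform
  inside and \<open>f\<close> itself on the circle, so that the equality there is pointwise and
  passes into integrals without exceptional sets.\<close>

theorem Fatou_H2b:
  assumes f: "f \<in> H2b"
  obtains F where "F \<in> Hardy 2" "\<And>z. norm z = 1 \<Longrightarrow> F z = f z"
proof -
  let ?m = circle_measure
  note [measurable] = L2_measurable[OF H2b_L2[OF f]]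
  have fi: "integrable ?m f" by (intro L2_circle_integrable H2b_L2 f)
  define F where "F w = (if norm w < 1 then cauchy_transform f w else f w)" for w
  have "F holomorphic_on disc"
    by (rule holomorphic_transform[OF cauchy_transform_holomorphic[OF f]]) (simp add: F_def)
  moreover have "(\<integral>z. norm (F (of_real r * z)) powr 2 \<partial>?m) \<le> L2_sq ?m f" if r: "0 \<le> r" "r < 1" for r
  proof -
    have "(\<integral>z. norm (F (of_real r * z)) powr 2 \<partial>?m) = (\<integral>z. (norm (cauchy_transform f (of_real r * z)))\<^sup>2 \<partial>?m)"
      by (rule Bochner_Integration.integral_cong) (use r in \<open>auto simp: F_def norm_mult\<close>)
    then show ?thesis using cauchy_transform_dilation_bound[OF f r] by simp
  qed
  moreover have "F \<in> borel_measurable ?m"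
    by (rule measurable_cong[THEN iffD2, of _ _ f]) (auto simp: F_def)
  moreover have "AE \<zeta> in ?m. has_nontangential_limit F (F \<zeta>) \<zeta>"
    using Lebesgue_points_circle[OF fi] AE_space
  proof eventually_elim
    case (elim \<zeta>)
    have \<zeta>: "F \<zeta> = f \<zeta>" using elim(2) by (simp add: F_def)
    show ?case unfolding has_nontangential_limit_def
    proof (intro allI impI tendstoI)
      fix \<alpha> e0 :: real assume "\<alpha> > 1" "e0 > 0"
      from poisson_integral_nontangential[OF fi this elim(1)] obtain \<delta> where \<delta>: "\<delta> > 0"
        "\<And>w. w \<in> stolz_region \<alpha> \<zeta> \<Longrightarrow> 1 - norm w < \<delta> \<Longrightarrow>
          norm ((\<integral>v. f v * complex_of_real (poisson w v) \<partial>?m) - f \<zeta>) < e0" by metis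
      have "dist (F w) (F \<zeta>) < e0" if w: "w \<in> stolz_region \<alpha> \<zeta>" "dist w \<zeta> < \<delta>" for w
      proof -
        have nw: "norm w < 1" using w by (simp add: stolz_region_def)
        have "1 - norm w \<le> norm (\<zeta> - w)" using norm_triangle_ineq2[of \<zeta> w] elim(2) by simp
        then have "1 - norm w < \<delta>" using w(2) by (simp add: dist_norm norm_minus_commute)
        moreover have "F w = (\<integral>v. f v * complex_of_real (poisson w v) \<partial>?m)"
          using nw by (simp add: F_def cauchy_transform_poisson[OF f nw])
        ultimately show ?thesis
          using \<delta>(2)[OF w(1)] by (simp only: \<zeta> dist_norm)
      qed
      then show "\<forall>\<^sub>F w in at \<zeta> within stolz_region \<alpha> \<zeta>. dist (F w) (F \<zeta>) < e0"
        using \<delta>(1) by (auto simp: eventually_at)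
    qed
  qed
  ultimately have "F \<in> Hardy 2" by (auto simp: Hardy_def has_own_boundary_values_def)
  then show ?thesis by (rule that) (simp add: F_def)
qed

section \<open>The Hahn-Banach theorem\<close>

text \<open>Homogeneity is only an inequality, which is what infima deliver directly; applied to
  \<open>c\<close> and to \<open>1 / c\<close> it gives the equality in
  \<open>sublinear_scaleR\<close>.\<close>

definition sublinear :: "('a::real_vector \<Rightarrow> real) \<Rightarrow> bool" where
  "sublinear p \<longleftrightarrow> (\<forall>x y. p (x + y) \<le> p x + p y) \<and> (\<forall>c>0. \<forall>x. p (c *\<^sub>R x) \<le> c * p x)"

lemma sublinear_add: "sublinear p \<Longrightarrow> p (x + y) \<le> p x + p y"
  by (simp add: sublinear_def)

lemma sublinear_scaleR_le: "sublinear p \<Longrightarrow> c > 0 \<Longrightarrow> p (c *\<^sub>R x) \<le> c * p x"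
  by (simp add: sublinear_def)

lemma sublinear_zero:
  fixes p :: "'a::real_vector \<Rightarrow> real"
  assumes "sublinear p" shows "p 0 = 0"
  using sublinear_scaleR_le[OF assms, of 2 0] sublinear_scaleR_le[OF assms, of "1/2" 0] by simp

lemma sublinear_scaleR:
  fixes p :: "'a::real_vector \<Rightarrow> real"
  assumes p: "sublinear p" and c: "c \<ge> 0" shows "p (c *\<^sub>R x) = c * p x"
proof (cases "c = 0")
  case False
  then have "c > 0" using c by simp
  have "p ((1 / c) *\<^sub>R (c *\<^sub>R x)) \<le> (1 / c) * p (c *\<^sub>R x)"
    using \<open>c > 0\<close> by (intro sublinear_scaleR_le[OF p]) simp
  then have "c * p x \<le> p (c *\<^sub>R x)" using \<open>c > 0\<close> by (simp add: field_simps)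
  then show ?thesis using sublinear_scaleR_le[OF p \<open>c > 0\<close>, of x] by simp
qed (simp add: sublinear_zero[OF p])

lemma sublinear_ge_minus:
  fixes p :: "'a::real_vector \<Rightarrow> real"
  assumes p: "sublinear p" shows "- p (- x) \<le> p x"
  using sublinear_add[OF p, of x "- x"] sublinear_zero[OF p] by simp

text \<open>Supplies the bounds for Zorn's lemma. The infimum is finite because
  \<open>q x \<ge> - q (- x) \<ge> - p (- x)\<close>, and subadditive because, of two members of a
  chain, the smaller one may be used for both arguments.\<close>

lemma sublinear_Inf_chain:
  fixes p :: "'a::real_vector \<Rightarrow> real"
  assumes C: "C \<noteq> {}" "\<And>q. q \<in> C \<Longrightarrow> sublinear q" "\<And>q x. q \<in> C \<Longrightarrow> q x \<le> p x"
    and chain: "\<And>q r. q \<in> C \<Longrightarrow> r \<in> C \<Longrightarrow> (\<forall>x. q x \<le> r x) \<or> (\<forall>x. r x \<le> q x)"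
  shows "sublinear (\<lambda>x. INF q\<in>C. q x)" "\<And>q x. q \<in> C \<Longrightarrow> (INF q\<in>C. q x) \<le> q x"
proof -
  have bdd: "bdd_below ((\<lambda>q. q x) ` C)" for x
  proof (rule bdd_belowI2)
    fix q assume q: "q \<in> C"
    show "- p (- x) \<le> q x" using sublinear_ge_minus[OF C(2)[OF q], of x] C(3)[OF q, of "- x"] by linarith
  qed
  show le: "(INF q\<in>C. q x) \<le> q x" if "q \<in> C" for q x
    by (rule cINF_lower[OF bdd that])
  have "(INF q\<in>C. q (x + y)) \<le> (INF q\<in>C. q x) + (INF q\<in>C. q y)" for x y
  proof -
    have *: "(INF q\<in>C. q (x + y)) \<le> q x + r y" if "q \<in> C" "r \<in> C" for q r
      using chain[OF that]
    proof
      assume "\<forall>x. q x \<le> r x"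
      then show ?thesis using le[OF that(1), of "x + y"] sublinear_add[OF C(2)[OF that(1)], of x y]
        by (smt (verit))
    next
      assume "\<forall>x. r x \<le> q x"
      then show ?thesis using le[OF that(2), of "x + y"] sublinear_add[OF C(2)[OF that(2)], of x y]
        by (smt (verit))
    qed
    have "(INF q\<in>C. q (x + y)) - r y \<le> (INF q\<in>C. q x)" if "r \<in> C" for r
      using *[OF _ that] by (intro cINF_greatest C) (auto simp: algebra_simps)
    then have "(INF q\<in>C. q (x + y)) - (INF q\<in>C. q x) \<le> (INF q\<in>C. q y)"
      by (intro cINF_greatest C) (auto simp: algebra_simps)
    then show ?thesis by simp
  qed
  moreover have "(INF q\<in>C. q (c *\<^sub>R x)) \<le> c * (INF q\<in>C. q x)" if c: "c > 0" for c x
  proof -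
    have "(INF q\<in>C. q (c *\<^sub>R x)) / c \<le> (INF q\<in>C. q x)"
    proof (rule cINF_greatest[OF C(1)])
      fix q assume q: "q \<in> C"
      have "(INF q\<in>C. q (c *\<^sub>R x)) \<le> c * q x"
        using le[OF q, of "c *\<^sub>R x"] sublinear_scaleR_le[OF C(2)[OF q] c, of x] by linarith
      then show "(INF q\<in>C. q (c *\<^sub>R x)) / c \<le> q x" using c by (simp add: field_simps)
    qed
    then show ?thesis using c by (simp add: field_simps)
  qed
  ultimately show "sublinear (\<lambda>x. INF q\<in>C. q x)" by (simp add: sublinear_def)
qed

text \<open>A minimal sublinear functional is linear: otherwise the functional
  \<open>q'\<close> constructed from a direction \<open>y\<close> would be smaller.\<close>

lemma minimal_sublinear_linear:
  fixes q :: "'a::real_vector \<Rightarrow> real"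
  assumes q: "sublinear q"
    and min: "\<And>q'. sublinear q' \<Longrightarrow> (\<And>x. q' x \<le> q x) \<Longrightarrow> q' = q"
  shows "linear q"
proof -
  have ge: "q x + q y \<le> q (x + y)" for x y
  proof -
    \<comment> \<open>The term \<open>t = 0\<close> shows \<open>q' \<le> q\<close>, so minimality
      gives \<open>q' = q\<close>; the term \<open>t = 1\<close> then reads
      \<open>q x + q y \<le> q (x + y)\<close>, the half of additivity that sublinearity
      lacks.\<close>
    define q' where "q' x = (INF t\<in>{0..}. q (x + t *\<^sub>R y) - t * q y)" for x
    have bdd: "bdd_below ((\<lambda>t. q (x + t *\<^sub>R y) - t * q y) ` {0..})" for x
    proof (rule bdd_belowI2)
      fix t :: real assume "t \<in> {0..}"
      then have "t * q y \<le> q (x + t *\<^sub>R y) + q (- x)"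
        using sublinear_add[OF q, of "x + t *\<^sub>R y" "- x"] sublinear_scaleR[OF q, of t y] by simp
      then show "- q (- x) \<le> q (x + t *\<^sub>R y) - t * q y" by simp
    qed
    have le: "q' x \<le> q (x + t *\<^sub>R y) - t * q y" if "t \<ge> 0" for x t
      unfolding q'_def by (rule cINF_lower[OF bdd]) (use that in simp)
    have "q' (x1 + x2) \<le> q' x1 + q' x2" for x1 x2
    proof -
      have *: "q' (x1 + x2) \<le> (q (x1 + t1 *\<^sub>R y) - t1 * q y) + (q (x2 + t2 *\<^sub>R y) - t2 * q y)"
        if "t1 \<ge> 0" "t2 \<ge> 0" for t1 t2
        using le[of "t1 + t2" "x1 + x2"] that sublinear_add[OF q, of "x1 + t1 *\<^sub>R y" "x2 + t2 *\<^sub>R y"]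
        by (simp add: algebra_simps)
      have "q' (x1 + x2) - (q (x2 + t2 *\<^sub>R y) - t2 * q y) \<le> q' x1" if "t2 \<ge> 0" for t2
        unfolding q'_def[of x1] using *[OF _ that] by (intro cINF_greatest) (auto simp: algebra_simps)
      then have "q' (x1 + x2) - q' x1 \<le> q' x2"
        unfolding q'_def[of x2] by (intro cINF_greatest) (auto simp: algebra_simps)
      then show ?thesis by simp
    qed
    moreover have "q' (c *\<^sub>R x) \<le> c * q' x" if c: "c > 0" for c x
    proof -
      have "q' (c *\<^sub>R x) / c \<le> q' x"
        unfolding q'_def[of x]
      proof (rule cINF_greatest)
        fix t :: real assume t: "t \<in> {0..}"
        have "q' (c *\<^sub>R x) \<le> q (c *\<^sub>R x + (c * t) *\<^sub>R y) - (c * t) * q y" using t c by (intro le) auto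
        also have "c *\<^sub>R x + (c * t) *\<^sub>R y = c *\<^sub>R (x + t *\<^sub>R y)" by (simp add: algebra_simps)
        also have "q \<dots> = c * q (x + t *\<^sub>R y)" using c by (intro sublinear_scaleR q) auto
        finally show "q' (c *\<^sub>R x) / c \<le> q (x + t *\<^sub>R y) - t * q y" using c by (simp add: field_simps)
      qed simp
      then show ?thesis using c by (simp add: field_simps)
    qed
    ultimately have "sublinear q'" by (simp add: sublinear_def)
    moreover have "q' x \<le> q x" for x using le[of 0 x] by simp
    ultimately have "q' = q" by (rule min)
    then show ?thesis using le[of 1 x] by simp
  qed
  have add: "q (x + y) = q x + q y" for x y
    using ge[of x y] sublinear_add[OF q, of x y] by simp
  have minus: "q (- x) = - q x" for x
    using add[of x "- x"] sublinear_zero[OF q] by simp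
  show ?thesis
  proof (rule linearI)
    show "q (c *\<^sub>R x) = c *\<^sub>R q x" for c x
    proof (cases "c \<ge> 0")
      case False
      have "q (c *\<^sub>R x) = q ((- c) *\<^sub>R (- x))" by simp
      also have "\<dots> = (- c) * q (- x)" using False by (intro sublinear_scaleR q) simp
      finally show ?thesis by (simp add: minus)
    qed (simp add: sublinear_scaleR[OF q])
  qed (rule add)
qed

text \<open>The functional to be extended is no separate datum here: in the application it is
  encoded in \<open>p\<close>. Zorn's lemma provides a minimal sublinear functional below
  \<open>p\<close>, which is linear.\<close>

theorem Hahn_Banach_sublinear:
  fixes p :: "'a::real_vector \<Rightarrow> real"
  assumes p: "sublinear p"
  obtains l where "linear l" "\<And>x. l x \<le> p x"
proof -
  define A where "A = {q. sublinear q \<and> (\<forall>x. q x \<le> p x)}"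
  \<comment> \<open>Larger with respect to \<open>R\<close> means smaller as a functional, so a
    maximal element in Zorn's sense is a minimal functional.\<close>
  define R where "R = {(q, r). q \<in> A \<and> r \<in> A \<and> (\<forall>x. r x \<le> q x)}"
  have Field: "Field R = A" by (auto simp: R_def Field_def)
  have "Partial_order R"
    unfolding partial_order_on_def preorder_on_def Field
    by (auto simp: R_def refl_on_def trans_def antisym_def fun_eq_iff intro: order_trans antisym)
  moreover have "\<exists>u\<in>Field R. \<forall>q\<in>C. (q, u) \<in> R" if C: "C \<in> Chains R" for C
  proof (cases "C = {}")
    case True
    then show ?thesis using p by (auto simp: Field A_def)
  next
    case False
    have CA: "C \<subseteq> A" using C by (auto simp: Chains_def R_def)
    define u where "u x = (INF q\<in>C. q x)" for x
    have chain: "(\<forall>x. q x \<le> r x) \<or> (\<forall>x. r x \<le> q x)" if "q \<in> C" "r \<in> C" for q r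
      using C that by (auto simp: Chains_def R_def)
    have "sublinear u" "\<And>q x. q \<in> C \<Longrightarrow> u x \<le> q x"
      unfolding u_def using sublinear_Inf_chain[OF False, of p] CA chain by (auto simp: A_def)
    moreover have "u x \<le> p x" for x
    proof -
      obtain q where "q \<in> C" using False by blast
      then have "u x \<le> q x" "q x \<le> p x" using calculation(2) CA by (auto simp: A_def)
      then show ?thesis by simp
    qed
    ultimately have "u \<in> A" "\<forall>q\<in>C. (q, u) \<in> R" using CA by (auto simp: A_def R_def)
    then show ?thesis by (auto simp: Field)
  qed
  ultimately obtain q where q: "q \<in> A" "\<And>r. r \<in> A \<Longrightarrow> (q, r) \<in> R \<Longrightarrow> r = q"
    using Zorns_po_lemma[of R] unfolding Field by blast
  have "linear q"
  proof (rule minimal_sublinear_linear)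
    show "sublinear q" using q(1) by (simp add: A_def)
    fix q' assume q': "sublinear q'" "\<And>x. q' x \<le> q x"
    moreover have "q x \<le> p x" for x using q(1) by (simp add: A_def)
    ultimately have "q' \<in> A" by (auto simp: A_def intro: order_trans)
    then show "q' = q" using q q' by (auto simp: R_def)
  qed
  then show ?thesis using that q(1) by (auto simp: A_def)
qed

section \<open>Positive functionals on an interval\<close>

text \<open>To the right of the last node all hats but the last one vanish. This is the new case in
  the induction for \<open>hat_sum\<close>.\<close>

lemma hat_sum_right: "real n \<le> s \<Longrightarrow> (\<Sum>j\<le>n. max 0 (1 - \<bar>s - real j\<bar>)) = max 0 (1 - (s - real n))"
  by (induction n) auto

lemma hat_sum: "0 \<le> s \<Longrightarrow> s \<le> real n \<Longrightarrow> (\<Sum>j\<le>n. max 0 (1 - \<bar>s - real j\<bar>)) = 1"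
proof (induction n)
  case (Suc n)
  show ?case
  proof (cases "s \<le> real n")
    case False
    then have "(\<Sum>j\<le>Suc n. max 0 (1 - \<bar>s - real j\<bar>)) = max 0 (1 - (s - real n)) + max 0 (1 - \<bar>s - real (Suc n)\<bar>)"
      by (simp only: sum.atMost_Suc hat_sum_right not_le less_imp_le)
    then show ?thesis using Suc.prems False by simp
  qed (use Suc in auto)
qed simp

text \<open>The measures \<open>\<mu> n\<close> carry the masses \<open>l (hat j)\<close> at equally spaced points, where the
  piecewise linear functions \<open>hat j\<close> form a partition of unity; a weak limit represents \<open>l\<close>.\<close>

theorem positive_functional_measure:
  fixes l :: "(real \<Rightarrow>\<^sub>C real) \<Rightarrow> real"
  assumes ab: "a < b" and l: "linear l"
    and pos: "\<And>u. (\<And>t. t \<in> {a..b} \<Longrightarrow> apply_bcontfun u t \<le> 0) \<Longrightarrow> l u \<le> 0"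
  obtains \<nu> :: "real measure" where "finite_measure \<nu>" "sets \<nu> = sets borel"
    "\<And>u. (\<integral>t. apply_bcontfun u t \<partial>\<nu>) = l u"
proof -
  interpret linear l by fact
  define one :: "real \<Rightarrow>\<^sub>C real" where "one = const_bcontfun 1"
  have one [simp]: "apply_bcontfun one t = 1" for t by (simp add: one_def const_bcontfun.rep_eq)
  have mono: "l u \<le> l v" if "\<And>t. t \<in> {a..b} \<Longrightarrow> apply_bcontfun u t \<le> apply_bcontfun v t" for u v
  proof -
    have "l (u - v) \<le> 0" by (rule pos) (use that in \<open>simp add: minus_bcontfun.rep_eq\<close>)
    then show ?thesis by (simp add: diff)
  qed
  define c where "c = l one"
  have c: "c \<ge> 0" using mono[of 0 one] by (simp add: c_def zero zero_bcontfun.rep_eq)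
  have l_bound: "\<bar>l u\<bar> \<le> e * c" if "\<And>t. t \<in> {a..b} \<Longrightarrow> \<bar>apply_bcontfun u t\<bar> \<le> e" for u e
  proof -
    have "l u \<le> l (e *\<^sub>R one)" by (rule mono) (use that in \<open>force simp: scaleR_bcontfun.rep_eq\<close>)
    moreover have "l ((- e) *\<^sub>R one) \<le> l u" by (rule mono) (use that in \<open>force simp: scaleR_bcontfun.rep_eq\<close>)
    moreover have "l (e *\<^sub>R one) = e * c" "l ((- e) *\<^sub>R one) = (- e) * c"
      by (simp_all only: scale c_def real_scaleR_def)
    ultimately show ?thesis by simp
  qed
  show ?thesis
  \<comment> \<open>If the total mass \<open>c\<close> is 0, then \<open>l\<close> vanishes by
    \<open>l_bound\<close>. Otherwise division by \<open>c\<close> leads to probability measures, to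
    which the compactness theorem for weak convergence applies.\<close>
  proof (cases "c = 0")
    case True
    have "l u = 0" for u
      using l_bound[of u "norm u"] norm_bounded[of u] True by simp
    then show ?thesis
      by (intro that[of "null_measure borel"]) (auto intro!: finite_measureI)
  next
    case False
    then have c: "c > 0" using c by simp
    define x where "x n j = a + real j * ((b - a) / real (Suc n))" for n j :: nat
    define s where "s n t = (t - a) / ((b - a) / real (Suc n))" for n :: nat and t
    define hat where "hat n j = Bcontfun (\<lambda>t. max 0 (1 - \<bar>s n t - real j\<bar>))" for n j :: nat
    have hat [simp]: "apply_bcontfun (hat n j) t = max 0 (1 - \<bar>s n t - real j\<bar>)" for n j t
    proof -
      have "(\<lambda>t. max 0 (1 - \<bar>s n t - real j\<bar>)) \<in> bcontfun"
        by (rule bcontfun_normI[of _ 1]) (use ab in \<open>auto simp: s_def intro!: continuous_intros\<close>)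
      then show ?thesis by (simp add: hat_def Bcontfun_inverse)
    qed
    have s: "0 \<le> s n t" "s n t \<le> real (Suc n)" if "t \<in> {a..b}" for n t
    proof -
      have eq: "s n t = (t - a) / (b - a) * real (Suc n)" using ab by (simp add: s_def)
      have r: "0 \<le> (t - a) / (b - a)" "(t - a) / (b - a) \<le> 1" using that ab by auto
      show "0 \<le> s n t" unfolding eq using r(1) by (rule mult_nonneg_nonneg) simp
      show "s n t \<le> real (Suc n)" unfolding eq using mult_right_mono[OF r(2), of "real (Suc n)"] by simp
    qed
    have x_diff: "\<bar>t - x n j\<bar> = \<bar>s n t - real j\<bar> * ((b - a) / real (Suc n))" for n j t
    proof -
      have "t - x n j = (s n t - real j) * ((b - a) / real (Suc n))"
      proof -
        have *: "t - (a + real j * D) = ((t - a) / D - real j) * D" if "D \<noteq> 0" for D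
          using that by (simp add: field_simps)
        show ?thesis unfolding s_def x_def by (rule *) (use ab in auto)
      qed
      then have "\<bar>t - x n j\<bar> = \<bar>s n t - real j\<bar> * \<bar>(b - a) / real (Suc n)\<bar>"
        by (simp only: abs_mult)
      then show ?thesis using ab by simp
    qed
    have x_range: "x n j \<in> {a..b}" if "j \<le> Suc n" for n j
    proof -
      have "real j * (b - a) \<le> real (Suc n) * (b - a)" using that ab by (intro mult_right_mono) auto
      then have "real j * ((b - a) / real (Suc n)) \<le> b - a"
        by (simp add: divide_le_eq mult.commute)
      then show ?thesis using ab by (simp add: x_def)
    qed
    define w where "w n j = l (hat n j) / c" for n j :: nat
    have w: "w n j \<ge> 0" for n j
      using mono[of 0 "hat n j"] c by (simp add: w_def zero zero_bcontfun.rep_eq)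
    have apply_sum: "apply_bcontfun (\<Sum>j\<in>J. g j) t = (\<Sum>j\<in>J. apply_bcontfun (g j) t)" for J :: "nat set" and g t
      by (induction J rule: infinite_finite_induct) (auto simp: plus_bcontfun.rep_eq zero_bcontfun.rep_eq)
    have w_sum: "(\<Sum>j\<le>Suc n. w n j) = 1" for n
    proof -
      have eq: "apply_bcontfun (\<Sum>j\<le>Suc n. hat n j) t = apply_bcontfun one t" if "t \<in> {a..b}" for t
        unfolding apply_sum hat one by (rule hat_sum[OF s[OF that]])
      have "l (\<Sum>j\<le>Suc n. hat n j) = l one"
        by (intro antisym mono) (simp_all only: eq order_refl)
      then show ?thesis unfolding w_def sum_divide_distrib[symmetric] using c by (simp only: sum c_def) simp
    qed
    \<comment> \<open>The index \<open>j\<close> is drawn with probability \<open>w n j\<close>; the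
      image under \<open>x n\<close> is the discrete measure at the nodes.\<close>
    define P where "P n = point_measure {..Suc n} (\<lambda>j. ennreal (w n j))" for n
    have P: "prob_space (P n)" for n
    proof (rule prob_spaceI)
      have "emeasure (P n) (space (P n)) = (\<Sum>j\<le>Suc n. ennreal (w n j))"
        unfolding P_def by (simp only: space_point_measure emeasure_point_measure_finite[OF finite_atMost order_refl])
      also have "\<dots> = ennreal (\<Sum>j\<le>Suc n. w n j)" by (rule sum_ennreal) (rule w)
      finally show "emeasure (P n) (space (P n)) = 1" by (simp only: w_sum ennreal_1)
    qed
    have meas: "x n \<in> measurable (P n) borel" for n by (simp add: P_def)
    define \<mu> where "\<mu> n = distr (P n) borel (x n)" for n
    have rd: "real_distribution (\<mu> n)" for n
      unfolding \<mu>_def by (intro prob_space.real_distribution_distr P meas)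
    have int: "(\<integral>t. apply_bcontfun u t \<partial>\<mu> n) = l (\<Sum>j\<le>Suc n. apply_bcontfun u (x n j) *\<^sub>R hat n j) / c" for u n
    proof -
      have "(\<integral>t. apply_bcontfun u t \<partial>\<mu> n) = (\<integral>j. apply_bcontfun u (x n j) \<partial>P n)"
        unfolding \<mu>_def by (intro integral_distr meas borel_measurable_continuous_onI continuous_on_apply_bcontfun)
      also have "\<dots> = (\<Sum>j\<le>Suc n. w n j *\<^sub>R apply_bcontfun u (x n j))"
        unfolding P_def by (rule lebesgue_integral_point_measure_finite) (auto simp: w)
      also have "\<dots> = l (\<Sum>j\<le>Suc n. apply_bcontfun u (x n j) *\<^sub>R hat n j) / c"
        unfolding sum scale w_def sum_divide_distrib by (intro sum.cong refl) simp
      finally show ?thesis .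
    qed
    \<comment> \<open>The integral against \<open>\<mu> n\<close> is \<open>l\<close> of the
      piecewise linear interpolant of \<open>u\<close>, divided by \<open>c\<close>. Uniform
      continuity brings the interpolant uniformly close to \<open>u\<close> on
      \<open>{a..b}\<close>, and \<open>l_bound\<close> applies to the difference.\<close>
    have conv: "(\<lambda>n. \<integral>t. apply_bcontfun u t \<partial>\<mu> n) \<longlonglongrightarrow> l u / c" for u
    proof (rule LIMSEQ_I)
      fix e :: real assume e: "e > 0"
      have "uniformly_continuous_on {a..b} (apply_bcontfun u)"
        by (intro compact_uniformly_continuous continuous_on_apply_bcontfun compact_Icc)
      then obtain d where d: "d > 0" "\<And>t t'. t \<in> {a..b} \<Longrightarrow> t' \<in> {a..b} \<Longrightarrow> dist t' t < d \<Longrightarrow>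
          dist (apply_bcontfun u t') (apply_bcontfun u t) < e / 2"
        unfolding uniformly_continuous_on_def using half_gt_zero[OF e] by metis
      obtain N :: nat where N: "(b - a) / d < real N" using reals_Archimedean2 by blast
      have "norm ((\<integral>t. apply_bcontfun u t \<partial>\<mu> n) - l u / c) < e" if n: "n \<ge> N" for n
      proof -
        define v where "v = (\<Sum>j\<le>Suc n. apply_bcontfun u (x n j) *\<^sub>R hat n j)"
        have mesh: "(b - a) / real (Suc n) < d"
        proof -
          have "(b - a) / d < real (Suc n)" using N n by simp
          then show ?thesis using d(1) by (simp add: field_simps)
        qed
        have "\<bar>apply_bcontfun (v - u) t\<bar> \<le> e / 2" if t: "t \<in> {a..b}" for t
        proof -
          have h1: "(\<Sum>j\<le>Suc n. apply_bcontfun (hat n j) t) = 1"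
            unfolding hat by (rule hat_sum[OF s[OF t]])
          have "apply_bcontfun (v - u) t = (\<Sum>j\<le>Suc n. apply_bcontfun u (x n j) * apply_bcontfun (hat n j) t)
              - apply_bcontfun u t * (\<Sum>j\<le>Suc n. apply_bcontfun (hat n j) t)"
            unfolding h1 by (simp only: v_def minus_bcontfun.rep_eq apply_sum scaleR_bcontfun.rep_eq real_scaleR_def mult_1_right)
          also have "\<dots> = (\<Sum>j\<le>Suc n. (apply_bcontfun u (x n j) - apply_bcontfun u t) * apply_bcontfun (hat n j) t)"
            by (simp only: sum_distrib_left sum_subtractf left_diff_distrib)
          also have "\<bar>\<dots>\<bar> \<le> (\<Sum>j\<le>Suc n. e / 2 * apply_bcontfun (hat n j) t)"
          proof (rule order_trans[OF sum_abs sum_mono])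
            fix j assume j: "j \<in> {..Suc n}"
            show "\<bar>(apply_bcontfun u (x n j) - apply_bcontfun u t) * apply_bcontfun (hat n j) t\<bar> \<le> e / 2 * apply_bcontfun (hat n j) t"
            proof (cases "\<bar>s n t - real j\<bar> < 1")
              case True
              then have "\<bar>t - x n j\<bar> \<le> 1 * ((b - a) / real (Suc n))"
                unfolding x_diff using ab by (intro mult_right_mono) auto
              then have "dist (x n j) t < d" using mesh by (simp add: dist_real_def abs_minus_commute)
              then have "\<bar>apply_bcontfun u (x n j) - apply_bcontfun u t\<bar> \<le> e / 2"
                using d(2)[OF t x_range, of j n] j by (simp add: dist_real_def)
              then show ?thesis unfolding abs_mult using e by (intro mult_mono) auto
            qed simp
          qed
          also have "\<dots> = e / 2" unfolding sum_distrib_left[symmetric] h1 by simp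
          finally show ?thesis .
        qed
        then have "\<bar>l (v - u)\<bar> \<le> e / 2 * c" by (rule l_bound)
        then have "\<bar>l v / c - l u / c\<bar> \<le> e / 2"
          using c by (simp add: diff diff_divide_distrib[symmetric] divide_le_eq)
        then show ?thesis using e by (simp add: int v_def)
      qed
      then show "\<exists>N. \<forall>n\<ge>N. norm ((\<integral>t. apply_bcontfun u t \<partial>\<mu> n) - l u / c) < e" by blast
    qed
    have "tight \<mu>"
      unfolding tight_def
    proof (intro conjI allI impI rd)
      fix \<epsilon> :: real assume "\<epsilon> > 0"
      \<comment> \<open>Tightness is phrased with intervals open on the left, and the node
        \<open>x n 0 = a\<close> may carry mass, so the left end is moved to
        \<open>a - 1\<close>.\<close>
      have "measure (\<mu> n) {a - 1<..b} = 1" for n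
      proof -
        interpret P: prob_space "P n" by (rule P)
        have "x n -` {a - 1<..b} \<inter> space (P n) = space (P n)"
          using x_range[of _ n] by (force simp: P_def space_point_measure)
        then show ?thesis using meas P.prob_space by (simp add: \<mu>_def measure_distr)
      qed
      then show "\<exists>a b. a < b \<and> (\<forall>n. 1 - \<epsilon> < measure (\<mu> n) {a<..b})"
        using \<open>\<epsilon> > 0\<close> ab by (intro exI[of _ "a - 1"] exI[of _ b]) auto
    qed
    then obtain r M where r: "strict_mono r" and M: "real_distribution M" and weak: "weak_conv_m (\<mu> \<circ> id \<circ> r) M"
      using tight_imp_convergent_subsubsequence[of \<mu> id] by (auto simp: strict_mono_id)
    interpret M: real_distribution M by (rule M)
    have lim: "(\<integral>t. apply_bcontfun u t \<partial>M) = l u / c" for u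
    proof -
      have "(\<lambda>n. \<integral>t. apply_bcontfun u t \<partial>(\<mu> \<circ> id \<circ> r) n) \<longlonglongrightarrow> (\<integral>t. apply_bcontfun u t \<partial>M)"
      proof (rule weak_conv_imp_integral_bdd_continuous_conv[OF _ M weak])
        show "real_distribution ((\<mu> \<circ> id \<circ> r) n)" for n using rd by simp
        show "isCont (apply_bcontfun u) t" for t
          using continuous_on_apply_bcontfun[of UNIV u] unfolding continuous_on_eq_continuous_at[OF open_UNIV] by simp
        show "norm (apply_bcontfun u t) \<le> norm u" for t by (rule norm_bounded)
      qed
      moreover have "(\<lambda>n. \<integral>t. apply_bcontfun u t \<partial>(\<mu> \<circ> id \<circ> r) n) \<longlonglongrightarrow> l u / c"
        using LIMSEQ_subseq_LIMSEQ[OF conv r] by (simp add: o_def)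
      ultimately show ?thesis by (rule LIMSEQ_unique)
    qed
    show ?thesis
    proof (rule that[of "density M (\<lambda>_. ennreal c)"])
      show "finite_measure (density M (\<lambda>_. ennreal c))"
        by (rule finite_measureI) (simp add: emeasure_density ennreal_mult_eq_top_iff)
      show "sets (density M (\<lambda>_. ennreal c)) = sets borel" by simp
      fix u :: "real \<Rightarrow>\<^sub>C real"
      have "(\<integral>t. apply_bcontfun u t \<partial>density M (\<lambda>_. ennreal c)) = (\<integral>t. c *\<^sub>R apply_bcontfun u t \<partial>M)"
        using c integral_density[of "apply_bcontfun u" M "\<lambda>_. c"]
        by (simp add: borel_measurable_continuous_onI)
      then show "(\<integral>t. apply_bcontfun u t \<partial>density M (\<lambda>_. ennreal c)) = l u"
        using c by (simp add: lim)
    qed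
  qed
qed

section \<open>Complex measures on the circle\<close>

text \<open>A difference of measures is no measure. With sums the Jordan decomposition can be stated
  as an identity between measures, and both sides can be integrated.\<close>

definition add_measure :: "'a measure \<Rightarrow> 'a measure \<Rightarrow> 'a measure" where
  "add_measure M N = measure_of (space M) (sets M) (\<lambda>S. emeasure M S + emeasure N S)"

lemma sets_add_measure [simp, measurable_cong]: "sets (add_measure M N) = sets M"
  by (simp add: add_measure_def sets.space_closed sets.sigma_sets_eq)

lemma space_add_measure [simp]: "space (add_measure M N) = space M"
  by (simp add: add_measure_def sets.space_closed)

lemma emeasure_add_measure:
  assumes "sets N = sets M" "S \<in> sets M"
  shows "emeasure (add_measure M N) S = emeasure M S + emeasure N S"
  unfolding add_measure_def
proof (rule emeasure_measure_of_sigma)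
  show "sigma_algebra (space M) (sets M)" ..
  show "positive (sets M) (\<lambda>S. emeasure M S + emeasure N S)" by (simp add: positive_def)
  show "countably_additive (sets M) (\<lambda>S. emeasure M S + emeasure N S)"
  proof (rule countably_additiveI)
    fix A :: "nat \<Rightarrow> 'a set"
    assume A: "range A \<subseteq> sets M" "disjoint_family A"
    then have "range A \<subseteq> sets N" using assms by simp
    then have "(\<Sum>i. emeasure M (A i)) = emeasure M (\<Union>i. A i)" "(\<Sum>i. emeasure N (A i)) = emeasure N (\<Union>i. A i)"
      using A by (auto intro: suminf_emeasure)
    then show "(\<Sum>i. emeasure M (A i) + emeasure N (A i)) = emeasure M (\<Union>i. A i) + emeasure N (\<Union>i. A i)"
      by (subst suminf_add[symmetric]) auto
  qed
qed (fact assms)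

lemma nn_integral_add_measure:
  assumes s: "sets N = sets M" and f: "f \<in> borel_measurable M"
  shows "(\<integral>\<^sup>+x. f x \<partial>add_measure M N) = (\<integral>\<^sup>+x. f x \<partial>M) + (\<integral>\<^sup>+x. f x \<partial>N)"
  using f
proof (induction rule: borel_measurable_induct)
  have sp: "space N = space M" using s by (rule sets_eq_imp_space_eq)
  have meas: "u \<in> borel_measurable N \<longleftrightarrow> u \<in> borel_measurable M"
    "u \<in> borel_measurable (add_measure M N) \<longleftrightarrow> u \<in> borel_measurable M" for u :: "'a \<Rightarrow> ennreal"
    by (simp_all add: measurable_cong_sets[OF s refl] measurable_cong_sets[OF sets_add_measure refl])
  {
    case (cong f g)
    have "(\<integral>\<^sup>+x. f x \<partial>K) = (\<integral>\<^sup>+x. g x \<partial>K)" if "space K = space M" for K :: "'a measure"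
      by (rule nn_integral_cong) (use cong that in auto)
    then show ?case using cong sp by simp
  next
    case (set A)
    then show ?case using s by (simp add: emeasure_add_measure)
  next
    case (mult u c)
    then show ?case by (simp add: nn_integral_cmult distrib_left meas)
  next
    case (add u v)
    then show ?case by (simp add: nn_integral_add algebra_simps meas)
  next
    case (seq U)
    have mono: "incseq (\<lambda>i. \<integral>\<^sup>+x. U i x \<partial>K)" for K
      using \<open>incseq U\<close> by (auto simp: incseq_def le_fun_def intro!: nn_integral_mono)
    have sup: "(\<integral>\<^sup>+x. (SUP i. U i) x \<partial>K) = (SUP i. \<integral>\<^sup>+x. U i x \<partial>K)" if "sets K = sets M" for K
    proof -
      have "U i \<in> borel_measurable K" for i
        using seq by (simp add: measurable_cong_sets[OF that refl])
      then show ?thesis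
        unfolding SUP_apply using seq by (intro nn_integral_monotone_convergence_SUP) auto
    qed
    show ?case
      by (simp only: sup[OF sets_add_measure] sup[OF refl] sup[OF s] seq ennreal_SUP_add[OF mono mono])
  }
qed

lemma integral_add_measure_real:
  fixes f :: "'a \<Rightarrow> real"
  assumes s: "sets N = sets M" and f: "integrable M f" "integrable N f"
  shows "integrable (add_measure M N) f" "(\<integral>x. f x \<partial>add_measure M N) = (\<integral>x. f x \<partial>M) + (\<integral>x. f x \<partial>N)"
proof -
  have [measurable]: "f \<in> borel_measurable M" using f by auto
  have fin: "(\<integral>\<^sup>+x. ennreal (f x) \<partial>M) < top" "(\<integral>\<^sup>+x. ennreal (- f x) \<partial>M) < top"
    "(\<integral>\<^sup>+x. ennreal (f x) \<partial>N) < top" "(\<integral>\<^sup>+x. ennreal (- f x) \<partial>N) < top"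
    using f by (auto simp: real_integrable_def less_top[symmetric])
  show int: "integrable (add_measure M N) f"
    using fin by (simp add: real_integrable_def nn_integral_add_measure[OF s] measurable_cong_sets[OF sets_add_measure refl])
      auto
  show "(\<integral>x. f x \<partial>add_measure M N) = (\<integral>x. f x \<partial>M) + (\<integral>x. f x \<partial>N)"
    unfolding real_lebesgue_integral_def[OF int] real_lebesgue_integral_def[OF f(1)] real_lebesgue_integral_def[OF f(2)]
    using fin by (simp add: nn_integral_add_measure[OF s] enn2real_plus)
qed

lemma integral_add_measure:
  fixes f :: "'a \<Rightarrow> complex"
  assumes s: "sets N = sets M" and f: "integrable M f" "integrable N f"
  shows "(\<integral>x. f x \<partial>add_measure M N) = (\<integral>x. f x \<partial>M) + (\<integral>x. f x \<partial>N)"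
proof -
  have *: "integrable (add_measure M N) (\<lambda>x. complex_of_real (Re (f x)) + \<i> * complex_of_real (Im (f x)))"
    using integral_add_measure_real(1)[OF s integrable_Re[OF f(1)] integrable_Re[OF f(2)]]
      integral_add_measure_real(1)[OF s integrable_Im[OF f(1)] integrable_Im[OF f(2)]]
    by (intro Bochner_Integration.integrable_add integrable_mult_right integrable_of_real)
  then have int: "integrable (add_measure M N) f" by (simp add: complex_eq[symmetric])
  show ?thesis
    using f int integral_add_measure_real(2)[OF s integrable_Re[OF f(1)] integrable_Re[OF f(2)]]
      integral_add_measure_real(2)[OF s integrable_Im[OF f(1)] integrable_Im[OF f(2)]]
    by (simp add: complex_eq_iff)
qed

section \<open>Jordan decomposition and total variation\<close>

lemma sigma_sets_circle_borel: "sigma_sets circle (sets circle_borel) = sets circle_borel"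
  using sets.sigma_sets_eq[of circle_borel] by (simp add: space_restrict_space)

lemma sets_circle_borel_Pow: "sets circle_borel \<subseteq> Pow circle"
  using sets.space_closed[of circle_borel] by (simp add: space_restrict_space)

lemma sets_jordan_pos [simp, measurable_cong]: "sets (jordan_pos \<nu>) = sets circle_borel"
  unfolding jordan_pos_def using sets_circle_borel_Pow by (simp add: sigma_sets_circle_borel)

lemma sets_total_variation [simp, measurable_cong]: "sets (total_variation \<mu>) = sets circle_borel"
  unfolding total_variation_def using sets_circle_borel_Pow by (simp add: sigma_sets_circle_borel)

text \<open>With a Hahn set \<open>Y\<close> the supremum over the subsets of \<open>S\<close> is
  attained at \<open>S \<inter> Y\<close>. Countable additivity has to be checked, because otherwise
  \<open>measure_of\<close> would return the zero measure.\<close>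

lemma emeasure_jordan_pos:
  assumes fin: "finite_measure M" "finite_measure N"
    and sM: "sets M = sets circle_borel" and sN: "sets N = sets circle_borel"
    and Y: "Y \<in> sets circle_borel" "\<And>X. X \<in> sets circle_borel \<Longrightarrow> X \<subseteq> Y \<Longrightarrow> measure N X \<le> measure M X"
      "\<And>X. X \<in> sets circle_borel \<Longrightarrow> X \<inter> Y = {} \<Longrightarrow> measure M X \<le> measure N X"
    and S: "S \<in> sets circle_borel"
  shows "emeasure (jordan_pos (\<lambda>E. measure M E - measure N E)) S = ennreal (measure M (S \<inter> Y) - measure N (S \<inter> Y))"
proof -
  interpret M: finite_measure M by fact
  interpret N: finite_measure N by fact
  define \<nu> where "\<nu> E = measure M E - measure N E" for E
  have split: "\<nu> A = \<nu> (A \<inter> B) + \<nu> (A - B)" if "A \<in> sets circle_borel" "B \<in> sets circle_borel" for A B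
  proof -
    have d: "(A \<inter> B) \<inter> (A - B) = {}" "A \<inter> B \<union> (A - B) = A" by auto
    have "measure M A = measure M (A \<inter> B) + measure M (A - B)"
      using M.finite_measure_Union[of "A \<inter> B" "A - B"] d that sM by simp
    moreover have "measure N A = measure N (A \<inter> B) + measure N (A - B)"
      using N.finite_measure_Union[of "A \<inter> B" "A - B"] d that sN by simp
    ultimately show ?thesis by (simp add: \<nu>_def)
  qed
  have \<nu>_pos: "\<nu> X \<ge> 0" if "X \<in> sets circle_borel" "X \<subseteq> Y" for X using Y(2)[OF that] by (simp add: \<nu>_def)
  have \<nu>_neg: "\<nu> X \<le> 0" if "X \<in> sets circle_borel" "X \<inter> Y = {}" for X using Y(3)[OF that] by (simp add: \<nu>_def)
  have Sup: "(SUP E\<in>{E \<in> sets circle_borel. E \<subseteq> S}. ennreal (\<nu> E)) = ennreal (\<nu> (S \<inter> Y))"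
    if S: "S \<in> sets circle_borel" for S
  proof (rule antisym)
    show "(SUP E\<in>{E \<in> sets circle_borel. E \<subseteq> S}. ennreal (\<nu> E)) \<le> ennreal (\<nu> (S \<inter> Y))"
    proof (intro SUP_least ennreal_leI)
      fix E assume "E \<in> {E \<in> sets circle_borel. E \<subseteq> S}"
      then have E: "E \<in> sets circle_borel" "E \<subseteq> S" by auto
      have "\<nu> E = \<nu> (E \<inter> Y) + \<nu> (E - Y)" by (rule split[OF E(1) Y(1)])
      moreover have "\<nu> (E - Y) \<le> 0" using E Y(1) by (intro \<nu>_neg) auto
      moreover have "\<nu> (S \<inter> Y) = \<nu> (S \<inter> Y \<inter> E) + \<nu> (S \<inter> Y - E)" using S Y(1) E by (intro split) auto
      moreover have "\<nu> (S \<inter> Y - E) \<ge> 0" using S Y(1) E by (intro \<nu>_pos) auto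
      moreover have "S \<inter> Y \<inter> E = E \<inter> Y" using E by auto
      ultimately show "\<nu> E \<le> \<nu> (S \<inter> Y)" by simp
    qed
    show "ennreal (\<nu> (S \<inter> Y)) \<le> (SUP E\<in>{E \<in> sets circle_borel. E \<subseteq> S}. ennreal (\<nu> E))"
      by (rule SUP_upper) (use S Y(1) in auto)
  qed
  let ?\<mu> = "\<lambda>S. SUP E\<in>{E \<in> sets circle_borel. E \<subseteq> S}. ennreal (\<nu> E)"
  have "emeasure (jordan_pos \<nu>) S = ?\<mu> S"
  proof (rule emeasure_measure_of[OF jordan_pos_def sets_circle_borel_Pow])
    show "positive (sets (jordan_pos \<nu>)) ?\<mu>"
      unfolding positive_def using Sup[of "{}"] by (simp add: \<nu>_def)
    show "countably_additive (sets (jordan_pos \<nu>)) ?\<mu>"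
    proof (rule countably_additiveI)
      fix A :: "nat \<Rightarrow> complex set"
      assume A: "range A \<subseteq> sets (jordan_pos \<nu>)" "disjoint_family A" "(\<Union>i. A i) \<in> sets (jordan_pos \<nu>)"
      then have AY: "range (\<lambda>i. A i \<inter> Y) \<subseteq> sets circle_borel" "disjoint_family (\<lambda>i. A i \<inter> Y)"
        using Y(1) by (auto simp: disjoint_family_on_def)
      have "(\<lambda>i. \<nu> (A i \<inter> Y)) sums (measure M (\<Union>i. A i \<inter> Y) - measure N (\<Union>i. A i \<inter> Y))"
        unfolding \<nu>_def using AY sM sN
        by (intro sums_diff M.finite_measure_UNION N.finite_measure_UNION) auto
      also have "(\<Union>i. A i \<inter> Y) = (\<Union>i. A i) \<inter> Y" by auto
      finally have "(\<lambda>i. \<nu> (A i \<inter> Y)) sums \<nu> ((\<Union>i. A i) \<inter> Y)" by (simp add: \<nu>_def)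
      then have "(\<Sum>i. ennreal (\<nu> (A i \<inter> Y))) = ennreal (\<nu> ((\<Union>i. A i) \<inter> Y))"
        using AY by (intro suminf_ennreal_eq \<nu>_pos) auto
      moreover have "A i \<in> sets circle_borel" "(\<Union>i. A i) \<in> sets circle_borel" for i using A by auto
      ultimately show "(\<Sum>i. ?\<mu> (A i)) = ?\<mu> (\<Union>i. A i)" by (simp only: Sup)
    qed
  qed (use S in simp)
  then show ?thesis using Sup[OF S] by (simp add: \<nu>_def[abs_def])
qed

text \<open>On a Hahn set, where \<open>M\<close> dominates, both sums equal \<open>M\<close>; on
  its complement both equal \<open>N\<close>.\<close>

lemma jordan_decomposition_measures:
  assumes fin: "finite_measure M" "finite_measure N"
    and sM: "sets M = sets circle_borel" and sN: "sets N = sets circle_borel"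
  shows "finite_measure (jordan_pos (\<lambda>E. measure M E - measure N E))"
    and "add_measure M (jordan_pos (\<lambda>E. measure N E - measure M E)) =
      add_measure N (jordan_pos (\<lambda>E. measure M E - measure N E))"
proof -
  interpret M: finite_measure M by fact
  interpret N: finite_measure N by fact
  obtain Y where Y: "Y \<in> sets M" "\<And>X. X \<in> sets M \<Longrightarrow> X \<subseteq> Y \<Longrightarrow> emeasure N X \<le> emeasure M X"
    "\<And>X. X \<in> sets M \<Longrightarrow> X \<inter> Y = {} \<Longrightarrow> emeasure M X \<le> emeasure N X"
    using finite_unsigned_Hahn_decomposition[OF fin] sM sN by metis
  have le: "measure N X \<le> measure M X" if "X \<in> sets circle_borel" "X \<subseteq> Y" for X
    using Y(2)[of X] that sM by (simp add: M.emeasure_eq_measure N.emeasure_eq_measure)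
  have ge: "measure M X \<le> measure N X" if "X \<in> sets circle_borel" "X \<inter> Y = {}" for X
    using Y(3)[of X] that sM by (simp add: M.emeasure_eq_measure N.emeasure_eq_measure)
  have Yb: "Y \<in> sets circle_borel" "circle - Y \<in> sets circle_borel"
    using Y(1) sM sets.compl_sets[of Y circle_borel] by (auto simp: space_restrict_space)
  have pos: "emeasure (jordan_pos (\<lambda>E. measure M E - measure N E)) S = ennreal (measure M (S \<inter> Y) - measure N (S \<inter> Y))"
    if "S \<in> sets circle_borel" for S
    by (rule emeasure_jordan_pos[OF fin sM sN Yb(1) le ge that])
  have neg: "emeasure (jordan_pos (\<lambda>E. measure N E - measure M E)) S
      = ennreal (measure N (S \<inter> (circle - Y)) - measure M (S \<inter> (circle - Y)))"
    if "S \<in> sets circle_borel" for S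
  proof (rule emeasure_jordan_pos[OF fin(2,1) sN sM Yb(2) _ _ that])
    fix X assume X: "X \<in> sets circle_borel"
    then have "X \<subseteq> circle" using sets_circle_borel_Pow by auto
    then show "X \<subseteq> circle - Y \<Longrightarrow> measure M X \<le> measure N X" "X \<inter> (circle - Y) = {} \<Longrightarrow> measure N X \<le> measure M X"
      using le[OF X] ge[OF X] by auto
  qed
  show "finite_measure (jordan_pos (\<lambda>E. measure M E - measure N E))"
  proof (rule finite_measureI)
    have "space (jordan_pos (\<lambda>E. measure M E - measure N E)) \<in> sets circle_borel"
      using sets.top[of "jordan_pos (\<lambda>E. measure M E - measure N E)"] by simp
    then show "emeasure (jordan_pos (\<lambda>E. measure M E - measure N E)) (space (jordan_pos (\<lambda>E. measure M E - measure N E))) \<noteq> \<infinity>"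
      by (simp add: pos)
  qed
  show "add_measure M (jordan_pos (\<lambda>E. measure N E - measure M E)) =
      add_measure N (jordan_pos (\<lambda>E. measure M E - measure N E))"
  proof (rule measure_eqI)
    fix S assume "S \<in> sets (add_measure M (jordan_pos (\<lambda>E. measure N E - measure M E)))"
    then have S: "S \<in> sets circle_borel" using sM by simp
    then have S_sub: "S \<subseteq> circle" using sets_circle_borel_Pow by auto
    define A B where "A = S \<inter> Y" and "B = S \<inter> (circle - Y)"
    have AB: "A \<in> sets circle_borel" "B \<in> sets circle_borel" "A \<inter> B = {}" "A \<union> B = S"
      using S S_sub Yb by (auto simp: A_def B_def)
    have "measure M S = measure M A + measure M B" "measure N S = measure N A + measure N B"
      using AB sM sN M.finite_measure_Union[of A B] N.finite_measure_Union[of A B] by auto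
    moreover have "measure N A \<le> measure M A" "measure M B \<le> measure N B"
      using AB by (auto intro!: le ge simp: A_def B_def)
    ultimately have "emeasure M S + ennreal (measure N B - measure M B) = emeasure N S + ennreal (measure M A - measure N A)"
      by (simp add: M.emeasure_eq_measure N.emeasure_eq_measure ennreal_plus[symmetric] del: ennreal_plus)
    then show "emeasure (add_measure M (jordan_pos (\<lambda>E. measure N E - measure M E))) S =
        emeasure (add_measure N (jordan_pos (\<lambda>E. measure M E - measure N E))) S"
      using S sM sN by (simp add: emeasure_add_measure pos neg A_def B_def)
  qed (simp add: sM sN)
qed

text \<open>Frees \<open>cm_integral\<close> from the Jordan decomposition: every representation as
  a difference of finite measures gives the same value.\<close>

lemma integral_jordan:
  fixes f :: "complex \<Rightarrow> complex"
  assumes fin: "finite_measure M" "finite_measure N"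
    and sM: "sets M = sets circle_borel" and sN: "sets N = sets circle_borel"
    and f: "f \<in> borel_measurable circle_borel" "\<And>z. z \<in> circle \<Longrightarrow> norm (f z) \<le> C"
  shows "(\<integral>z. f z \<partial>jordan_pos (\<lambda>E. measure M E - measure N E)) - (\<integral>z. f z \<partial>jordan_pos (\<lambda>E. measure N E - measure M E))
    = (\<integral>z. f z \<partial>M) - (\<integral>z. f z \<partial>N)"
proof -
  let ?P = "jordan_pos (\<lambda>E. measure M E - measure N E)" and ?Q = "jordan_pos (\<lambda>E. measure N E - measure M E)"
  have int: "integrable K f" if "finite_measure K" "sets K = sets circle_borel" for K
  proof -
    have "space K = circle" using sets_eq_imp_space_eq[OF that(2)] by (simp add: space_restrict_space)
    then show ?thesis
      using f that by (intro finite_measure.integrable_const_bound[OF that(1), of _ C])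
        (auto simp: measurable_cong_sets[OF that(2) refl])
  qed
  have finPQ: "finite_measure ?P" "finite_measure ?Q"
    by (intro jordan_decomposition_measures(1) assms)+
  have "(\<integral>z. f z \<partial>M) + (\<integral>z. f z \<partial>?Q) = (\<integral>z. f z \<partial>add_measure M ?Q)"
    using fin finPQ sM by (intro integral_add_measure[symmetric] int) auto
  also have "add_measure M ?Q = add_measure N ?P" by (rule jordan_decomposition_measures(2)[OF fin sM sN])
  also have "(\<integral>z. f z \<partial>\<dots>) = (\<integral>z. f z \<partial>N) + (\<integral>z. f z \<partial>?P)"
    using fin finPQ sN by (intro integral_add_measure int) auto
  finally show ?thesis by (simp add: algebra_simps)
qed

text \<open>If the set function defining the total variation failed to be a measure, its
  \<open>measure_of\<close> would be the zero measure, so the estimate needs no additivity.\<close>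

lemma emeasure_total_variation_le:
  assumes N: "sets N = sets circle_borel"
    and le: "\<And>E. E \<in> sets circle_borel \<Longrightarrow> ennreal (norm (\<mu> E)) \<le> emeasure N E"
  shows "emeasure (total_variation \<mu>) S \<le> emeasure N S"
proof -
  have "(SUP E \<in> {E :: nat \<Rightarrow> complex set. range E \<subseteq> sets circle_borel \<and> disjoint_family E \<and> (\<Union>i. E i) = S}.
      (\<Sum>i. ennreal (norm (\<mu> (E i))))) \<le> emeasure N S"
  proof (rule SUP_least)
    fix E :: "nat \<Rightarrow> complex set"
    assume "E \<in> {E. range E \<subseteq> sets circle_borel \<and> disjoint_family E \<and> (\<Union>i. E i) = S}"
    then have E: "range E \<subseteq> sets circle_borel" "disjoint_family E" "(\<Union>i. E i) = S" by auto
    have "(\<Sum>i. ennreal (norm (\<mu> (E i)))) \<le> (\<Sum>i. emeasure N (E i))"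
      using E by (intro suminf_le le) auto
    also have "\<dots> = emeasure N (\<Union>i. E i)" using E N by (intro suminf_emeasure) auto
    finally show "(\<Sum>i. ennreal (norm (\<mu> (E i)))) \<le> emeasure N S" using E by simp
  qed
  then show ?thesis unfolding total_variation_def by (simp add: emeasure_measure_of_conv)
qed

text \<open>Neither of the pairs \<open>A\<close>, \<open>B\<close> and \<open>C\<close>,
  \<open>D\<close> has to be mutually singular; \<open>integral_jordan\<close> takes care of
  overlaps.\<close>

definition cm_of_measures ::
    "complex measure \<Rightarrow> complex measure \<Rightarrow> complex measure \<Rightarrow> complex measure \<Rightarrow> complex set \<Rightarrow> complex" where
  "cm_of_measures A B C D E = Complex (measure A E - measure B E) (measure C E - measure D E)"

locale four_circle_measures =
  fixes A B C D :: "complex measure"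
  assumes fin: "finite_measure A" "finite_measure B" "finite_measure C" "finite_measure D"
    and sets: "sets A = sets circle_borel" "sets B = sets circle_borel"
      "sets C = sets circle_borel" "sets D = sets circle_borel"
begin

lemma complex_measure_cm_of_measures: "complex_measure_on_circle (cm_of_measures A B C D)"
  unfolding complex_measure_on_circle_def
proof (intro allI impI)
  fix E :: "nat \<Rightarrow> complex set"
  assume E: "range E \<subseteq> sets circle_borel \<and> disjoint_family E"
  have *: "(\<lambda>i. measure K (E i)) sums measure K (\<Union>i. E i)" if "finite_measure K" "sets K = sets circle_borel" for K
    using E that by (intro finite_measure.finite_measure_UNION) auto
  show "(\<lambda>i. cm_of_measures A B C D (E i)) sums cm_of_measures A B C D (\<Union>i. E i)"
    unfolding sums_complex_iff cm_of_measures_def complex.sel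
    by (intro conjI sums_diff * fin sets)
qed

lemma cm_integral_cm_of_measures:
  assumes f: "f \<in> borel_measurable circle_borel" "\<And>z. z \<in> circle \<Longrightarrow> norm (f z) \<le> K"
  shows "cm_integral (cm_of_measures A B C D) f =
    ((\<integral>z. f z \<partial>A) - (\<integral>z. f z \<partial>B)) + \<i> * ((\<integral>z. f z \<partial>C) - (\<integral>z. f z \<partial>D))"
  using integral_jordan[OF fin(1,2) sets(1,2) f] integral_jordan[OF fin(3,4) sets(3,4) f]
  by (simp add: cm_integral_def cm_of_measures_def)

lemma nn_integral_total_variation_cm_of_measures:
  assumes f: "f \<in> borel_measurable circle_borel"
  shows "(\<integral>\<^sup>+z. f z \<partial>total_variation (cm_of_measures A B C D)) \<le>
    ((\<integral>\<^sup>+z. f z \<partial>A) + (\<integral>\<^sup>+z. f z \<partial>B)) + ((\<integral>\<^sup>+z. f z \<partial>C) + (\<integral>\<^sup>+z. f z \<partial>D))"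
proof -
  let ?N = "add_measure (add_measure A B) (add_measure C D)"
  have N: "sets ?N = sets circle_borel" by (simp add: sets)
  have em: "emeasure ?N E = (emeasure A E + emeasure B E) + (emeasure C E + emeasure D E)"
    if "E \<in> sets circle_borel" for E
    using that by (simp add: emeasure_add_measure sets)
  have "emeasure (total_variation (cm_of_measures A B C D)) E \<le> emeasure ?N E" for E
  proof (rule emeasure_total_variation_le[OF N])
    fix E assume E: "E \<in> sets circle_borel"
    have "norm (cm_of_measures A B C D E) \<le> \<bar>measure A E - measure B E\<bar> + \<bar>measure C E - measure D E\<bar>"
      unfolding cm_of_measures_def using cmod_le[of "Complex (measure A E - measure B E) (measure C E - measure D E)"] by simp
    also have "\<dots> \<le> (measure A E + measure B E) + (measure C E + measure D E)"
      by (intro add_mono) (simp_all add: abs_le_iff measure_nonneg add_increasing add_increasing2)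
    finally have "ennreal (norm (cm_of_measures A B C D E)) \<le> ennreal ((measure A E + measure B E) + (measure C E + measure D E))"
      by (rule ennreal_leI)
    also have "\<dots> = emeasure ?N E"
      using fin by (simp add: em[OF E] finite_measure.emeasure_eq_measure ennreal_plus)
    finally show "ennreal (norm (cm_of_measures A B C D E)) \<le> emeasure ?N E" .
  qed
  then have "total_variation (cm_of_measures A B C D) \<le> ?N"
    by (subst le_measure) (auto simp: sets)
  then have "(\<integral>\<^sup>+z. f z \<partial>total_variation (cm_of_measures A B C D)) \<le> (\<integral>\<^sup>+z. f z \<partial>?N)"
    by (intro nn_integral_mono_measure) (auto simp: sets)
  also have "\<dots> = ((\<integral>\<^sup>+z. f z \<partial>A) + (\<integral>\<^sup>+z. f z \<partial>B)) + ((\<integral>\<^sup>+z. f z \<partial>C) + (\<integral>\<^sup>+z. f z \<partial>D))"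
  proof -
    have m: "f \<in> borel_measurable A" "f \<in> borel_measurable C" "f \<in> borel_measurable (add_measure A B)"
      using f by (simp_all add: measurable_cong_sets[OF sets(1) refl] measurable_cong_sets[OF sets(3) refl]
          measurable_cong_sets[OF sets_add_measure refl])
    show ?thesis by (simp add: nn_integral_add_measure m sets)
  qed
  finally show ?thesis .
qed

end

section \<open>Model spaces\<close>

lemma H2b_add: "f \<in> H2b \<Longrightarrow> g \<in> H2b \<Longrightarrow> (\<lambda>z. f z + g z) \<in> H2b"
  by (auto simp: H2b_def L2_add distrib_right L2_circle_integrable L2_circle_mult_powi)

lemma H2b_cmult: "f \<in> H2b \<Longrightarrow> (\<lambda>z. c * f z) \<in> H2b"
  by (auto simp: H2b_def L2_cmult mult.assoc)

lemma H2b_AE_cong: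
  assumes f: "f \<in> H2b" and g: "g \<in> borel_measurable circle_measure"
    and eq: "AE z in circle_measure. f z = g z"
  shows "g \<in> H2b"
proof -
  have gL: "g \<in> L2 circle_measure" by (rule L2_AE_cong[OF H2b_L2[OF f] g eq])
  have "(\<integral>z. g z * z powi k \<partial>circle_measure) = (\<integral>z. f z * z powi k \<partial>circle_measure)" for k
    using eq by (intro integral_cong_AE borel_measurable_times powi_measurable_circle g L2_measurable[OF H2b_L2[OF f]])
      (auto elim: eventually_mono)
  then show ?thesis using gL H2b_zero[OF f] by (simp add: H2b_def)
qed

lemma H2b_mult:
  assumes f: "f \<in> H2b" and g: "g \<in> H2b" and bdd: "AE z in circle_measure. norm (f z) \<le> C"
  shows "(\<lambda>z. f z * g z) \<in> H2b"
  using H2b_mult_zero[OF f g] L2_mult_bounded(1)[OF H2b_L2[OF g] L2_measurable[OF H2b_L2[OF f]] bdd]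
  by (simp add: H2b_def)

lemma inner_function_H2b:
  assumes "inner_function \<theta>" shows "\<theta> \<in> H2b"
proof (rule Hardy_imp_H2b)
  have "bounded (\<theta> ` disc)" using assms by (simp add: inner_function_def)
  then obtain B where B: "\<And>z. z \<in> disc \<Longrightarrow> norm (\<theta> z) \<le> B"
    unfolding bounded_iff by blast
  have "(\<integral>z. norm (\<theta> (of_real r * z)) powr 2 \<partial>circle_measure) \<le> B\<^sup>2" if r: "0 \<le> r" "r < 1" for r
  proof (rule integral_real_bounded)
    have "(\<integral>\<^sup>+z. ennreal (norm (\<theta> (of_real r * z)) powr 2) \<partial>circle_measure) \<le> (\<integral>\<^sup>+z. ennreal (B\<^sup>2) \<partial>circle_measure)"
    proof (intro nn_integral_mono ennreal_leI)
      fix z assume "z \<in> space circle_measure"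
      then have "norm (\<theta> (of_real r * z)) \<le> B" using r by (intro B) (simp add: norm_mult)
      then show "norm (\<theta> (of_real r * z)) powr 2 \<le> B\<^sup>2" by (simp add: power_mono)
    qed
    then show "(\<integral>\<^sup>+z. ennreal (norm (\<theta> (of_real r * z)) powr 2) \<partial>circle_measure) \<le> ennreal (B\<^sup>2)"
      using circle.emeasure_space_1 by simp
  qed simp
  then show "\<theta> \<in> Hardy 2" using assms by (auto simp: Hardy_def inner_function_def)
qed

text \<open>The boundary functions of \<open>K\<^sub>\<theta>\<close>: those \<open>f\<close> in \<open>H\<^sup>2\<close> for which
  \<open>\<theta> * cnj (z * f)\<close> is again in \<open>H\<^sup>2\<close>.\<close>

definition Kb :: "(complex \<Rightarrow> complex) \<Rightarrow> (complex \<Rightarrow> complex) set" where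
  "Kb \<theta> = {f \<in> H2b. (\<lambda>z. \<theta> z * cnj (z * f z)) \<in> H2b}"

lemma L2_inner_eq_ip: "L2_inner f g = L2_ip circle_measure f g"
  by (simp add: L2_inner_def L2_ip_def)

section \<open>The model space in terms of boundary functions\<close>

locale inner_boundary =
  fixes \<theta> :: "complex \<Rightarrow> complex"
  assumes \<theta>_H2b: "\<theta> \<in> H2b" and \<theta>_norm: "AE z in circle_measure. norm (\<theta> z) = 1"
begin

lemma \<theta>_measurable [measurable]: "\<theta> \<in> borel_measurable circle_measure"
  by (rule L2_measurable[OF H2b_L2[OF \<theta>_H2b]])

lemma \<theta>_cnj: "AE z in circle_measure. \<theta> z * cnj (\<theta> z) = 1"
  using \<theta>_norm by eventually_elim (simp add: complex_norm_square[symmetric])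

lemma \<theta>_powi_L2: "(\<lambda>z. \<theta> z * z powi k) \<in> L2 circle_measure"
  by (intro L2_circle_mult_powi H2b_L2 \<theta>_H2b)

lemma twist_L2:
  assumes "f \<in> L2 circle_measure"
  shows "(\<lambda>z. \<theta> z * cnj (z * f z)) \<in> L2 circle_measure"
proof -
  have "(\<lambda>z. \<theta> z * (cnj (f z * z powi 1))) \<in> L2 circle_measure"
    by (rule L2_mult_bounded(1)[where C = 1, OF L2_cnj[OF L2_circle_mult_powi[OF assms]] \<theta>_measurable])
      (use \<theta>_norm in auto)
  then show ?thesis by (simp add: mult.commute)
qed

text \<open>The factor \<open>cnj z\<close> of the twist shifts indices by one: the conditions for
  \<open>k \<ge> 1\<close> that define \<open>H2b\<close> become orthogonality to
  \<open>\<theta> * z^l\<close> for \<open>l \<ge> 0\<close>.\<close>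

lemma twist_coeff:
  "(\<integral>z. \<theta> z * cnj (z * f z) * z powi k \<partial>circle_measure) = cnj (L2_ip circle_measure f (\<lambda>z. \<theta> z * z powi (k - 1)))"
proof -
  have "(\<integral>z. \<theta> z * cnj (z * f z) * z powi k \<partial>circle_measure)
      = (\<integral>z. cnj (f z * cnj (\<theta> z * z powi (k - 1))) \<partial>circle_measure)"
  proof (rule Bochner_Integration.integral_cong[OF refl])
    fix z assume "z \<in> space circle_measure"
    then have z: "norm z = 1" by simp
    have "cnj z * z powi k = z powi (k - 1)"
      using powi_add_circle[OF z, of "-1" k] cnj_powi[OF z, of 1] by simp
    then show "\<theta> z * cnj (z * f z) * z powi k = cnj (f z * cnj (\<theta> z * z powi (k - 1)))"
      by (simp add: mult_ac)
  qed
  also have "\<dots> = cnj (\<integral>z. f z * cnj (\<theta> z * z powi (k - 1)) \<partial>circle_measure)"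
    by (rule Bochner_Integration.integral_cnj)
  finally show ?thesis by (simp only: L2_ip_def)
qed

text \<open>Orthogonality to the negative powers puts \<open>f\<close> into \<open>H^2\<close>; the
  second family expresses that \<open>f\<close> is perpendicular to \<open>\<theta> H^2\<close>. The
  model space thereby becomes an annihilator, to which \<open>projection_exists\<close>
  applies.\<close>

definition orth :: "(complex \<Rightarrow> complex) set" where
  "orth = {(\<lambda>z. z powi (- k)) | k::int. k \<ge> 1} \<union> {(\<lambda>z. \<theta> z * z powi k) | k::int. k \<ge> 0}"

lemma orth_L2: "orth \<subseteq> L2 circle_measure"
  by (auto simp: orth_def L2_powi \<theta>_powi_L2 simp del: power_int_minus)

lemma Kb_annihilator: "Kb \<theta> = annihilator circle_measure orth"
proof (intro set_eqI iffI)
  fix f assume f: "f \<in> Kb \<theta>"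
  then have fH: "f \<in> H2b" by (simp add: Kb_def)
  have "L2_ip circle_measure f (\<lambda>z. \<theta> z * z powi k) = 0" if "k \<ge> 0" for k
    using f twist_coeff[of f "k + 1"] that H2b_zero[of "\<lambda>z. \<theta> z * cnj (z * f z)" "k + 1"] by (simp add: Kb_def)
  moreover have "L2_ip circle_measure f (\<lambda>z. z powi (- k)) = 0" if "k \<ge> 1" for k
    using H2b_zero[OF fH that] by (simp only: ip_powi)
  ultimately show "f \<in> annihilator circle_measure orth"
    using H2b_L2[OF fH] by (auto simp: annihilator_def orth_def)
next
  fix f assume f: "f \<in> annihilator circle_measure orth"
  then have fL: "f \<in> L2 circle_measure" by (simp add: annihilator_def)
  have "(\<integral>z. f z * z powi k \<partial>circle_measure) = 0" if "k \<ge> 1" for k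
  proof -
    have "(\<lambda>z. z powi (- k)) \<in> orth" using that unfolding orth_def by blast
    then show ?thesis using f unfolding ip_powi[symmetric] annihilator_def by blast
  qed
  moreover have "(\<integral>z. \<theta> z * cnj (z * f z) * z powi k \<partial>circle_measure) = 0" if "k \<ge> 1" for k
  proof -
    have "(\<lambda>z. \<theta> z * z powi (k - 1)) \<in> orth" unfolding orth_def using that by force
    then have "L2_ip circle_measure f (\<lambda>z. \<theta> z * z powi (k - 1)) = 0" using f unfolding annihilator_def by blast
    then show ?thesis unfolding twist_coeff by simp
  qed
  ultimately show "f \<in> Kb \<theta>" using fL twist_L2[OF fL] by (simp add: Kb_def H2b_def)
qed

lemma Kb_H2b: "f \<in> Kb \<theta> \<Longrightarrow> f \<in> H2b"
  by (simp add: Kb_def)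

lemma Kb_L2: "f \<in> Kb \<theta> \<Longrightarrow> f \<in> L2 circle_measure"
  by (intro H2b_L2 Kb_H2b)

lemma Kb_add_mult: "f \<in> Kb \<theta> \<Longrightarrow> g \<in> Kb \<theta> \<Longrightarrow> (\<lambda>z. f z + c * g z) \<in> Kb \<theta>"
  unfolding Kb_annihilator by (rule annihilator_add_mult[OF orth_L2])

text \<open>As \<open>\<theta>\<close> and \<open>z\<close> are unimodular almost everywhere on the
  circle, \<open>f = \<theta> * cnj (z * h)\<close> can be solved for \<open>h\<close>, and the
  solution is the twist of \<open>f\<close>.\<close>

lemma model_space_imp_Kb:
  assumes "f \<in> model_space 2 \<theta>" shows "f \<in> Kb \<theta>"
proof -
  obtain h g where f: "f \<in> H2b" and h: "h \<in> H2b"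
    and g: "AE z in circle_measure. g z = cnj (z * h z)" and fg: "AE z in circle_measure. f z = \<theta> z * g z"
    using assms Hardy_imp_H2b unfolding model_space_def Hardy_minus_def by auto
  have "AE z in circle_measure. h z = \<theta> z * cnj (z * f z)"
    using g fg \<theta>_cnj AE_space
  proof eventually_elim
    case (elim z)
    have zz: "z * cnj z = 1" using elim(4) complex_norm_square[of z] by simp
    have "\<theta> z * cnj (z * f z) = (\<theta> z * cnj (\<theta> z)) * (z * cnj z) * h z"
      unfolding elim(2) elim(1) by (simp add: mult_ac)
    then show ?case using zz elim(3) by simp
  qed
  from H2b_AE_cong[OF h _ this] show ?thesis
    using f L2_measurable[OF twist_L2[OF H2b_L2[OF f]]] by (simp add: Kb_def)
qed

text \<open>Fatou's theorem is applied twice, to \<open>f\<close> and to its twist; the second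
  function is the one that \<open>Hardy_minus\<close> asks for.\<close>

lemma Kb_imp_model_space:
  assumes f: "f \<in> Kb \<theta>"
  obtains F where "F \<in> model_space 2 \<theta>" "\<And>z. norm z = 1 \<Longrightarrow> F z = f z"
proof -
  obtain F where F: "F \<in> Hardy 2" "\<And>z. norm z = 1 \<Longrightarrow> F z = f z"
    using Fatou_H2b[OF Kb_H2b[OF f]] by blast
  obtain h where h: "h \<in> Hardy 2" "\<And>z. norm z = 1 \<Longrightarrow> h z = \<theta> z * cnj (z * f z)"
    using Fatou_H2b[of "\<lambda>z. \<theta> z * cnj (z * f z)"] f by (auto simp: Kb_def)
  have [measurable]: "h \<in> borel_measurable circle_measure"
    by (rule L2_measurable[OF H2b_L2[OF Hardy_imp_H2b[OF h(1)]]])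
  have "(\<lambda>z. cnj (z * h z)) \<in> Hardy_minus 2"
    unfolding Hardy_minus_def using h(1) by (intro CollectI conjI bexI[of _ h]) (auto simp del: complex_cnj_mult)
  moreover have "AE z in circle_measure. F z = \<theta> z * cnj (z * h z)"
    using \<theta>_cnj AE_space
  proof eventually_elim
    case (elim z)
    then have z: "norm z = 1" by simp
    have zz: "z * cnj z = 1" using z complex_norm_square[of z] by simp
    have "\<theta> z * cnj (z * h z) = (\<theta> z * cnj (\<theta> z)) * (z * cnj z) * f z"
      unfolding h(2)[OF z] by (simp add: mult_ac)
    then show ?case using zz elim(1) F(2)[OF z] by simp
  qed
  ultimately have "F \<in> model_space 2 \<theta>" using F(1) by (auto simp: model_space_def)
  then show ?thesis using F(2) by (rule that)
qed

text \<open>Being a \<open>SOME\<close> term, \<open>model_proj\<close> has its properties only once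
  a witness is known: the Hilbert space projection, replaced by its analytic extension.\<close>

lemma model_proj:
  assumes h: "h \<in> L2 circle_measure"
  shows "model_proj \<theta> h \<in> model_space 2 \<theta>"
    and "g \<in> model_space 2 \<theta> \<Longrightarrow> L2_ip circle_measure (model_proj \<theta> h) g = L2_ip circle_measure h g"
proof -
  let ?P = "\<lambda>k. k \<in> model_space 2 \<theta> \<and> (\<forall>g\<in>model_space 2 \<theta>. L2_inner (\<lambda>z. h z - k z) g = 0)"
  obtain k where k: "k \<in> Kb \<theta>" "\<And>v. v \<in> Kb \<theta> \<Longrightarrow> L2_ip circle_measure (\<lambda>z. h z - k z) v = 0"
    using projection_exists[OF orth_L2 h] unfolding Kb_annihilator by blast
  obtain K where K: "K \<in> model_space 2 \<theta>" "\<And>z. norm z = 1 \<Longrightarrow> K z = k z"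
    using Kb_imp_model_space[OF k(1)] by blast
  have "L2_ip circle_measure (\<lambda>z. h z - K z) g = L2_ip circle_measure (\<lambda>z. h z - k z) g" for g
    unfolding L2_ip_def by (rule Bochner_Integration.integral_cong) (auto simp: K(2))
  then have "?P K" using K(1) k(2) model_space_imp_Kb by (simp add: L2_inner_eq_ip)
  then have "?P (SOME k. ?P k)" by (rule someI[of ?P])
  then have P: "?P (model_proj \<theta> h)" unfolding model_proj_def by assumption
  then show mem: "model_proj \<theta> h \<in> model_space 2 \<theta>" by blast
  assume g: "g \<in> model_space 2 \<theta>"
  have "L2_ip circle_measure (\<lambda>z. h z - model_proj \<theta> h z) g = 0" using P g by (simp add: L2_inner_eq_ip)
  then show "L2_ip circle_measure (model_proj \<theta> h) g = L2_ip circle_measure h g"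
    using ip_diff_left[OF h Kb_L2[OF model_space_imp_Kb[OF mem]] Kb_L2[OF model_space_imp_Kb[OF g]]] by simp
qed

text \<open>Szego's factorization through the extremal problem of approximating \<open>1\<close> by \<open>z H\<^sup>2\<close> in
  \<open>L\<^sup>2(F dm)\<close>: the error \<open>p\<close> of the best approximation satisfies \<open>F * norm p ^ 2 = const\<close>, and
  \<open>F * p\<close> is the conjugate of an \<open>H\<^sup>2\<close> function \<open>h\<close>.\<close>

lemma Szego_factorization:
  fixes F :: "complex \<Rightarrow> real"
  assumes [measurable]: "F \<in> borel_measurable circle_measure"
    and \<delta>: "\<delta> > 0" and lower: "AE z in circle_measure. \<delta> \<le> F z" and upper: "AE z in circle_measure. F z \<le> C"
    and T: "(\<lambda>z. \<theta> z * cnj z * complex_of_real (F z)) \<in> H2b"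
  obtains h where "h \<in> Kb \<theta>" "AE z in circle_measure. (norm (h z))\<^sup>2 = F z"
proof -
  let ?m = circle_measure
  \<comment> \<open>Multiplication by \<open>w\<close>, the square root of \<open>F\<close>,
    identifies \<open>L^2(F dm)\<close> with \<open>L2\<close> of the circle; the bounds on
    \<open>F\<close> make \<open>w\<close> and its inverse \<open>wi\<close> bounded.\<close>
  define w where "w z = complex_of_real (sqrt (F z))" for z
  define wi where "wi z = complex_of_real (1 / sqrt (F z))" for z
  have [measurable]: "w \<in> borel_measurable ?m" "wi \<in> borel_measurable ?m" unfolding w_def wi_def by measurable
  have cnj_w: "cnj (w z) = w z" "cnj (wi z) = wi z" for z by (simp_all add: w_def wi_def)
  have w_bdd: "AE z in ?m. norm (w z) \<le> sqrt C"
    using upper lower by eventually_elim (use \<delta> in \<open>simp add: w_def\<close>)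
  have wi_bdd: "AE z in ?m. norm (wi z) \<le> 1 / sqrt \<delta>"
    using lower by eventually_elim (use \<delta> in \<open>auto simp: wi_def intro!: frac_le simp del: of_real_divide\<close>)
  have w_wi: "AE z in ?m. w z * wi z = 1"
    using lower by eventually_elim (use \<delta> in \<open>simp add: w_def wi_def of_real_mult[symmetric] del: of_real_mult\<close>)
  have w_w: "AE z in ?m. w z * w z = complex_of_real (F z)"
    using lower by eventually_elim (use \<delta> in \<open>simp add: w_def of_real_mult[symmetric] del: of_real_mult\<close>)
  have wL: "w \<in> L2 ?m" by (rule L2_circle_bounded[OF _ w_bdd]) simp
  have w_mult: "(\<lambda>z. w z * f z) \<in> L2 ?m" if "f \<in> L2 ?m" for f
    by (rule L2_mult_bounded(1)[OF that _ w_bdd]) simp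
  have wi_mult: "(\<lambda>z. wi z * f z) \<in> L2 ?m" if "f \<in> L2 ?m" for f
    by (rule L2_mult_bounded(1)[OF that _ wi_bdd]) simp
  \<comment> \<open>The annihilator of \<open>S\<close> consists of the products
    \<open>w * q\<close> with \<open>q\<close> in \<open>z H^2\<close>: the exponent 0 removes the
    constant term, the others the negative frequencies. Projecting \<open>w\<close> to it therefore
    solves the extremal problem.\<close>
  define S where "S = {(\<lambda>z. wi z * z powi (- k)) | k::int. k \<ge> 0}"
  have SL: "S \<subseteq> L2 ?m" unfolding S_def using wi_mult[OF L2_powi] by blast
  have ipS: "L2_ip ?m v (\<lambda>z. wi z * z powi (- k)) = (\<integral>z. wi z * v z * z powi k \<partial>?m)" for v k
    unfolding L2_ip_def by (rule Bochner_Integration.integral_cong) (auto simp: cnj_powi cnj_w mult_ac simp del: power_int_minus)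
  obtain v where v: "v \<in> annihilator ?m S"
    and orth_v: "\<And>u. u \<in> annihilator ?m S \<Longrightarrow> L2_ip ?m (\<lambda>z. w z - v z) u = 0"
    using projection_exists[OF SL wL] by blast
  have vL: "v \<in> L2 ?m" using v by (simp add: annihilator_def)
  note [measurable] = L2_measurable[OF vL]
  have v_zero: "(\<integral>z. wi z * v z * z powi k \<partial>?m) = 0" if "k \<ge> 0" for k
  proof -
    have "(\<lambda>z. wi z * z powi (- k)) \<in> S" using that unfolding S_def by blast
    then show ?thesis using v unfolding ipS[symmetric] annihilator_def by blast
  qed
  define p where "p z = wi z * (w z - v z)" for z
  have pL: "p \<in> L2 ?m" unfolding p_def by (intro wi_mult L2_diff wL vL)
  note [measurable] = L2_measurable[OF pL]
  have p_eq: "AE z in ?m. p z = 1 - wi z * v z"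
    using w_wi by eventually_elim (simp add: p_def right_diff_distrib mult.commute)
  have p_coeff: "(\<integral>z. p z * z powi k \<partial>?m) = (if k = 0 then 1 else 0)" if "k \<ge> 0" for k
  proof -
    have "(\<integral>z. p z * z powi k \<partial>?m) = (\<integral>z. z powi k - wi z * v z * z powi k \<partial>?m)"
    proof (rule integral_cong_AE)
      show "AE z in ?m. p z * z powi k = z powi k - wi z * v z * z powi k"
        using p_eq by eventually_elim (simp add: left_diff_distrib)
    qed measurable
    also have "\<dots> = (if k = 0 then 1 else 0)"
      using L2_circle_mult_powi[OF wi_mult[OF vL], of k] L2_powi[of k] v_zero[OF that]
      by (simp add: L2_circle_integrable integral_circle_powi)
    finally show ?thesis .
  qed
  have pH: "p \<in> H2b" using pL p_coeff by (simp add: H2b_def)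
  \<comment> \<open>Orthogonality of the error to \<open>z H^2\<close>, written in
    \<open>L^2(F dm)\<close>. It is used twice, with \<open>q = p * z^n\<close> and with
    \<open>q = z^k\<close>, for \<open>n\<close> and \<open>k\<close> at least 1.\<close>
  have orth_q: "(\<integral>z. complex_of_real (F z) * p z * cnj (q z) \<partial>?m) = 0"
    if q: "q \<in> L2 ?m" "\<And>k. k \<ge> 0 \<Longrightarrow> (\<integral>z. q z * z powi k \<partial>?m) = 0" for q
  proof -
    note [measurable] = L2_measurable[OF q(1)]
    have "(\<integral>z. wi z * (w z * q z) * z powi k \<partial>?m) = (\<integral>z. q z * z powi k \<partial>?m)" for k
    proof (rule integral_cong_AE)
      show "AE z in ?m. wi z * (w z * q z) * z powi k = q z * z powi k"
        using w_wi
      proof eventually_elim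
        case (elim z)
        have "wi z * (w z * q z) * z powi k = (w z * wi z) * (q z * z powi k)" by (simp only: mult_ac)
        then show ?case using elim by simp
      qed
    qed measurable
    then have "L2_ip ?m (\<lambda>z. w z * q z) (\<lambda>z. wi z * z powi (- k)) = 0" if "k \<ge> 0" for k
      unfolding ipS using q(2)[OF that] by simp
    then have "(\<lambda>z. w z * q z) \<in> annihilator ?m S"
      using w_mult[OF q(1)] unfolding annihilator_def S_def by auto
    then have "L2_ip ?m (\<lambda>z. w z - v z) (\<lambda>z. w z * q z) = 0" by (rule orth_v)
    moreover have "L2_ip ?m (\<lambda>z. w z - v z) (\<lambda>z. w z * q z) = (\<integral>z. complex_of_real (F z) * p z * cnj (q z) \<partial>?m)"
      unfolding L2_ip_def
    proof (rule integral_cong_AE)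
      show "AE z in ?m. (w z - v z) * cnj (w z * q z) = complex_of_real (F z) * p z * cnj (q z)"
        using w_wi w_w
      proof eventually_elim
        case (elim z)
        have "complex_of_real (F z) * p z * cnj (q z) = (w z * wi z) * (w z * ((w z - v z) * cnj (q z)))"
          unfolding p_def elim(2)[symmetric] by (simp only: mult_ac)
        then show ?case using elim(1) by (auto simp: cnj_w mult_ac)
      qed
    qed measurable
    ultimately show ?thesis by simp
  qed
  have F_bdd: "AE z in ?m. norm (complex_of_real (F z)) \<le> C"
    using lower upper by eventually_elim (use \<delta> in auto)
  have FpL: "(\<lambda>z. complex_of_real (F z) * p z) \<in> L2 ?m"
    by (rule L2_mult_bounded(1)[OF pL _ F_bdd]) simp
  define G where "G z = F z * (norm (p z))\<^sup>2" for z
  have G_eq: "complex_of_real (G z) = complex_of_real (F z) * p z * cnj (p z)" for z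
    by (simp add: G_def complex_norm_square[symmetric] mult.assoc)
  have Gi: "integrable ?m (\<lambda>z. complex_of_real (G z))"
    unfolding G_eq by (rule L2_mult_integrable[OF FpL L2_cnj[OF pL]])
  \<comment> \<open>Take \<open>q = p * z^n\<close>. Since \<open>G\<close> is real, the opposite
    coefficients vanish by conjugation, and only the mean of \<open>G\<close> survives.\<close>
  have G_neg: "(\<integral>z. complex_of_real (G z) * z powi (- n) \<partial>?m) = 0" if n: "n \<ge> 1" for n
  proof -
    have "(\<integral>z. complex_of_real (F z) * p z * cnj (p z * z powi n) \<partial>?m) = 0"
    proof (rule orth_q[OF L2_circle_mult_powi[OF pL]])
      fix k :: int assume k: "k \<ge> 0"
      have "(\<integral>z. p z * z powi n * z powi k \<partial>?m) = (\<integral>z. p z * z powi (n + k) \<partial>?m)"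
        by (rule Bochner_Integration.integral_cong) (auto simp: mult.assoc powi_add_circle)
      then show "(\<integral>z. p z * z powi n * z powi k \<partial>?m) = 0" using p_coeff[of "n + k"] n k by simp
    qed
    moreover have "(\<integral>z. complex_of_real (G z) * z powi (- n) \<partial>?m) = (\<integral>z. complex_of_real (F z) * p z * cnj (p z * z powi n) \<partial>?m)"
      by (rule Bochner_Integration.integral_cong) (auto simp: G_eq cnj_powi mult.assoc simp del: power_int_minus)
    ultimately show ?thesis by simp
  qed
  have G_pos: "(\<integral>z. complex_of_real (G z) * z powi n \<partial>?m) = 0" if n: "n \<ge> 1" for n
  proof -
    have "(\<integral>z. complex_of_real (G z) * z powi n \<partial>?m) = (\<integral>z. cnj (complex_of_real (G z) * z powi (- n)) \<partial>?m)"
      by (rule Bochner_Integration.integral_cong) (auto simp: cnj_powi simp del: power_int_minus)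
    also have "\<dots> = cnj (\<integral>z. complex_of_real (G z) * z powi (- n) \<partial>?m)" by (rule Bochner_Integration.integral_cnj)
    also have "\<dots> = 0" using G_neg[OF n] by simp
    finally show ?thesis .
  qed
  define c where "c = (\<integral>z. G z \<partial>?m)"
  have cG: "(\<integral>z. complex_of_real (G z) \<partial>?m) = complex_of_real c" unfolding c_def by (rule integral_complex_of_real)
  have "AE z in ?m. complex_of_real (G z) - complex_of_real c = 0"
  proof (rule Fourier_uniqueness)
    show "integrable ?m (\<lambda>z. complex_of_real (G z) - complex_of_real c)" using Gi by simp
    fix k :: int
    have "(\<integral>z. (complex_of_real (G z) - complex_of_real c) * z powi k \<partial>?m)
        = (\<integral>z. complex_of_real (G z) * z powi k \<partial>?m) - complex_of_real c * (\<integral>z. z powi k \<partial>?m)"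
      using integrable_mult_powi[OF Gi, of k] L2_circle_integrable[OF L2_powi[of k]] by (simp add: left_diff_distrib)
    also have "\<dots> = 0"
    proof -
      consider "k = 0" | "k \<ge> 1" | "- k \<ge> 1" by linarith
      then show ?thesis
      proof cases
        case 1 then show ?thesis using cG by (simp add: circle.prob_space[simplified])
      next
        case 2 then show ?thesis using G_pos[OF 2] by (simp add: integral_circle_powi)
      next
        case 3 then show ?thesis using G_neg[OF 3] by (simp add: integral_circle_powi)
      qed
    qed
    finally show "(\<integral>z. (complex_of_real (G z) - complex_of_real c) * z powi k \<partial>?m) = 0" .
  qed
  then have G_const: "AE z in ?m. G z = c" by eventually_elim simp
  \<comment> \<open>Otherwise \<open>p\<close> would be null, whereas its constant term is
    1.\<close>
  have "c \<noteq> 0"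
  proof
    assume "c = 0"
    have "AE z in ?m. p z = 0"
      using G_const lower by eventually_elim (use \<open>c = 0\<close> \<delta> in \<open>auto simp: G_def\<close>)
    then have "(\<integral>z. p z * z powi 0 \<partial>?m) = 0" by (intro integral_eq_zero_AE) auto
    then show False using p_coeff[of 0] by simp
  qed
  moreover have "c \<ge> 0" unfolding c_def
    using lower by (intro integral_nonneg_AE) (use \<delta> in \<open>auto simp: G_def elim!: eventually_mono\<close>)
  ultimately have c: "c > 0" by simp
  \<comment> \<open>Normalized so that \<open>norm h ^ 2 = F * G / c = F\<close>. The conjugate
    makes \<open>h\<close> analytic, as \<open>F * p\<close> is orthogonal to \<open>z^k\<close> for
    \<open>k \<ge> 1\<close>.\<close>
  define h where "h z = complex_of_real (1 / sqrt c) * cnj (complex_of_real (F z) * p z)" for z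
  have hL: "h \<in> L2 ?m" unfolding h_def by (intro L2_cmult L2_cnj FpL)
  note [measurable] = L2_measurable[OF hL]
  have "(\<integral>z. h z * z powi k \<partial>?m) = 0" if k: "k \<ge> 1" for k
  proof -
    have "(\<integral>z. complex_of_real (F z) * p z * cnj (z powi k) \<partial>?m) = 0"
    proof (rule orth_q[OF L2_powi])
      fix l :: int assume l: "l \<ge> 0"
      have "(\<integral>z. z powi k * z powi l \<partial>?m) = (\<integral>z. z powi (k + l) \<partial>?m)"
        by (rule Bochner_Integration.integral_cong) (auto simp: powi_add_circle)
      then show "(\<integral>z. z powi k * z powi l \<partial>?m) = 0" using k l by (simp add: integral_circle_powi)
    qed
    then have "cnj (\<integral>z. complex_of_real (F z) * p z * cnj (z powi k) \<partial>?m) = 0" by simp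
    then have "(\<integral>z. cnj (complex_of_real (F z) * p z * cnj (z powi k)) \<partial>?m) = 0"
      by (simp only: Bochner_Integration.integral_cnj)
    moreover have "(\<integral>z. h z * z powi k \<partial>?m)
        = complex_of_real (1 / sqrt c) * (\<integral>z. cnj (complex_of_real (F z) * p z * cnj (z powi k)) \<partial>?m)"
      unfolding h_def by (subst integral_mult_right_zero[symmetric]) (simp add: mult_ac)
    ultimately show ?thesis by simp
  qed
  then have hH: "h \<in> H2b" using hL by (simp add: H2b_def)
  have T_bdd: "AE z in ?m. norm (\<theta> z * cnj z * complex_of_real (F z)) \<le> C"
    using \<theta>_norm F_bdd AE_space by eventually_elim (simp add: norm_mult)
  \<comment> \<open>The twist of \<open>h\<close> is, up to a constant, the bounded function of
    hypothesis \<open>T\<close> times \<open>p\<close>, a product that stays in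
    \<open>H2b\<close>.\<close>
  have "(\<lambda>z. complex_of_real (1 / sqrt c) * (\<theta> z * cnj z * complex_of_real (F z) * p z)) \<in> H2b"
    by (intro H2b_cmult H2b_mult[OF T pH T_bdd])
  moreover have "complex_of_real (1 / sqrt c) * (\<theta> z * cnj z * complex_of_real (F z) * p z) = \<theta> z * cnj (z * h z)" for z
    by (simp add: h_def mult_ac)
  ultimately have "h \<in> Kb \<theta>" using hH by (simp add: Kb_def)
  moreover have "AE z in ?m. (norm (h z))\<^sup>2 = F z"
    using G_const
  proof eventually_elim
    case (elim z)
    have "(norm (h z))\<^sup>2 = F z * G z / c"
      using c by (simp add: h_def G_def norm_mult norm_divide power_mult_distrib power_divide power2_eq_square)
    then show ?case using elim c by simp
  qed
  ultimately show ?thesis by (rule that)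
qed

end

lemma inner_boundary_inner_function: "inner_function \<theta> \<Longrightarrow> inner_boundary \<theta>"
  by unfold_locales (auto simp: inner_function_H2b inner_function_def)

section \<open>Representing measures\<close>

lemma Lp_space_2: "Lp_space 2 = L2 circle_measure"
  by (simp add: Lp_space_def L2_def)

lemma Lp_norm_2: "Lp_norm M 2 f = sqrt (L2_sq M f)"
  by (simp add: Lp_norm_def L2_sq_def powr_half_sqrt)

definition bounded_ae :: "(complex \<Rightarrow> complex) \<Rightarrow> bool" where
  "bounded_ae f \<longleftrightarrow> (\<exists>C. AE z in circle_measure. norm (f z) \<le> C)"

lemma bounded_ae_continuous:
  assumes "continuous_on circle f" shows "bounded_ae f"
proof -
  obtain B where "\<And>z. z \<in> circle \<Longrightarrow> norm (f z) \<le> B"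
    by (fact continuous_on_circle_bounded[OF assms])
  then show ?thesis unfolding bounded_ae_def by (intro exI[of _ B] AE_I2) simp
qed

lemma integrable_continuous_circle:
  fixes f :: "complex \<Rightarrow> complex"
  assumes "finite_measure N" "sets N = sets circle_borel" "continuous_on circle f"
  shows "integrable N f"
proof -
  obtain B where B: "\<And>z. z \<in> circle \<Longrightarrow> norm (f z) \<le> B"
    by (fact continuous_on_circle_bounded[OF assms(3)])
  have sp: "space N = circle" using sets_eq_imp_space_eq[OF assms(2)] by (simp add: space_restrict_space)
  have "f \<in> borel_measurable N"
    using borel_measurable_continuous_on_restrict[OF assms(3)] by (simp add: measurable_cong_sets[OF assms(2) refl])
  then show ?thesis
    using B by (intro finite_measure.integrable_const_bound[OF assms(1), of _ B]) (auto simp: sp)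
qed

lemma bounded_ae_add_mult:
  assumes "bounded_ae f" "bounded_ae g" shows "bounded_ae (\<lambda>z. f z + c * g z)"
proof -
  obtain C D where "AE z in circle_measure. norm (f z) \<le> C" "AE z in circle_measure. norm (g z) \<le> D"
    using assms by (auto simp: bounded_ae_def)
  then have "AE z in circle_measure. norm (f z + c * g z) \<le> C + norm c * D"
    by eventually_elim (auto simp: norm_mult intro!: norm_triangle_le add_mono mult_left_mono)
  then show ?thesis by (auto simp: bounded_ae_def)
qed

lemma Re_Im_L2:
  assumes "\<phi> \<in> L2 M"
  shows "(\<lambda>z. complex_of_real (Re (\<phi> z))) \<in> L2 M" "(\<lambda>z. complex_of_real (Im (\<phi> z))) \<in> L2 M"
proof -
  note [measurable] = L2_measurable[OF assms]
  show "(\<lambda>z. complex_of_real (Re (\<phi> z))) \<in> L2 M" "(\<lambda>z. complex_of_real (Im (\<phi> z))) \<in> L2 M"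
    by (rule L2_bound[OF assms, where C = 1]; simp add: abs_Re_le_cmod abs_Im_le_cmod)+
qed

lemma finite_null_measure: "finite_measure (null_measure circle_borel)"
  by (rule finite_measureI) simp

lemma polarization:
  fixes a b :: complex
  shows "4 * (a * cnj b) = complex_of_real ((norm (a + b))\<^sup>2) - complex_of_real ((norm (a + (-1) * b))\<^sup>2)
    + \<i> * (complex_of_real ((norm (a + \<i> * b))\<^sup>2) - complex_of_real ((norm (a + (-\<i>) * b))\<^sup>2))"
  unfolding complex_norm_square by (simp add: algebra_simps)

text \<open>The weight \<open>\<psi>\<close> serves both sides of a later comparison: it is a real
  symbol on the circle and the constant 1 for a representing measure.\<close>

lemma integral_polarization:
  assumes f: "integrable M (\<lambda>z. complex_of_real (\<psi> z * (norm (f z + g z))\<^sup>2))"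
      "integrable M (\<lambda>z. complex_of_real (\<psi> z * (norm (f z + (-1) * g z))\<^sup>2))"
      "integrable M (\<lambda>z. complex_of_real (\<psi> z * (norm (f z + \<i> * g z))\<^sup>2))"
      "integrable M (\<lambda>z. complex_of_real (\<psi> z * (norm (f z + (-\<i>) * g z))\<^sup>2))"
  shows "4 * (\<integral>z. complex_of_real (\<psi> z) * (f z * cnj (g z)) \<partial>M) =
    complex_of_real (\<integral>z. \<psi> z * (norm (f z + g z))\<^sup>2 \<partial>M) - complex_of_real (\<integral>z. \<psi> z * (norm (f z + (-1) * g z))\<^sup>2 \<partial>M)
    + \<i> * (complex_of_real (\<integral>z. \<psi> z * (norm (f z + \<i> * g z))\<^sup>2 \<partial>M) - complex_of_real (\<integral>z. \<psi> z * (norm (f z + (-\<i>) * g z))\<^sup>2 \<partial>M))"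
proof -
  have "4 * (complex_of_real (\<psi> z) * (f z * cnj (g z))) =
      complex_of_real (\<psi> z * (norm (f z + g z))\<^sup>2) - complex_of_real (\<psi> z * (norm (f z + (-1) * g z))\<^sup>2)
      + \<i> * (complex_of_real (\<psi> z * (norm (f z + \<i> * g z))\<^sup>2) - complex_of_real (\<psi> z * (norm (f z + (-\<i>) * g z))\<^sup>2))" for z
  proof -
    have "4 * (complex_of_real (\<psi> z) * (f z * cnj (g z))) = complex_of_real (\<psi> z) * (4 * (f z * cnj (g z)))" by simp
    then show ?thesis unfolding polarization of_real_mult by (simp only: distrib_left right_diff_distrib mult_ac)
  qed
  then have "(\<integral>z. 4 * (complex_of_real (\<psi> z) * (f z * cnj (g z))) \<partial>M) =
      (\<integral>z. complex_of_real (\<psi> z * (norm (f z + g z))\<^sup>2) - complex_of_real (\<psi> z * (norm (f z + (-1) * g z))\<^sup>2)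
      + \<i> * (complex_of_real (\<psi> z * (norm (f z + \<i> * g z))\<^sup>2) - complex_of_real (\<psi> z * (norm (f z + (-\<i>) * g z))\<^sup>2)) \<partial>M)"
    by (simp only:)
  also have "\<dots> = ((\<integral>z. complex_of_real (\<psi> z * (norm (f z + g z))\<^sup>2) \<partial>M) - (\<integral>z. complex_of_real (\<psi> z * (norm (f z + (-1) * g z))\<^sup>2) \<partial>M))
      + \<i> * ((\<integral>z. complex_of_real (\<psi> z * (norm (f z + \<i> * g z))\<^sup>2) \<partial>M) - (\<integral>z. complex_of_real (\<psi> z * (norm (f z + (-\<i>) * g z))\<^sup>2) \<partial>M))"
    by (simp only: f Bochner_Integration.integral_add Bochner_Integration.integral_diff Bochner_Integration.integrable_diff
        integrable_mult_right integral_mult_right_zero)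
  finally show ?thesis unfolding integral_complex_of_real integral_mult_right_zero .
qed

section \<open>The positive functional and its representing measure\<close>

context inner_boundary
begin

definition real_symbols :: "(complex \<Rightarrow> real) set" where
  "real_symbols = {F \<in> borel_measurable circle_measure. (\<exists>C. AE z in circle_measure. \<bar>F z\<bar> \<le> C) \<and>
     (\<lambda>z. \<theta> z * cnj z * complex_of_real (F z)) \<in> H2b}"

lemma real_symbols_add:
  assumes "F \<in> real_symbols" "G \<in> real_symbols"
  shows "(\<lambda>z. F z + G z) \<in> real_symbols"
proof -
  obtain C D where "AE z in circle_measure. \<bar>F z\<bar> \<le> C" "AE z in circle_measure. \<bar>G z\<bar> \<le> D"
    using assms by (auto simp: real_symbols_def)
  then have "AE z in circle_measure. \<bar>F z + G z\<bar> \<le> C + D" by eventually_elim auto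
  moreover from assms have "(\<lambda>z. \<theta> z * cnj z * complex_of_real (F z) + \<theta> z * cnj z * complex_of_real (G z)) \<in> H2b"
    by (intro H2b_add) (auto simp: real_symbols_def)
  then have "(\<lambda>z. \<theta> z * cnj z * complex_of_real (F z + G z)) \<in> H2b" by (simp add: distrib_left)
  moreover have "(\<lambda>z. F z + G z) \<in> borel_measurable circle_measure"
    using assms by (intro borel_measurable_add) (simp_all add: real_symbols_def)
  ultimately show ?thesis unfolding real_symbols_def by (intro CollectI conjI exI[of _ "C + D"])
qed

lemma real_symbols_cmult:
  assumes "F \<in> real_symbols" shows "(\<lambda>z. c * F z) \<in> real_symbols"
proof -
  obtain C where "AE z in circle_measure. \<bar>F z\<bar> \<le> C" using assms by (auto simp: real_symbols_def)
  then have "AE z in circle_measure. \<bar>c * F z\<bar> \<le> \<bar>c\<bar> * C" by eventually_elim (auto simp: abs_mult intro: mult_left_mono)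
  moreover have "(\<lambda>z. complex_of_real c * (\<theta> z * cnj z * complex_of_real (F z))) \<in> H2b"
    using assms by (intro H2b_cmult) (auto simp: real_symbols_def)
  then have "(\<lambda>z. \<theta> z * cnj z * complex_of_real (c * F z)) \<in> H2b" by (simp add: mult_ac)
  moreover have "(\<lambda>z. c * F z) \<in> borel_measurable circle_measure"
    using assms by (intro borel_measurable_times borel_measurable_const) (simp add: real_symbols_def)
  ultimately show ?thesis unfolding real_symbols_def by (intro CollectI conjI exI[of _ "\<bar>c\<bar> * C"])
qed

text \<open>\<open>\<theta> * cnj z * norm h ^ 2\<close> factors into \<open>h\<close> and its
  twist, two functions of \<open>H2b\<close> of which the first is bounded.\<close>

lemma norm_sq_real_symbols:
  assumes h: "h \<in> Kb \<theta>" "bounded_ae h"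
  shows "(\<lambda>z. (norm (h z))\<^sup>2) \<in> real_symbols"
proof -
  obtain C where C: "AE z in circle_measure. norm (h z) \<le> C" using h(2) by (auto simp: bounded_ae_def)
  note [measurable] = L2_measurable[OF Kb_L2[OF h(1)]]
  have "AE z in circle_measure. \<bar>(norm (h z))\<^sup>2\<bar> \<le> C\<^sup>2"
    using C by eventually_elim (auto intro: power_mono)
  moreover have "(\<lambda>z. h z * (\<theta> z * cnj (z * h z))) \<in> H2b"
    using h(1) by (intro H2b_mult[OF _ _ C]) (auto simp: Kb_def)
  then have "(\<lambda>z. \<theta> z * cnj z * complex_of_real ((norm (h z))\<^sup>2)) \<in> H2b"
    unfolding complex_norm_square by (simp add: mult_ac)
  moreover have "(\<lambda>z. (norm (h z))\<^sup>2) \<in> borel_measurable circle_measure" by measurable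
  ultimately show ?thesis unfolding real_symbols_def by (intro CollectI conjI exI[of _ "C\<^sup>2"])
qed

lemma bounded_ae_of_norm_sq:
  assumes "F \<in> real_symbols" "AE z in circle_measure. (norm (h z))\<^sup>2 = F z"
  shows "bounded_ae h"
proof -
  obtain C where "AE z in circle_measure. \<bar>F z\<bar> \<le> C" using assms(1) by (auto simp: real_symbols_def)
  then have "AE z in circle_measure. norm (h z) \<le> sqrt C"
    using assms(2) by eventually_elim (auto simp: real_le_rsqrt)
  then show ?thesis by (auto simp: bounded_ae_def)
qed

text \<open>\<open>c\<close> is the mean of \<open>\<theta>\<close>, the value of its analytic
  extension at 0. The variance \<open>1 - norm c ^ 2\<close> shows that
  \<open>norm c \<ge> 1\<close> occurs only for constant \<open>\<theta>\<close>, and then all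
  Fourier coefficients of elements of the model space vanish. Otherwise the reproducing kernel at 0
  is bounded below by \<open>1 - norm c\<close>.\<close>

lemma Kb_trivial_or_lower_bound:
  shows "(\<forall>h\<in>Kb \<theta>. AE z in circle_measure. h z = 0) \<or>
    (\<exists>F0\<in>real_symbols. \<exists>\<delta>>0. AE z in circle_measure. \<delta> \<le> F0 z)"
proof -
  let ?m = circle_measure
  define c where "c = (\<integral>z. \<theta> z \<partial>?m)"
  have \<theta>L: "\<theta> \<in> L2 ?m" by (rule H2b_L2[OF \<theta>_H2b])
  have oneL: "(\<lambda>z. 1) \<in> L2 ?m" by (rule H2b_L2[OF const_H2b])
  have "L2_sq ?m \<theta> = (\<integral>z. 1 \<partial>?m)"
    unfolding L2_sq_def using \<theta>_norm by (intro integral_cong_AE) auto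
  then have "L2_sq ?m \<theta> = 1" using circle.prob_space by simp
  moreover have "L2_sq ?m (\<lambda>z. 1) = 1" using circle.prob_space by (simp add: L2_sq_def)
  moreover have "L2_ip ?m \<theta> (\<lambda>z. 1) = c" by (simp add: L2_ip_def c_def)
  moreover have "Re (cnj c * c) = (norm c)\<^sup>2" unfolding cmod_power2 by (simp add: power2_eq_square)
  ultimately have sq: "L2_sq ?m (\<lambda>z. \<theta> z - c) = 1 - (norm c)\<^sup>2"
    using L2_sq_diff_mult[OF \<theta>L oneL, of c] by simp
  show ?thesis
  proof (cases "norm c \<ge> 1")
    case True
    then have "(norm c)\<^sup>2 \<ge> 1" by (simp add: one_le_power)
    then have "L2_sq ?m (\<lambda>z. \<theta> z - c) = 0" using sq L2_sq_nonneg[of ?m "\<lambda>z. \<theta> z - c"] by simp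
    then have \<theta>c: "AE z in ?m. \<theta> z = c"
      using L2_diff[OF \<theta>L L2_cmult[OF oneL, of c]] by (simp add: L2_sq_zero_iff)
    have "AE z in ?m. h z = 0" if h: "h \<in> Kb \<theta>" for h
    proof (rule Fourier_uniqueness)
      note [measurable] = L2_measurable[OF Kb_L2[OF h]]
      show "integrable ?m h" by (intro L2_circle_integrable Kb_L2 h)
      fix k :: int
      show "(\<integral>z. h z * z powi k \<partial>?m) = 0"
      proof (cases "k \<ge> 1")
        case True
        then show ?thesis by (rule H2b_zero[OF Kb_H2b[OF h]])
      next
        case False
        have "(\<lambda>z. \<theta> z * z powi (- k)) \<in> orth" unfolding orth_def using False by force
        then have "L2_ip ?m h (\<lambda>z. \<theta> z * z powi (- k)) = 0"
          using h unfolding Kb_annihilator annihilator_def by blast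
        moreover have "L2_ip ?m h (\<lambda>z. \<theta> z * z powi (- k)) = (\<integral>z. cnj c * (h z * z powi k) \<partial>?m)"
          unfolding L2_ip_def
        proof (rule integral_cong_AE)
          show "AE z in ?m. h z * cnj (\<theta> z * z powi (- k)) = cnj c * (h z * z powi k)"
            using \<theta>c AE_space by eventually_elim (simp add: cnj_powi mult_ac del: power_int_minus)
        qed measurable
        ultimately show ?thesis using True by auto
      qed
    qed
    then show ?thesis by blast
  next
    case False
    define k0 where "k0 z = 1 - cnj c * \<theta> z" for z
    have k0H: "k0 \<in> H2b" unfolding k0_def using H2b_add[OF const_H2b[of 1] H2b_cmult[OF \<theta>_H2b, of "- cnj c"]] by simp
    note [measurable] = L2_measurable[OF H2b_L2[OF k0H]]
    \<comment> \<open>The twist of \<open>k0\<close> is \<open>(\<theta> - c) / z\<close>;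
      subtracting the mean is what keeps the division by \<open>z\<close> inside
      \<open>H2b\<close>.\<close>
    have tw: "AE z in ?m. (\<theta> z - c) * z powi (-1) = \<theta> z * cnj (z * k0 z)"
      using \<theta>_cnj AE_space
    proof eventually_elim
      case (elim z)
      have "\<theta> z * cnj (z * k0 z) = cnj z * (\<theta> z - c * (\<theta> z * cnj (\<theta> z)))"
        by (simp add: k0_def algebra_simps)
      then show ?case using elim by (auto simp: cnj_circle mult.commute)
    qed
    have "(\<lambda>z. (\<theta> z - c) * z powi (-1)) \<in> H2b"
    proof -
      have \<theta>cL: "(\<lambda>z. \<theta> z - c) \<in> L2 ?m" using L2_diff[OF \<theta>L L2_cmult[OF oneL, of c]] by simp
      have "(\<integral>z. (\<theta> z - c) * z powi (-1) * z powi k \<partial>?m) = 0" if k: "k \<ge> 1" for k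
      proof -
        have "(\<integral>z. (\<theta> z - c) * z powi (-1) * z powi k \<partial>?m) = (\<integral>z. \<theta> z * z powi (k - 1) - c * z powi (k - 1) \<partial>?m)"
        proof (rule Bochner_Integration.integral_cong[OF refl])
          fix z assume "z \<in> space ?m"
          then have "z powi (-1) * z powi k = z powi (k - 1)" using powi_add_circle[of z "-1" k] by simp
          then show "(\<theta> z - c) * z powi (-1) * z powi k = \<theta> z * z powi (k - 1) - c * z powi (k - 1)"
            by (simp only: mult.assoc left_diff_distrib)
        qed
        also have "\<dots> = (\<integral>z. \<theta> z * z powi (k - 1) \<partial>?m) - c * (\<integral>z. z powi (k - 1) \<partial>?m)"
          using L2_circle_integrable[OF \<theta>_powi_L2] L2_circle_integrable[OF L2_powi] by simp
        also have "\<dots> = 0"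
        proof (cases "k = 1")
          case False
          then show ?thesis using k H2b_zero[OF \<theta>_H2b, of "k - 1"] by (simp add: integral_circle_powi)
        qed (simp add: c_def circle.prob_space[simplified])
        finally show ?thesis .
      qed
      then show ?thesis using L2_circle_mult_powi[OF \<theta>cL, of "-1"] by (simp add: H2b_def)
    qed
    from H2b_AE_cong[OF this _ tw] have k0: "k0 \<in> Kb \<theta>"
      using k0H L2_measurable[OF twist_L2[OF H2b_L2[OF k0H]]] by (simp add: Kb_def)
    have "AE z in ?m. norm (k0 z) \<le> 1 + norm c"
      using \<theta>_norm
    proof eventually_elim
      case (elim z)
      then show ?case using norm_triangle_ineq4[of 1 "cnj c * \<theta> z"] by (simp add: k0_def norm_mult)
    qed
    then have "bounded_ae k0" by (auto simp: bounded_ae_def)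
    then have "(\<lambda>z. (norm (k0 z))\<^sup>2) \<in> real_symbols" by (rule norm_sq_real_symbols[OF k0])
    moreover have "AE z in ?m. (1 - norm c)\<^sup>2 \<le> (norm (k0 z))\<^sup>2"
      using \<theta>_norm
    proof eventually_elim
      case (elim z)
      then have "1 - norm c \<le> norm (k0 z)"
        using norm_triangle_ineq2[of 1 "cnj c * \<theta> z"] by (simp add: k0_def norm_mult)
      then show ?case using False by (intro power_mono) auto
    qed
    moreover have "(1 - norm c)\<^sup>2 > 0" using False by simp
    ultimately show ?thesis
      by (intro disjI2 bexI[of _ "\<lambda>z. (norm (k0 z))\<^sup>2"] exI[of _ "(1 - norm c)\<^sup>2"] conjI)
  qed
qed

lemma symbol_integrable:
  assumes \<psi>: "(\<lambda>z. complex_of_real (\<psi> z)) \<in> L2 circle_measure" and F: "F \<in> real_symbols"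
  shows "integrable circle_measure (\<lambda>z. \<psi> z * F z)"
proof -
  obtain C where C: "AE z in circle_measure. \<bar>F z\<bar> \<le> C" using F by (auto simp: real_symbols_def)
  have "integrable circle_measure (\<lambda>z. complex_of_real (\<psi> z) * complex_of_real (F z))"
    using F C by (intro integrable_mult_bounded(1)[OF L2_circle_integrable[OF \<psi>], where C = C])
      (auto simp: real_symbols_def)
  from integrable_Re[OF this] show ?thesis by simp
qed

text \<open>Positivity on functions bounded below suffices by adding \<open>\<epsilon> * F0\<close>, and these are
  squares \<open>norm h ^ 2\<close> by Szego's factorization.\<close>

lemma symbol_functional_nonneg:
  assumes \<psi>: "(\<lambda>z. complex_of_real (\<psi> z)) \<in> L2 circle_measure"
    and pos: "\<And>h. h \<in> Kb \<theta> \<Longrightarrow> bounded_ae h \<Longrightarrow> 0 \<le> (\<integral>z. \<psi> z * (norm (h z))\<^sup>2 \<partial>circle_measure)"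
    and F0: "F0 \<in> real_symbols" "\<delta> > 0" "AE z in circle_measure. \<delta> \<le> F0 z"
    and F: "F \<in> real_symbols" "AE z in circle_measure. 0 \<le> F z"
  shows "0 \<le> (\<integral>z. \<psi> z * F z \<partial>circle_measure)"
proof (rule field_le_epsilon)
  let ?m = circle_measure
  define I where "I = (\<integral>z. \<psi> z * F0 z \<partial>?m)"
  fix e :: real assume e: "e > 0"
  \<comment> \<open>The correction \<open>\<epsilon> * I\<close> is at most \<open>e\<close>; the
    added 1 covers \<open>I = 0\<close>.\<close>
  define \<epsilon> where "\<epsilon> = e / (\<bar>I\<bar> + 1)"
  have \<epsilon>: "\<epsilon> > 0" using e by (simp add: \<epsilon>_def add_nonneg_pos)
  define G where "G z = F z + \<epsilon> * F0 z" for z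
  have G: "G \<in> real_symbols" unfolding G_def by (intro real_symbols_add F real_symbols_cmult F0)
  obtain C where C: "AE z in ?m. \<bar>G z\<bar> \<le> C" using G by (auto simp: real_symbols_def)
  note [measurable] = L2_measurable[OF \<psi>]
  have [measurable]: "\<psi> \<in> borel_measurable ?m"
  proof -
    have "(\<lambda>z. Re (complex_of_real (\<psi> z))) \<in> borel_measurable ?m" by measurable
    then show ?thesis by simp
  qed
  obtain h where h: "h \<in> Kb \<theta>" "AE z in ?m. (norm (h z))\<^sup>2 = G z"
  proof (rule Szego_factorization)
    show "G \<in> borel_measurable ?m" using G by (simp add: real_symbols_def)
    show "\<epsilon> * \<delta> > 0" using \<epsilon> F0 by simp
    show "AE z in ?m. \<epsilon> * \<delta> \<le> G z"
      using F(2) F0(3) by eventually_elim (use \<epsilon> in \<open>auto simp: G_def intro: add_increasing mult_left_mono\<close>)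
    show "AE z in ?m. G z \<le> C" using C by eventually_elim simp
    show "(\<lambda>z. \<theta> z * cnj z * complex_of_real (G z)) \<in> H2b" using G by (simp add: real_symbols_def)
  qed
  have [measurable]: "h \<in> borel_measurable ?m" "G \<in> borel_measurable ?m"
    using L2_measurable[OF Kb_L2[OF h(1)]] G by (auto simp: real_symbols_def)
  have "0 \<le> (\<integral>z. \<psi> z * (norm (h z))\<^sup>2 \<partial>?m)" by (rule pos[OF h(1) bounded_ae_of_norm_sq[OF G h(2)]])
  also have "\<dots> = (\<integral>z. \<psi> z * G z \<partial>?m)"
    using h(2) by (intro integral_cong_AE) auto
  also have "\<dots> = (\<integral>z. \<psi> z * F z + \<epsilon> * (\<psi> z * F0 z) \<partial>?m)"
    by (simp add: G_def algebra_simps)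
  also have "\<dots> = (\<integral>z. \<psi> z * F z \<partial>?m) + \<epsilon> * I"
    using symbol_integrable[OF \<psi> F(1)] symbol_integrable[OF \<psi> F0(1)] by (simp add: I_def)
  also have "\<epsilon> * I \<le> e"
  proof -
    have "\<epsilon> * I \<le> \<epsilon> * (\<bar>I\<bar> + 1)" using \<epsilon> by (intro mult_left_mono) auto
    also have "\<dots> = e" by (simp add: \<epsilon>_def add_nonneg_eq_0_iff)
    finally show ?thesis .
  qed
  finally show "0 \<le> (\<integral>z. \<psi> z * F z \<partial>?m) + e" by simp
qed

text \<open>The measure is built on the parameter interval, where weak limits on the real line are
  available, and pushed to the circle by \<open>cis\<close>, which merges the end points 0 and
  \<open>2 * pi\<close>. It is tested on squares only; polarization supplies the rest.\<close>

lemma representing_measure: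
  assumes \<psi>: "(\<lambda>z. complex_of_real (\<psi> z)) \<in> L2 circle_measure"
    and pos: "\<And>h. h \<in> Kb \<theta> \<Longrightarrow> bounded_ae h \<Longrightarrow> 0 \<le> (\<integral>z. \<psi> z * (norm (h z))\<^sup>2 \<partial>circle_measure)"
  obtains N where "finite_measure N" "sets N = sets circle_borel"
    "\<And>h. h \<in> Kb \<theta> \<Longrightarrow> continuous_on circle h \<Longrightarrow>
      (\<integral>z. (norm (h z))\<^sup>2 \<partial>N) = (\<integral>z. \<psi> z * (norm (h z))\<^sup>2 \<partial>circle_measure)"
proof -
  let ?m = circle_measure
  from Kb_trivial_or_lower_bound show ?thesis
  proof
    assume trivial: "\<forall>h\<in>Kb \<theta>. AE z in ?m. h z = 0"
    show ?thesis
    proof (rule that[of "null_measure circle_borel"])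
      fix h assume "h \<in> Kb \<theta>"
      then have "AE z in ?m. \<psi> z * (norm (h z))\<^sup>2 = 0" using trivial by (auto elim: eventually_mono)
      then have "(\<integral>z. \<psi> z * (norm (h z))\<^sup>2 \<partial>?m) = 0" by (rule integral_eq_zero_AE)
      then show "(\<integral>z. (norm (h z))\<^sup>2 \<partial>null_measure circle_borel) = (\<integral>z. \<psi> z * (norm (h z))\<^sup>2 \<partial>?m)" by simp
    qed (auto intro!: finite_measureI)
  next
    assume "\<exists>F0\<in>real_symbols. \<exists>\<delta>>0. AE z in ?m. \<delta> \<le> F0 z"
    then obtain F0 \<delta> where F0: "F0 \<in> real_symbols" "\<delta> > 0" "AE z in ?m. \<delta> \<le> F0 z" by blast
    define L where "L F = (\<integral>z. \<psi> z * F z \<partial>?m)" for F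
    have L_add: "L (\<lambda>z. F z + G z) = L F + L G" if "F \<in> real_symbols" "G \<in> real_symbols" for F G
      unfolding L_def using that by (simp add: distrib_left symbol_integrable[OF \<psi>])
    have L_cmult: "L (\<lambda>z. c * F z) = c * L F" for c F
      unfolding L_def by (simp add: mult.left_commute)
    have L_nonneg: "0 \<le> L F" if "F \<in> real_symbols" "AE z in ?m. 0 \<le> F z" for F
      unfolding L_def by (rule symbol_functional_nonneg[OF \<psi> pos F0 that])
    \<comment> \<open>The admissible majorants of \<open>u\<close>. The comparison is almost
      everywhere, since admissible functions matter only up to null sets, and on one period, since
      \<open>u\<close> may be non-periodic.\<close>
    define D where "D u = {F \<in> real_symbols. AE t in lborel. t \<in> {0..<2 * pi} \<longrightarrow> apply_bcontfun u t \<le> F (cis t)}"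
      for u :: "real \<Rightarrow>\<^sub>C real"
    define p where "p u = Inf (L ` D u)" for u
    \<comment> \<open>\<open>F0\<close> makes \<open>p\<close> finite: a multiple of it majorizes
      \<open>u\<close>, so \<open>D u\<close> is nonempty, and by positivity the same multiple
      yields a lower bound for \<open>L\<close> on \<open>D u\<close>.\<close>
    have big: "(\<lambda>z. norm u / \<delta> * F0 z) \<in> real_symbols"
      "AE z in ?m. norm u \<le> norm u / \<delta> * F0 z" for u :: "real \<Rightarrow>\<^sub>C real"
    proof -
      show "(\<lambda>z. norm u / \<delta> * F0 z) \<in> real_symbols" by (intro real_symbols_cmult F0)
      show "AE z in ?m. norm u \<le> norm u / \<delta> * F0 z"
        using F0(3)
      proof eventually_elim
        case (elim z)
        have "norm u / \<delta> * \<delta> \<le> norm u / \<delta> * F0 z" using elim F0(2) by (intro mult_left_mono) auto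
        then show ?case using F0(2) by simp
      qed
    qed
    have abs_u: "\<bar>apply_bcontfun u t\<bar> \<le> norm u" for u :: "real \<Rightarrow>\<^sub>C real" and t
      using norm_bounded[of u t] by simp
    have D_ne: "D u \<noteq> {}" for u
    proof -
      have "(\<lambda>z. norm u / \<delta> * F0 z) \<in> D u"
        unfolding D_def using big(1)[of u] AE_circle_measureD[OF big(2)[of u]]
        by (auto elim!: eventually_mono intro: order_trans[OF order_trans[OF abs_ge_self abs_u]])
      then show ?thesis by blast
    qed
    have D_lower: "- L (\<lambda>z. norm u / \<delta> * F0 z) \<le> L F" if F: "F \<in> D u" for F u
    proof -
      have "AE z in ?m. - norm u \<le> F z"
      proof (rule AE_circle_measureI)
        have "AE t in lborel. t \<in> {0..<2 * pi} \<longrightarrow> apply_bcontfun u t \<le> F (cis t)" using F by (simp add: D_def)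
        then show "AE t in lborel. t \<in> {0..<2 * pi} \<longrightarrow> - norm u \<le> F (cis t)"
        proof eventually_elim
          case (elim t)
          then show ?case using abs_u[of u t] by auto
        qed
      qed
      with big(2)[of u] have "AE z in ?m. 0 \<le> F z + norm u / \<delta> * F0 z" by eventually_elim simp
      then have "0 \<le> L (\<lambda>z. F z + norm u / \<delta> * F0 z)"
        using F big(1) by (intro L_nonneg real_symbols_add) (auto simp: D_def)
      then show ?thesis using F L_add[OF _ big(1)] by (auto simp: D_def)
    qed
    have bdd: "bdd_below (L ` D u)" for u using D_lower by (intro bdd_belowI2) auto
    have p_le: "p u \<le> L F" if "F \<in> D u" for u F
      unfolding p_def using that by (intro cINF_lower bdd)
    have "sublinear p"
      unfolding sublinear_def
    proof (intro conjI allI impI)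
      fix u v :: "real \<Rightarrow>\<^sub>C real"
      have *: "p (u + v) \<le> L F + L G" if "F \<in> D u" "G \<in> D v" for F G
      proof -
        have "AE t in lborel. t \<in> {0..<2 * pi} \<longrightarrow> apply_bcontfun u t \<le> F (cis t)"
          "AE t in lborel. t \<in> {0..<2 * pi} \<longrightarrow> apply_bcontfun v t \<le> G (cis t)"
          using that by (auto simp: D_def)
        then have "AE t in lborel. t \<in> {0..<2 * pi} \<longrightarrow> apply_bcontfun (u + v) t \<le> F (cis t) + G (cis t)"
          by eventually_elim (auto simp: plus_bcontfun.rep_eq)
        then have "(\<lambda>z. F z + G z) \<in> D (u + v)" using that by (simp add: D_def real_symbols_add)
        then show ?thesis using p_le[of "\<lambda>z. F z + G z"] L_add that by (simp add: D_def)
      qed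
      have "p (u + v) - L G \<le> p u" if "G \<in> D v" for G
        unfolding p_def[of u] using *[OF _ that] by (intro cINF_greatest D_ne) (auto simp: algebra_simps)
      then have "p (u + v) - p u \<le> p v"
        unfolding p_def[of v] by (intro cINF_greatest D_ne) (auto simp: algebra_simps)
      then show "p (u + v) \<le> p u + p v" by simp
    next
      fix c :: real and u :: "real \<Rightarrow>\<^sub>C real" assume c: "c > 0"
      have "p (c *\<^sub>R u) / c \<le> p u"
        unfolding p_def[of u]
      proof (rule cINF_greatest[OF D_ne])
        fix F assume F: "F \<in> D u"
        then have "AE t in lborel. t \<in> {0..<2 * pi} \<longrightarrow> apply_bcontfun u t \<le> F (cis t)" by (simp add: D_def)
        then have "AE t in lborel. t \<in> {0..<2 * pi} \<longrightarrow> apply_bcontfun (c *\<^sub>R u) t \<le> c * F (cis t)"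
          by eventually_elim (use c in \<open>auto simp: scaleR_bcontfun.rep_eq\<close>)
        then have "(\<lambda>z. c * F z) \<in> D (c *\<^sub>R u)" using F by (simp add: D_def real_symbols_cmult)
        then have "p (c *\<^sub>R u) \<le> c * L F" using p_le L_cmult by metis
        then show "p (c *\<^sub>R u) / c \<le> L F" using c by (simp add: field_simps)
      qed
      then show "p (c *\<^sub>R u) \<le> c * p u" using c by (simp add: field_simps)
    qed
    then obtain l where l: "linear l" "\<And>u. l u \<le> p u" by (rule Hahn_Banach_sublinear) blast
    have l_le: "l u \<le> L F" if "F \<in> D u" for u F using l(2)[of u] p_le[OF that] by simp
    have zero: "(\<lambda>z. 0) \<in> real_symbols" using real_symbols_cmult[OF F0(1), of 0] by simp
    obtain \<nu> :: "real measure" where \<nu>: "finite_measure \<nu>" "sets \<nu> = sets borel"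
      "\<And>u. (\<integral>t. apply_bcontfun u t \<partial>\<nu>) = l u"
    proof (rule positive_functional_measure[OF _ l(1), of 0 "2 * pi"])
      fix u :: "real \<Rightarrow>\<^sub>C real" assume "\<And>t. t \<in> {0..2 * pi} \<Longrightarrow> apply_bcontfun u t \<le> 0"
      \<comment> \<open>The zero function majorizes \<open>u\<close> on the interval, hence
        \<open>l u \<le> p u \<le> L 0 = 0\<close>: domination by \<open>p\<close> already contains
        positivity.\<close>
      then have "(\<lambda>z. 0) \<in> D u" using zero by (simp add: D_def)
      from l_le[OF this] show "l u \<le> 0" by (simp add: L_def)
    qed auto
    have cis_meas: "cis \<in> measurable \<nu> circle_borel"
      using cis_measurable_circle by (simp add: measurable_cong_sets[OF \<nu>(2) refl])
    show ?thesis
    proof (rule that[of "distr \<nu> circle_borel cis"])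
      show "finite_measure (distr \<nu> circle_borel cis)"
        by (rule finite_measure.finite_measure_distr[OF \<nu>(1) cis_meas])
      show "sets (distr \<nu> circle_borel cis) = sets circle_borel" by simp
      fix h assume h: "h \<in> Kb \<theta>" and cont: "continuous_on circle h"
      obtain B where B: "\<And>z. z \<in> circle \<Longrightarrow> norm (h z) \<le> B"
        by (fact continuous_on_circle_bounded[OF cont])
      define u where "u = Bcontfun (\<lambda>t. (norm (h (cis t)))\<^sup>2)"
      have u: "apply_bcontfun u t = (norm (h (cis t)))\<^sup>2" for t
      proof -
        have "continuous_on UNIV (\<lambda>t. (norm (h (cis t)))\<^sup>2)"
          by (intro continuous_intros continuous_on_compose2[OF cont]) auto
        moreover have "norm ((norm (h (cis t)))\<^sup>2) \<le> B\<^sup>2" for t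
          using power_mono[OF B norm_ge_zero, of "cis t" 2] by simp
        ultimately have "(\<lambda>t. (norm (h (cis t)))\<^sup>2) \<in> bcontfun" by (rule bcontfun_normI)
        then show ?thesis by (simp add: u_def Bcontfun_inverse)
      qed
      have F: "(\<lambda>z. (norm (h z))\<^sup>2) \<in> real_symbols"
        by (rule norm_sq_real_symbols[OF h bounded_ae_continuous[OF cont]])
      \<comment> \<open>\<open>norm h ^ 2\<close> is an admissible majorant of \<open>u\<close>, and
        its negative is one of \<open>- u\<close>; the two inequalities pin down
        \<open>l u\<close>.\<close>
      have "(\<lambda>z. (norm (h z))\<^sup>2) \<in> D u" using F by (simp add: D_def u)
      from l_le[OF this] have le: "l u \<le> L (\<lambda>z. (norm (h z))\<^sup>2)" .
      have "(\<lambda>z. (-1) * (norm (h z))\<^sup>2) \<in> D (- u)"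
        using real_symbols_cmult[OF F, of "-1"] by (simp add: D_def u uminus_bcontfun.rep_eq)
      from l_le[OF this] have "l (- u) \<le> - L (\<lambda>z. (norm (h z))\<^sup>2)" unfolding L_cmult by simp
      then have lu: "l u = L (\<lambda>z. (norm (h z))\<^sup>2)" using le linear_neg[OF l(1), of u] by simp
      have "(\<lambda>z. (norm (h z))\<^sup>2) \<in> borel_measurable circle_borel"
        by (intro borel_measurable_continuous_on_restrict continuous_intros cont)
      then have "(\<integral>z. (norm (h z))\<^sup>2 \<partial>distr \<nu> circle_borel cis) = (\<integral>t. (norm (h (cis t)))\<^sup>2 \<partial>\<nu>)"
        by (rule integral_distr[OF cis_meas])
      also have "\<dots> = l u" using \<nu>(3)[of u] by (simp add: u)
      finally show "(\<integral>z. (norm (h z))\<^sup>2 \<partial>distr \<nu> circle_borel cis) = (\<integral>z. \<psi> z * (norm (h z))\<^sup>2 \<partial>?m)"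
        by (simp add: lu L_def)
    qed
  qed
qed

section \<open>From the measure to the quasisymbol\<close>

lemma symbol_norm_sq_integrable:
  assumes \<psi>: "(\<lambda>z. complex_of_real (\<psi> z)) \<in> L2 circle_measure" and h: "h \<in> Kb \<theta>" "bounded_ae h"
  shows "integrable circle_measure (\<lambda>z. complex_of_real (\<psi> z * (norm (h z))\<^sup>2))"
  by (intro integrable_of_real symbol_integrable[OF \<psi> norm_sq_real_symbols[OF h]])

text \<open>Meant for the imaginary part of the symbol of a nonnegative operator, whose quadratic
  form vanishes because \<open>(A h, h)\<close> is real.\<close>

lemma polarize_symbol:
  assumes \<psi>: "(\<lambda>z. complex_of_real (\<psi> z)) \<in> L2 circle_measure"
    and f: "f \<in> Kb \<theta>" "bounded_ae f" and g: "g \<in> Kb \<theta>" "bounded_ae g"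
    and zero: "\<And>h. h \<in> Kb \<theta> \<Longrightarrow> bounded_ae h \<Longrightarrow> (\<integral>z. \<psi> z * (norm (h z))\<^sup>2 \<partial>circle_measure) = 0"
  shows "(\<integral>z. complex_of_real (\<psi> z) * (f z * cnj (g z)) \<partial>circle_measure) = 0"
proof -
  have fg: "(\<lambda>z. f z + c * g z) \<in> Kb \<theta>" "bounded_ae (\<lambda>z. f z + c * g z)" for c
    using Kb_add_mult[OF f(1) g(1)] bounded_ae_add_mult[OF f(2) g(2)] by auto
  note i = symbol_norm_sq_integrable[OF \<psi> fg] and z = zero[OF fg]
  show ?thesis
    using integral_polarization[of circle_measure \<psi> f g, OF i[of 1, simplified mult_1] i[of "-1"] i[of "\<i>"] i[of "-\<i>"]]
    by (simp only: z[of 1, simplified mult_1] z) simp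
qed

text \<open>The four combinations \<open>f + c * g\<close> are again continuous elements of
  \<open>Kb \<theta>\<close>, so the identity for squares applies to each of them.\<close>

lemma polarize_measure:
  assumes \<psi>: "(\<lambda>z. complex_of_real (\<psi> z)) \<in> L2 circle_measure"
    and N: "finite_measure N" "sets N = sets circle_borel"
    and eq: "\<And>h. h \<in> Kb \<theta> \<Longrightarrow> continuous_on circle h \<Longrightarrow>
      (\<integral>z. (norm (h z))\<^sup>2 \<partial>N) = (\<integral>z. \<psi> z * (norm (h z))\<^sup>2 \<partial>circle_measure)"
    and f: "f \<in> Kb \<theta>" "continuous_on circle f" and g: "g \<in> Kb \<theta>" "continuous_on circle g"
  shows "(\<integral>z. f z * cnj (g z) \<partial>N) = (\<integral>z. complex_of_real (\<psi> z) * (f z * cnj (g z)) \<partial>circle_measure)"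
proof -
  have fg: "(\<lambda>z. f z + c * g z) \<in> Kb \<theta>" "continuous_on circle (\<lambda>z. f z + c * g z)" for c
    using Kb_add_mult[OF f(1) g(1)] by (auto intro!: continuous_intros f g)
  note i = symbol_norm_sq_integrable[OF \<psi> fg(1) bounded_ae_continuous[OF fg(2)]]
  have j: "integrable N (\<lambda>z. complex_of_real (1 * (norm (f z + c * g z))\<^sup>2))" for c
    by (intro integrable_continuous_circle[OF N] continuous_intros f(2) g(2))
  note e = eq[OF fg]
  have "4 * (\<integral>z. complex_of_real 1 * (f z * cnj (g z)) \<partial>N) = 4 * (\<integral>z. complex_of_real (\<psi> z) * (f z * cnj (g z)) \<partial>circle_measure)"
    unfolding integral_polarization[of circle_measure \<psi> f g, OF i[of 1, simplified mult_1] i[of "-1"] i[of "\<i>"] i[of "-\<i>"]]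
      integral_polarization[of N "\<lambda>_. 1" f g, OF j[of 1, simplified mult_1[of "g _"]] j[of "-1"] j[of "\<i>"] j[of "-\<i>"]]
    by (simp only: mult_1 e[of 1, simplified mult_1] e)
  then show ?thesis by simp
qed

text \<open>Extracts what is used of \<open>A\<close> later, its sesquilinear form. The formula with
  \<open>\<phi>\<close> is confined to bounded \<open>f\<close>, on which the symbol acts; the
  estimate comes from Cauchy-Schwarz and holds on the whole space.\<close>

lemma bounded_TTO_symbol:
  assumes "bounded_TTO \<theta> A"
  obtains \<phi> K where "\<phi> \<in> L2 circle_measure" "0 \<le> K"
    "\<And>f g. f \<in> model_space 2 \<theta> \<Longrightarrow> bounded_ae f \<Longrightarrow> g \<in> model_space 2 \<theta> \<Longrightarrow>
      L2_inner (A f) g = (\<integral>z. \<phi> z * (f z * cnj (g z)) \<partial>circle_measure)"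
    "\<And>f. f \<in> model_space 2 \<theta> \<Longrightarrow> norm (L2_inner (A f) f) \<le> K * L2_sq circle_measure f"
proof -
  let ?m = circle_measure
  obtain \<phi> where \<phi>: "\<phi> \<in> L2 ?m"
    "\<And>f. f \<in> model_space 2 \<theta> \<Longrightarrow> f \<in> Linf_space \<Longrightarrow> AE z in ?m. A f z = model_proj \<theta> (\<lambda>w. \<phi> w * f w) z"
    using assms by (auto simp: bounded_TTO_def Lp_space_2)
  have A: "\<And>f. f \<in> model_space 2 \<theta> \<Longrightarrow> A f \<in> model_space 2 \<theta>"
    using assms by (simp add: bounded_TTO_def bounded_operator_on_model_space_def)
  obtain C where C: "\<And>f. f \<in> model_space 2 \<theta> \<Longrightarrow> sqrt (L2_sq ?m (A f)) \<le> C * sqrt (L2_sq ?m f)"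
    using assms unfolding bounded_TTO_def bounded_operator_on_model_space_def Lp_norm_2 by blast
  have mL: "f \<in> L2 ?m" if "f \<in> model_space 2 \<theta>" for f by (intro Kb_L2 model_space_imp_Kb that)
  show ?thesis
  \<comment> \<open>\<open>C\<close> may be negative when all norms are 0, so its absolute value
    serves as \<open>K\<close>.\<close>
  proof (rule that[OF \<phi>(1) abs_ge_zero[of C]])
    fix f g assume f: "f \<in> model_space 2 \<theta>" "bounded_ae f" and g: "g \<in> model_space 2 \<theta>"
    have fm: "f \<in> borel_measurable ?m" by (rule L2_measurable[OF mL[OF f(1)]])
    then have "f \<in> Linf_space" using f(2) by (simp add: Linf_space_def bounded_ae_def)
    note AE = \<phi>(2)[OF f(1) this]
    have \<phi>f: "(\<lambda>w. \<phi> w * f w) \<in> L2 ?m"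
      using f(2) L2_mult_bounded(2)[OF \<phi>(1) fm] by (auto simp: bounded_ae_def)
    have "L2_inner (A f) g = L2_ip ?m (model_proj \<theta> (\<lambda>w. \<phi> w * f w)) g"
      unfolding L2_inner_eq_ip using AE
      by (intro ip_AE_cong L2_measurable mL A f g model_proj(1)[OF \<phi>f]) auto
    also have "\<dots> = L2_ip ?m (\<lambda>w. \<phi> w * f w) g" by (rule model_proj(2)[OF \<phi>f g])
    finally show "L2_inner (A f) g = (\<integral>z. \<phi> z * (f z * cnj (g z)) \<partial>?m)" by (simp add: L2_ip_def mult.assoc)
  next
    fix f assume f: "f \<in> model_space 2 \<theta>"
    have "sqrt (L2_sq ?m (A f)) \<le> \<bar>C\<bar> * sqrt (L2_sq ?m f)"
      using C[OF f] mult_right_mono[OF abs_ge_self[of C], of "sqrt (L2_sq ?m f)"] by (simp add: L2_sq_nonneg)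
    then have "(sqrt (L2_sq ?m (A f)))\<^sup>2 \<le> (\<bar>C\<bar> * sqrt (L2_sq ?m f))\<^sup>2"
      by (rule power_mono) (simp add: L2_sq_nonneg)
    then have sq: "L2_sq ?m (A f) \<le> \<bar>C\<bar>\<^sup>2 * L2_sq ?m f" by (simp add: power_mult_distrib L2_sq_nonneg)
    have "(norm (L2_inner (A f) f))\<^sup>2 \<le> L2_sq ?m (A f) * L2_sq ?m f"
      unfolding L2_inner_eq_ip by (intro L2_Cauchy_Schwarz mL A f)
    also have "\<dots> \<le> (\<bar>C\<bar>\<^sup>2 * L2_sq ?m f) * L2_sq ?m f" by (intro mult_right_mono sq L2_sq_nonneg)
    also have "\<dots> = (\<bar>C\<bar> * L2_sq ?m f)\<^sup>2" by (simp add: power2_eq_square)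
    finally show "norm (L2_inner (A f) f) \<le> \<bar>C\<bar> * L2_sq ?m f"
      by (rule power2_le_imp_le) (simp add: L2_sq_nonneg)
  qed
qed

text \<open>Links two descriptions: Szego's factorization produces \<open>h\<close> as a boundary
  function, while \<open>A\<close> and its positivity are given on the model space.\<close>

lemma Kb_quadratic_form:
  assumes rep: "\<And>f g. f \<in> model_space 2 \<theta> \<Longrightarrow> bounded_ae f \<Longrightarrow> g \<in> model_space 2 \<theta> \<Longrightarrow>
      L2_inner (A f) g = (\<integral>z. \<phi> z * (f z * cnj (g z)) \<partial>circle_measure)"
    and h: "h \<in> Kb \<theta>" "bounded_ae h"
  obtains H where "H \<in> model_space 2 \<theta>" "L2_sq circle_measure H = L2_sq circle_measure h"
    "L2_inner (A H) H = (\<integral>z. \<phi> z * complex_of_real ((norm (h z))\<^sup>2) \<partial>circle_measure)"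
proof -
  obtain H where H: "H \<in> model_space 2 \<theta>" "\<And>z. norm z = 1 \<Longrightarrow> H z = h z"
    using Kb_imp_model_space[OF h(1)] by blast
  have "bounded_ae H"
  proof -
    obtain C where "AE z in circle_measure. norm (h z) \<le> C" using h(2) by (auto simp: bounded_ae_def)
    with AE_space have "AE z in circle_measure. norm (H z) \<le> C" by eventually_elim (simp add: H(2))
    then show ?thesis by (auto simp: bounded_ae_def)
  qed
  from rep[OF H(1) this H(1)]
  have "L2_inner (A H) H = (\<integral>z. \<phi> z * complex_of_real ((norm (h z))\<^sup>2) \<partial>circle_measure)"
    unfolding complex_norm_square
    by (rule trans) (rule Bochner_Integration.integral_cong, simp_all add: H(2))
  moreover have "L2_sq circle_measure H = L2_sq circle_measure h"
    unfolding L2_sq_def by (rule Bochner_Integration.integral_cong) (simp_all add: H(2))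
  ultimately show ?thesis using H(1) by (intro that)
qed

lemma Re_Im_integral:
  assumes "\<phi> \<in> L2 circle_measure" "h \<in> Kb \<theta>" "bounded_ae h"
  shows "(\<integral>z. Re (\<phi> z) * (norm (h z))\<^sup>2 \<partial>circle_measure) = Re (\<integral>z. \<phi> z * complex_of_real ((norm (h z))\<^sup>2) \<partial>circle_measure)"
    "(\<integral>z. Im (\<phi> z) * (norm (h z))\<^sup>2 \<partial>circle_measure) = Im (\<integral>z. \<phi> z * complex_of_real ((norm (h z))\<^sup>2) \<partial>circle_measure)"
proof -
  obtain C where C: "AE z in circle_measure. norm (h z) \<le> C" using assms(3) by (auto simp: bounded_ae_def)
  note [measurable] = L2_measurable[OF Kb_L2[OF assms(2)]]
  have "integrable circle_measure (\<lambda>z. \<phi> z * complex_of_real ((norm (h z))\<^sup>2))"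
    by (rule integrable_mult_bounded(1)[OF L2_circle_integrable[OF assms(1)], where C = "C\<^sup>2"])
      (use C in \<open>auto elim!: eventually_mono intro: power_mono simp: norm_power\<close>)
  then show "(\<integral>z. Re (\<phi> z) * (norm (h z))\<^sup>2 \<partial>circle_measure) = Re (\<integral>z. \<phi> z * complex_of_real ((norm (h z))\<^sup>2) \<partial>circle_measure)"
    "(\<integral>z. Im (\<phi> z) * (norm (h z))\<^sup>2 \<partial>circle_measure) = Im (\<integral>z. \<phi> z * complex_of_real ((norm (h z))\<^sup>2) \<partial>circle_measure)"
    by (simp_all flip: integral_Re integral_Im del: of_real_power)
qed

lemma symbol_split:
  assumes \<phi>: "\<phi> \<in> L2 circle_measure" and f: "f \<in> Kb \<theta>" "bounded_ae f" and g: "g \<in> Kb \<theta>"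
  shows "(\<integral>z. \<phi> z * (f z * cnj (g z)) \<partial>circle_measure) =
    (\<integral>z. complex_of_real (Re (\<phi> z)) * (f z * cnj (g z)) \<partial>circle_measure)
    + \<i> * (\<integral>z. complex_of_real (Im (\<phi> z)) * (f z * cnj (g z)) \<partial>circle_measure)"
proof -
  obtain C where C: "AE z in circle_measure. norm (f z) \<le> C" using f(2) by (auto simp: bounded_ae_def)
  have int: "integrable circle_measure (\<lambda>z. \<xi> z * (f z * cnj (g z)))" if "\<xi> \<in> L2 circle_measure" for \<xi>
    using L2_mult_integrable[OF L2_mult_bounded(2)[OF that L2_measurable[OF Kb_L2[OF f(1)]] C] L2_cnj[OF Kb_L2[OF g]]]
    by (simp add: mult.assoc)
  have "(\<integral>z. \<phi> z * (f z * cnj (g z)) \<partial>circle_measure) =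
      (\<integral>z. complex_of_real (Re (\<phi> z)) * (f z * cnj (g z)) + \<i> * (complex_of_real (Im (\<phi> z)) * (f z * cnj (g z))) \<partial>circle_measure)"
    by (subst complex_eq) (simp add: distrib_right mult.assoc)
  then show ?thesis using int[OF Re_Im_L2(1)[OF \<phi>]] int[OF Re_Im_L2(2)[OF \<phi>]] by simp
qed

text \<open>Each of the four measures adds \<open>\<bar>K\<bar>\<close> to the bound for the total
  variation, hence the Carleson constant \<open>sqrt (4 * \<bar>K\<bar>)\<close>.\<close>

lemma Carleson_quasisymbol:
  assumes "four_circle_measures A B C D"
    and bound: "\<And>f N. f \<in> Kb \<theta> \<Longrightarrow> continuous_on circle f \<Longrightarrow> N \<in> {A, B, C, D} \<Longrightarrow>
      (\<integral>z. (norm (f z))\<^sup>2 \<partial>N) \<le> K * L2_sq circle_measure f"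
    and rep: "\<And>f g. f \<in> model_space 2 \<theta> \<Longrightarrow> g \<in> model_space 2 \<theta> \<Longrightarrow>
      continuous_on circle f \<Longrightarrow> continuous_on circle g \<Longrightarrow>
      L2_inner (T f) g = ((\<integral>z. f z * cnj (g z) \<partial>A) - (\<integral>z. f z * cnj (g z) \<partial>B))
        + \<i> * ((\<integral>z. f z * cnj (g z) \<partial>C) - (\<integral>z. f z * cnj (g z) \<partial>D))"
  shows "cm_of_measures A B C D \<in> Carleson 2 \<theta>" "quasisymbol \<theta> T (cm_of_measures A B C D)"
proof -
  interpret four_circle_measures A B C D by fact
  let ?\<mu> = "cm_of_measures A B C D"
  have circ: "continuous_on circle f" if "continuous_on (cball 0 1) f" for f :: "complex \<Rightarrow> complex"
    by (rule continuous_on_subset[OF that]) auto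
  have "Lp_norm (total_variation ?\<mu>) 2 f \<le> sqrt (4 * \<bar>K\<bar>) * Lp_norm circle_measure 2 f"
    if f: "f \<in> model_space 2 \<theta>" and cont: "continuous_on (cball 0 1) f" for f
  proof -
    let ?s = "L2_sq circle_measure f"
    have "(\<lambda>z. (norm (f z))\<^sup>2) \<in> borel_measurable circle_borel"
      by (intro borel_measurable_continuous_on_restrict continuous_intros circ[OF cont])
    then have fm: "(\<lambda>z. ennreal ((norm (f z))\<^sup>2)) \<in> borel_measurable circle_borel"
      by (rule measurable_compose[OF _ measurable_ennreal])
    have s: "?s \<ge> 0" by (rule L2_sq_nonneg)
    have nn: "(\<integral>\<^sup>+z. ennreal ((norm (f z))\<^sup>2) \<partial>N) \<le> ennreal (\<bar>K\<bar> * ?s)"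
      if N: "N \<in> {A, B, C, D}" for N
    proof -
      have "integrable N (\<lambda>z. complex_of_real ((norm (f z))\<^sup>2))"
        using N fin sets circ[OF cont] by (intro integrable_continuous_circle continuous_intros) auto
      then have "integrable N (\<lambda>z. (norm (f z))\<^sup>2)" using integrable_Re by fastforce
      then have "(\<integral>\<^sup>+z. ennreal ((norm (f z))\<^sup>2) \<partial>N) = ennreal (\<integral>z. (norm (f z))\<^sup>2 \<partial>N)"
        by (rule nn_integral_eq_integral) simp
      also have "\<dots> \<le> ennreal (\<bar>K\<bar> * ?s)"
        using bound[OF model_space_imp_Kb[OF f] circ[OF cont] N] mult_right_mono[OF abs_ge_self[of K] s]
        by (intro ennreal_leI) linarith
      finally show ?thesis .
    qed
    have "(\<integral>\<^sup>+z. ennreal ((norm (f z))\<^sup>2) \<partial>total_variation ?\<mu>) \<le>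
        ((\<integral>\<^sup>+z. ennreal ((norm (f z))\<^sup>2) \<partial>A) + (\<integral>\<^sup>+z. ennreal ((norm (f z))\<^sup>2) \<partial>B))
        + ((\<integral>\<^sup>+z. ennreal ((norm (f z))\<^sup>2) \<partial>C) + (\<integral>\<^sup>+z. ennreal ((norm (f z))\<^sup>2) \<partial>D))"
      by (rule nn_integral_total_variation_cm_of_measures[OF fm])
    also have "\<dots> \<le> (ennreal (\<bar>K\<bar> * ?s) + ennreal (\<bar>K\<bar> * ?s)) + (ennreal (\<bar>K\<bar> * ?s) + ennreal (\<bar>K\<bar> * ?s))"
      by (intro add_mono nn) auto
    also have "\<dots> = ennreal (4 * \<bar>K\<bar> * ?s)"
      using s by (simp add: ennreal_plus[symmetric] del: ennreal_plus)
    finally have "L2_sq (total_variation ?\<mu>) f \<le> 4 * \<bar>K\<bar> * ?s"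
      unfolding L2_sq_def[of "total_variation ?\<mu>"] using s by (intro integral_real_bounded) auto
    then show ?thesis unfolding Lp_norm_2 real_sqrt_mult[symmetric] by (rule real_sqrt_le_mono)
  qed
  then show "?\<mu> \<in> Carleson 2 \<theta>"
    using complex_measure_cm_of_measures by (auto simp: Carleson_def)
  have "L2_inner (T f) g = cm_integral ?\<mu> (\<lambda>z. f z * cnj (g z))"
    if f: "f \<in> model_space 2 \<theta>" "continuous_on (cball 0 1) f" and g: "g \<in> model_space 2 \<theta>" "continuous_on (cball 0 1) g" for f g
  proof -
    have cont: "continuous_on circle (\<lambda>z. f z * cnj (g z))"
      by (intro continuous_intros circ f g)
    obtain M where "\<And>z. z \<in> circle \<Longrightarrow> norm (f z * cnj (g z)) \<le> M"
      by (fact continuous_on_circle_bounded[OF cont])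
    then show ?thesis
      using cm_integral_cm_of_measures[OF borel_measurable_continuous_on_restrict[OF cont], of M]
        rep[OF f(1) g(1) circ[OF f(2)] circ[OF g(2)]] by simp
  qed
  then show "quasisymbol \<theta> T ?\<mu>"
    using complex_measure_cm_of_measures by (auto simp: quasisymbol_def)
qed

text \<open>The form of the real part of the symbol is nonnegative and receives a measure
  \<open>N\<close>; that of the imaginary part is 0 and contributes nothing by polarization. The
  boundedness of \<open>A\<close> becomes the Carleson estimate for \<open>N\<close>.\<close>

lemma nonneg_TTO_quasisymbol:
  assumes A: "bounded_TTO \<theta> A" "nonneg_operator \<theta> A"
  shows "\<exists>\<mu>\<in>Carleson_nonneg 2 \<theta>. quasisymbol \<theta> A \<mu>"
proof -
  let ?m = circle_measure
  obtain \<phi> K where \<phi>: "\<phi> \<in> L2 ?m" and K: "0 \<le> K"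
    and rep: "\<And>f g. f \<in> model_space 2 \<theta> \<Longrightarrow> bounded_ae f \<Longrightarrow> g \<in> model_space 2 \<theta> \<Longrightarrow>
      L2_inner (A f) g = (\<integral>z. \<phi> z * (f z * cnj (g z)) \<partial>?m)"
    and bd: "\<And>f. f \<in> model_space 2 \<theta> \<Longrightarrow> norm (L2_inner (A f) f) \<le> K * L2_sq ?m f"
    by (fact bounded_TTO_symbol[OF A(1)])
  have form: "0 \<le> (\<integral>z. Re (\<phi> z) * (norm (h z))\<^sup>2 \<partial>?m)" "(\<integral>z. Im (\<phi> z) * (norm (h z))\<^sup>2 \<partial>?m) = 0"
    "(\<integral>z. Re (\<phi> z) * (norm (h z))\<^sup>2 \<partial>?m) \<le> K * L2_sq ?m h" if h: "h \<in> Kb \<theta>" "bounded_ae h" for h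
  proof -
    obtain H where H: "H \<in> model_space 2 \<theta>" "L2_sq ?m H = L2_sq ?m h"
      "L2_inner (A H) H = (\<integral>z. \<phi> z * complex_of_real ((norm (h z))\<^sup>2) \<partial>?m)"
    proof (rule Kb_quadratic_form[OF _ h])
      show "L2_inner (A f) g = (\<integral>z. \<phi> z * (f z * cnj (g z)) \<partial>?m)"
        if "f \<in> model_space 2 \<theta>" "bounded_ae f" "g \<in> model_space 2 \<theta>" for f g
        by (rule rep[OF that])
    qed
    have "L2_inner (A H) H \<in> \<real>\<^sub>\<ge>\<^sub>0" using A(2) H(1) by (simp add: nonneg_operator_def)
    then show "0 \<le> (\<integral>z. Re (\<phi> z) * (norm (h z))\<^sup>2 \<partial>?m)" "(\<integral>z. Im (\<phi> z) * (norm (h z))\<^sup>2 \<partial>?m) = 0"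
      unfolding Re_Im_integral[OF \<phi> h] H(3)[symmetric] complex_nonneg_Reals_iff by auto
    show "(\<integral>z. Re (\<phi> z) * (norm (h z))\<^sup>2 \<partial>?m) \<le> K * L2_sq ?m h"
      unfolding Re_Im_integral[OF \<phi> h] H(3)[symmetric] H(2)[symmetric]
      using bd[OF H(1)] complex_Re_le_cmod[of "L2_inner (A H) H"] by linarith
  qed
  obtain N where N: "finite_measure N" "sets N = sets circle_borel"
    "\<And>h. h \<in> Kb \<theta> \<Longrightarrow> continuous_on circle h \<Longrightarrow>
      (\<integral>z. (norm (h z))\<^sup>2 \<partial>N) = (\<integral>z. Re (\<phi> z) * (norm (h z))\<^sup>2 \<partial>?m)"
  proof (rule representing_measure[OF Re_Im_L2(1)[OF \<phi>]])
    show "0 \<le> (\<integral>z. Re (\<phi> z) * (norm (h z))\<^sup>2 \<partial>?m)" if "h \<in> Kb \<theta>" "bounded_ae h" for h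
      by (rule form(1)[OF that])
  next
    fix N assume "finite_measure N" "sets N = sets circle_borel"
      "\<And>h. h \<in> Kb \<theta> \<Longrightarrow> continuous_on circle h \<Longrightarrow>
        (\<integral>z. (norm (h z))\<^sup>2 \<partial>N) = (\<integral>z. Re (\<phi> z) * (norm (h z))\<^sup>2 \<partial>?m)"
    then show thesis by (rule that)
  qed
  let ?O = "null_measure circle_borel"
  have four: "four_circle_measures N ?O ?O ?O"
    by (intro four_circle_measures.intro N(1,2) finite_null_measure sets_null_measure)
  have bound: "(\<integral>z. (norm (f z))\<^sup>2 \<partial>M) \<le> K * L2_sq ?m f"
    if "f \<in> Kb \<theta>" "continuous_on circle f" "M \<in> {N, ?O, ?O, ?O}" for f M
    using that N(3)[OF that(1,2)] form(3)[OF that(1) bounded_ae_continuous[OF that(2)]] K L2_sq_nonneg[of ?m f] by auto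
  have eq: "L2_inner (A f) g = ((\<integral>z. f z * cnj (g z) \<partial>N) - (\<integral>z. f z * cnj (g z) \<partial>?O))
        + \<i> * ((\<integral>z. f z * cnj (g z) \<partial>?O) - (\<integral>z. f z * cnj (g z) \<partial>?O))"
    if f: "f \<in> model_space 2 \<theta>" and g: "g \<in> model_space 2 \<theta>"
      and c: "continuous_on circle f" "continuous_on circle g" for f g
  proof -
    note fK = model_space_imp_Kb[OF f] and gK = model_space_imp_Kb[OF g]
    note fb = bounded_ae_continuous[OF c(1)] and gb = bounded_ae_continuous[OF c(2)]
    have "(\<integral>z. f z * cnj (g z) \<partial>N) = (\<integral>z. complex_of_real (Re (\<phi> z)) * (f z * cnj (g z)) \<partial>?m)"
      by (rule polarize_measure[OF Re_Im_L2(1)[OF \<phi>] N fK c(1) gK c(2)])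
    moreover have "(\<integral>z. complex_of_real (Im (\<phi> z)) * (f z * cnj (g z)) \<partial>?m) = 0"
      by (rule polarize_symbol[OF Re_Im_L2(2)[OF \<phi>] fK fb gK gb form(2)])
    ultimately show ?thesis
      unfolding rep[OF f fb g] symbol_split[OF \<phi> fK fb gK] by simp
  qed
  have "nonneg_measure (cm_of_measures N ?O ?O ?O)"
    by (simp add: nonneg_measure_def cm_of_measures_def complex_nonneg_Reals_iff measure_def)
  moreover have "cm_of_measures N ?O ?O ?O \<in> Carleson 2 \<theta>"
    by (rule Carleson_quasisymbol(1)[OF four]) (fact bound, fact eq)
  ultimately have Carleson: "cm_of_measures N ?O ?O ?O \<in> Carleson_nonneg 2 \<theta>"
    by (simp add: Carleson_nonneg_def)
  have "quasisymbol \<theta> A (cm_of_measures N ?O ?O ?O)"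
    by (rule Carleson_quasisymbol(2)[OF four]) (fact bound, fact eq)
  then show ?thesis using Carleson by (rule bexI)
qed

text \<open>Adding a multiple of the identity, which has a constant symbol, makes the real and
  imaginary parts of the operator nonnegative.\<close>

lemma TTO_quasisymbol:
  assumes A: "bounded_TTO \<theta> A"
  shows "\<exists>\<mu>\<in>Carleson 2 \<theta>. quasisymbol \<theta> A \<mu>"
proof -
  let ?m = circle_measure
  obtain \<phi> K where \<phi>: "\<phi> \<in> L2 ?m" and K: "0 \<le> K"
    and rep: "\<And>f g. f \<in> model_space 2 \<theta> \<Longrightarrow> bounded_ae f \<Longrightarrow> g \<in> model_space 2 \<theta> \<Longrightarrow>
      L2_inner (A f) g = (\<integral>z. \<phi> z * (f z * cnj (g z)) \<partial>?m)"
    and bd: "\<And>f. f \<in> model_space 2 \<theta> \<Longrightarrow> norm (L2_inner (A f) f) \<le> K * L2_sq ?m f"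
    by (fact bounded_TTO_symbol[OF A])
  have form: "\<bar>\<integral>z. Re (\<phi> z) * (norm (h z))\<^sup>2 \<partial>?m\<bar> \<le> K * L2_sq ?m h" "\<bar>\<integral>z. Im (\<phi> z) * (norm (h z))\<^sup>2 \<partial>?m\<bar> \<le> K * L2_sq ?m h"
    if h: "h \<in> Kb \<theta>" "bounded_ae h" for h
  proof -
    obtain H where H: "H \<in> model_space 2 \<theta>" "L2_sq ?m H = L2_sq ?m h"
      "L2_inner (A H) H = (\<integral>z. \<phi> z * complex_of_real ((norm (h z))\<^sup>2) \<partial>?m)"
    proof (rule Kb_quadratic_form[OF _ h])
      show "L2_inner (A f) g = (\<integral>z. \<phi> z * (f z * cnj (g z)) \<partial>?m)"
        if "f \<in> model_space 2 \<theta>" "bounded_ae f" "g \<in> model_space 2 \<theta>" for f g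
        by (rule rep[OF that])
    qed
    show "\<bar>\<integral>z. Re (\<phi> z) * (norm (h z))\<^sup>2 \<partial>?m\<bar> \<le> K * L2_sq ?m h" "\<bar>\<integral>z. Im (\<phi> z) * (norm (h z))\<^sup>2 \<partial>?m\<bar> \<le> K * L2_sq ?m h"
      unfolding Re_Im_integral[OF \<phi> h] H(3)[symmetric] H(2)[symmetric]
      using bd[OF H(1)] abs_Re_le_cmod[of "L2_inner (A H) H"] abs_Im_le_cmod[of "L2_inner (A H) H"] by linarith+
  qed
  \<comment> \<open>The measure that represents \<open>K\<close> times the identity; it is
    subtracted again from both parts at the end.\<close>
  define KM where "KM = density ?m (\<lambda>_. ennreal K)"
  have KM: "finite_measure KM" "sets KM = sets circle_borel"
  proof -
    have "circle \<in> sets ?m" using sets.top[of ?m] by simp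
    then show "finite_measure KM"
      by (intro finite_measureI) (simp add: KM_def emeasure_density nn_integral_cmult_indicator ennreal_mult_eq_top_iff)
    show "sets KM = sets circle_borel" by (simp add: KM_def sets_circle_measure)
  qed
  have int_KM: "(\<integral>z. f z \<partial>KM) = complex_of_real K * (\<integral>z. f z \<partial>?m)" if "continuous_on circle f" for f :: "complex \<Rightarrow> complex"
    unfolding KM_def using K integral_density[of f ?m "\<lambda>_. K"] that by (simp add: scaleR_conv_of_real)
  have int_KM_real: "(\<integral>z. (norm (f z))\<^sup>2 \<partial>KM) = K * L2_sq ?m f" if "continuous_on circle f" for f :: "complex \<Rightarrow> complex"
  proof -
    have "(\<lambda>z. (norm (f z))\<^sup>2) \<in> borel_measurable ?m"
      by (intro continuous_circle_measurable continuous_intros that)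
    then show ?thesis
      unfolding KM_def L2_sq_def using K integral_density[of "\<lambda>z. (norm (f z))\<^sup>2" ?m "\<lambda>_. K"] by simp
  qed
  \<comment> \<open>One predicate for both parts of the symbol. The constant \<open>2 * K\<close> is
    the bound \<open>K\<close> of the form of \<open>\<xi>\<close> plus the shift by
    \<open>K\<close>.\<close>
  define P where "P \<xi> N \<longleftrightarrow> finite_measure N \<and> sets N = sets circle_borel \<and>
      (\<forall>f\<in>Kb \<theta>. continuous_on circle f \<longrightarrow> (\<integral>z. (norm (f z))\<^sup>2 \<partial>N) \<le> 2 * K * L2_sq ?m f) \<and>
      (\<forall>f\<in>Kb \<theta>. \<forall>g\<in>Kb \<theta>. continuous_on circle f \<longrightarrow> continuous_on circle g \<longrightarrow>
        (\<integral>z. f z * cnj (g z) \<partial>N) - (\<integral>z. f z * cnj (g z) \<partial>KM) = (\<integral>z. complex_of_real (\<xi> z) * (f z * cnj (g z)) \<partial>?m))"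
    for \<xi> N
  have shifted: "\<exists>N. P \<xi> N"
    if \<xi>: "(\<lambda>z. complex_of_real (\<xi> z)) \<in> L2 ?m"
      and \<xi>_bd: "\<And>h. h \<in> Kb \<theta> \<Longrightarrow> bounded_ae h \<Longrightarrow> \<bar>\<integral>z. \<xi> z * (norm (h z))\<^sup>2 \<partial>?m\<bar> \<le> K * L2_sq ?m h" for \<xi>
  proof -
    have shift_L2: "(\<lambda>z. complex_of_real (\<xi> z + K)) \<in> L2 ?m"
      using L2_add[OF \<xi> H2b_L2[OF const_H2b[of "complex_of_real K"]]] by simp
    have shift_int: "(\<integral>z. (\<xi> z + K) * (norm (h z))\<^sup>2 \<partial>?m) = (\<integral>z. \<xi> z * (norm (h z))\<^sup>2 \<partial>?m) + K * L2_sq ?m h"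
      if h: "h \<in> Kb \<theta>" "bounded_ae h" for h
      using symbol_integrable[OF \<xi> norm_sq_real_symbols[OF h]] L2_integrable_sq[OF Kb_L2[OF h(1)]]
      by (simp add: distrib_right L2_sq_def)
    obtain N where N: "finite_measure N" "sets N = sets circle_borel"
      "\<And>h. h \<in> Kb \<theta> \<Longrightarrow> continuous_on circle h \<Longrightarrow>
        (\<integral>z. (norm (h z))\<^sup>2 \<partial>N) = (\<integral>z. (\<xi> z + K) * (norm (h z))\<^sup>2 \<partial>?m)"
    proof (rule representing_measure[OF shift_L2])
      show "0 \<le> (\<integral>z. (\<xi> z + K) * (norm (h z))\<^sup>2 \<partial>?m)" if h: "h \<in> Kb \<theta>" "bounded_ae h" for h
        using shift_int[OF h] \<xi>_bd[OF h] by linarith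
    next
      fix N assume "finite_measure N" "sets N = sets circle_borel"
        "\<And>h. h \<in> Kb \<theta> \<Longrightarrow> continuous_on circle h \<Longrightarrow>
          (\<integral>z. (norm (h z))\<^sup>2 \<partial>N) = (\<integral>z. (\<xi> z + K) * (norm (h z))\<^sup>2 \<partial>?m)"
      then show thesis by (rule that)
    qed
    have "(\<integral>z. (norm (f z))\<^sup>2 \<partial>N) \<le> 2 * K * L2_sq ?m f" if f: "f \<in> Kb \<theta>" "continuous_on circle f" for f
      using N(3)[OF f] shift_int[OF f(1) bounded_ae_continuous[OF f(2)]] \<xi>_bd[OF f(1) bounded_ae_continuous[OF f(2)]]
      by linarith
    moreover have "(\<integral>z. f z * cnj (g z) \<partial>N) - (\<integral>z. f z * cnj (g z) \<partial>KM) = (\<integral>z. complex_of_real (\<xi> z) * (f z * cnj (g z)) \<partial>?m)"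
      if f: "f \<in> Kb \<theta>" "continuous_on circle f" and g: "g \<in> Kb \<theta>" "continuous_on circle g" for f g
    proof -
      have fgc: "continuous_on circle (\<lambda>z. f z * cnj (g z))" by (intro continuous_intros f g)
      obtain C where C: "AE z in ?m. norm (f z) \<le> C" using bounded_ae_continuous[OF f(2)] by (auto simp: bounded_ae_def)
      have i1: "integrable ?m (\<lambda>z. complex_of_real (\<xi> z) * (f z * cnj (g z)))"
        using L2_mult_integrable[OF L2_mult_bounded(2)[OF \<xi> L2_measurable[OF Kb_L2[OF f(1)]] C] L2_cnj[OF Kb_L2[OF g(1)]]]
        by (simp add: mult.assoc)
      have i2: "integrable ?m (\<lambda>z. f z * cnj (g z))" by (rule ip_integrable[OF Kb_L2[OF f(1)] Kb_L2[OF g(1)]])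
      have "(\<integral>z. f z * cnj (g z) \<partial>N) = (\<integral>z. complex_of_real (\<xi> z + K) * (f z * cnj (g z)) \<partial>?m)"
        by (rule polarize_measure[OF shift_L2 N f g])
      also have "\<dots> = (\<integral>z. complex_of_real (\<xi> z) * (f z * cnj (g z)) + complex_of_real K * (f z * cnj (g z)) \<partial>?m)"
        by (simp add: distrib_right)
      also have "\<dots> = (\<integral>z. complex_of_real (\<xi> z) * (f z * cnj (g z)) \<partial>?m) + complex_of_real K * (\<integral>z. f z * cnj (g z) \<partial>?m)"
        using i1 i2 by simp
      finally show ?thesis unfolding int_KM[OF fgc] by simp
    qed
    ultimately have "P \<xi> N" unfolding P_def using N(1,2) by (intro conjI ballI impI)
    then show ?thesis ..
  qed
  have "\<exists>N. P (\<lambda>z. Re (\<phi> z)) N"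
    by (rule shifted[OF Re_Im_L2(1)[OF \<phi>]]) (rule form(1))
  moreover have "\<exists>N. P (\<lambda>z. Im (\<phi> z)) N"
    by (rule shifted[OF Re_Im_L2(2)[OF \<phi>]]) (rule form(2))
  ultimately obtain N1 N2 where P: "P (\<lambda>z. Re (\<phi> z)) N1" "P (\<lambda>z. Im (\<phi> z)) N2" by (elim exE)
  note N1 = P(1)[unfolded P_def, THEN conjunct1] P(1)[unfolded P_def, THEN conjunct2, THEN conjunct1]
      P(1)[unfolded P_def, THEN conjunct2, THEN conjunct2, THEN conjunct1, rule_format]
      P(1)[unfolded P_def, THEN conjunct2, THEN conjunct2, THEN conjunct2, rule_format]
    and N2 = P(2)[unfolded P_def, THEN conjunct1] P(2)[unfolded P_def, THEN conjunct2, THEN conjunct1]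
      P(2)[unfolded P_def, THEN conjunct2, THEN conjunct2, THEN conjunct1, rule_format]
      P(2)[unfolded P_def, THEN conjunct2, THEN conjunct2, THEN conjunct2, rule_format]
  have four: "four_circle_measures N1 KM N2 KM"
    by (intro four_circle_measures.intro N1(1,2) N2(1,2) KM)
  have bound: "(\<integral>z. (norm (f z))\<^sup>2 \<partial>M) \<le> 2 * K * L2_sq ?m f"
    if "f \<in> Kb \<theta>" "continuous_on circle f" "M \<in> {N1, KM, N2, KM}" for f M
    using that N1(3)[OF that(1,2)] N2(3)[OF that(1,2)] int_KM_real[OF that(2)] mult_nonneg_nonneg[OF K L2_sq_nonneg[of ?m f]]
    by auto
  have eq: "L2_inner (A f) g = ((\<integral>z. f z * cnj (g z) \<partial>N1) - (\<integral>z. f z * cnj (g z) \<partial>KM))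
        + \<i> * ((\<integral>z. f z * cnj (g z) \<partial>N2) - (\<integral>z. f z * cnj (g z) \<partial>KM))"
    if f: "f \<in> model_space 2 \<theta>" and g: "g \<in> model_space 2 \<theta>"
      and c: "continuous_on circle f" "continuous_on circle g" for f g
  proof -
    note fK = model_space_imp_Kb[OF f] and gK = model_space_imp_Kb[OF g]
    note fb = bounded_ae_continuous[OF c(1)]
    show ?thesis
      unfolding rep[OF f fb g] symbol_split[OF \<phi> fK fb gK] N1(4)[OF fK gK c] N2(4)[OF fK gK c] ..
  qed
  have Carleson: "cm_of_measures N1 KM N2 KM \<in> Carleson 2 \<theta>"
    by (rule Carleson_quasisymbol(1)[OF four]) (fact bound, fact eq)
  have "quasisymbol \<theta> A (cm_of_measures N1 KM N2 KM)"
    by (rule Carleson_quasisymbol(2)[OF four]) (fact bound, fact eq)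
  then show ?thesis using Carleson by (rule bexI)
qed

end

theorem theorem2p1:
  fixes \<theta> :: "complex \<Rightarrow> complex"
  assumes "inner_function \<theta>"
  shows "(\<forall>A. bounded_TTO \<theta> A \<and> nonneg_operator \<theta> A \<longrightarrow>
            (\<exists>\<mu> \<in> Carleson_nonneg 2 \<theta>. quasisymbol \<theta> A \<mu>)) \<and>
         (\<forall>A. bounded_TTO \<theta> A \<longrightarrow> (\<exists>\<mu> \<in> Carleson 2 \<theta>. quasisymbol \<theta> A \<mu>))"
proof -
  interpret inner_boundary \<theta> by (rule inner_boundary_inner_function[OF assms])
  show ?thesis using nonneg_TTO_quasisymbol TTO_quasisymbol by blast
qed

end
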